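(* Let $S$ be a compact metric space and let $\bm U,\bm U^{(1)},\bm U^{(2)},\ldots$ be iid copula processes on $S$ satisfying $\bm U\in\mathcal D(\bm\eta)$, where $\bm\eta=(\eta_s)_{s\in S}$ is a standard max-stable process with corresponding $D$-norm $\|\cdot\|_D$. Suppose that the generator $\bm Z$ of $\|\cdot\|_D$ fulfills $P(\bm Z>0)>0$. Then, for every $f\in\bar E^-(S)$, $$P\left(n(\bm U^{(n)}-1)>f\,\Big|\,\bm U^{(n)}\text{ is a complete record}\right)\longrightarrow \frac{E\left(\wr\!\wr\max(\bm\eta,f)\wr\!\wr_D\right)}{E\left(\wr\!\wr\bm\eta\wr\!\wr_D\right)}\qquad(n\to\infty).$$
   Context: All operations and relations ($\max$, $>$, $\le$, ...) between functions are meant pointwise on $S$; in particular $\bm Z>0$ means $Z_s>0$ for all $s\in S$. $C(S)$ is the space of continuous real functions on $S$ with the sup-norm; $\bar C^+(S)=\{f\in C(S): f\ge 0\}$; $E(S)$ is the set of bounded functions $f:S\to\mathbb R$ with only finitely many discontinuities, and $\bar E^-(S)=\{f\in E(S): f\le 0\}$. A standard max-stable process (SMSP) is a process $\bm\eta=(\eta_s)_{s\in S}$ with sample paths in $C(S)$, margins $P(\eta_s\le x)=e^x$ for $x\le 0$, $s\in S$, and such that $n\max_{1\le i\le n}\bm\eta^{(i)}$ has the same distribution as $\bm\eta$ for every $n$, where $\bm\eta^{(i)}$ are iid copies of $\bm\eta$. For every SMSP there is a process $\bm Z=(Z_s)_{s\in S}$ with sample paths in $\bar C^+(S)$, $E(Z_s)=1$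 for all $s$, $E(\sup_{s}Z_s)<\infty$, such that $P(\bm\eta\le f)=\exp(-\|f\|_D)$ for $f\in\bar E^-(S)$, where $\|f\|_D:=E(\sup_{s\in S}|f(s)|Z_s)$, $f\in E(S)$. The norm $\|\cdot\|_D$ on $E(S)$ is the $D$-norm corresponding to $\bm\eta$ and $\bm Z$ is called a generator of it. The dual $D$-norm function is $\wr\!\wr f\wr\!\wr_D:=E(\inf_{s\in S}|f(s)|Z_s)$, $f\in E(S)$; it does not depend on the choice of the generator. $E(\wr\!\wr\bm\eta\wr\!\wr_D)$ and $E(\wr\!\wr\max(\bm\eta,f)\wr\!\wr_D)$ are expectations of the function $\wr\!\wr\cdot\wr\!\wr_D$ evaluated at the indicated random functions. A copula process is a process $\bm U=(U_s)_{s\in S}$ with sample paths in $C(S)$ and each $U_s$ uniformly distributed on $(0,1)$. $\bm U\in\mathcal D(\bm\eta)$ means that $n(\max_{1\le i\le n}\bm U^{(i)}-1)\to\bm\eta$ in distribution in $(C(S),\|\cdot\|_\infty)$. $\bm U^{(n)}$ is a complete record if $\bm U^{(n)}>\max_{1\le i\le n-1}\bm U^{(i)}$. *)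

theory Defs
  imports "HOL-Probability.Probability"
begin

text \<open>
  Throughout, the compact metric space \<open>S\<close> is a type of class metric_space whose universe
  is compact (this is assumed in the theorem).  Then every continuous function is bounded and
  \<open>'s \<Rightarrow>\<^sub>C real\<close> with its sup-distance is the space \<open>C(S)\<close>.  A process with sample
  paths in \<open>C(S)\<close> is a Borel random element of \<open>'s \<Rightarrow>\<^sub>C real\<close>; as \<open>C(S)\<close> is separable, this is
  the same as measurability of every coordinate \<open>\<lambda>\<omega>. X \<omega> s\<close>, and the Borel sigma-algebra of
  \<open>C(S)\<close> is the one generated by the evaluations.
\<close>

definition E_space :: "('s::metric_space \<Rightarrow> real) set" where
  "E_space = {f. bounded (range f) \<and> finite {s. \<not> isCont f s}}"

definition E_minus :: "('s::metric_space \<Rightarrow> real) set" where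
  "E_minus = {f \<in> E_space. \<forall>s. f s \<le> 0}"

definition bcontfun_Max :: "nat set \<Rightarrow> (nat \<Rightarrow> ('s::metric_space \<Rightarrow>\<^sub>C real)) \<Rightarrow> ('s \<Rightarrow>\<^sub>C real)" where
  "bcontfun_Max I x = Bcontfun (\<lambda>s. MAX i\<in>I. x i s)"

text \<open>Law of the pointwise maximum of \<open>n\<close> iid copies (\<open>n \<ge> 1\<close>) of a process with law \<open>\<mu>\<close>.\<close>

definition max_law :: "nat \<Rightarrow> ('s::metric_space \<Rightarrow>\<^sub>C real) measure \<Rightarrow> ('s \<Rightarrow>\<^sub>C real) measure" where
  "max_law n \<mu> = distr (PiM {1..n} (\<lambda>_. \<mu>)) borel (bcontfun_Max {1..n})"

definition weakly_converges :: "(nat \<Rightarrow> 'a::metric_space measure) \<Rightarrow> 'a measure \<Rightarrow> bool" where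
  "weakly_converges \<mu> \<nu> \<longleftrightarrow>
     (\<forall>\<phi> :: 'a \<Rightarrow> real. continuous_on UNIV \<phi> \<longrightarrow> bounded (range \<phi>) \<longrightarrow>
        (\<lambda>n. \<integral>x. \<phi> x \<partial>\<mu> n) \<longlonglongrightarrow> (\<integral>x. \<phi> x \<partial>\<nu>))"

definition standard_max_stable :: "'b measure \<Rightarrow> ('b \<Rightarrow> ('s::metric_space \<Rightarrow>\<^sub>C real)) \<Rightarrow> bool" where
  "standard_max_stable N \<eta> \<longleftrightarrow>
     \<eta> \<in> borel_measurable N \<and>
     (\<forall>s. \<forall>x\<le>0. \<P>(\<omega> in N. \<eta> \<omega> s \<le> x) = exp x) \<and>
     (\<forall>n\<ge>1. distr (max_law n (distr N borel \<eta>)) borel (\<lambda>g. real n *\<^sub>R g) = distr N borel \<eta>)"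

definition D_norm :: "'c measure \<Rightarrow> ('c \<Rightarrow> ('s::metric_space \<Rightarrow>\<^sub>C real)) \<Rightarrow> ('s \<Rightarrow> real) \<Rightarrow> real" where
  "D_norm L Z f = (\<integral>\<omega>. (SUP s. \<bar>f s\<bar> * Z \<omega> s) \<partial>L)"

definition dual_D_norm :: "'c measure \<Rightarrow> ('c \<Rightarrow> ('s::metric_space \<Rightarrow>\<^sub>C real)) \<Rightarrow> ('s \<Rightarrow> real) \<Rightarrow> real" where
  "dual_D_norm L Z f = (\<integral>\<omega>. (INF s. \<bar>f s\<bar> * Z \<omega> s) \<partial>L)"

text \<open>
  \<open>Z\<close> (on \<open>L\<close>) is a generator of the \<open>D\<close>-norm corresponding to the standard max-stable
  process \<open>\<eta>\<close> (on \<open>N\<close>).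
\<close>

definition D_norm_generator ::
    "'c measure \<Rightarrow> ('c \<Rightarrow> ('s::metric_space \<Rightarrow>\<^sub>C real)) \<Rightarrow> 'b measure \<Rightarrow> ('b \<Rightarrow> ('s \<Rightarrow>\<^sub>C real)) \<Rightarrow> bool" where
  "D_norm_generator L Z N \<eta> \<longleftrightarrow>
     Z \<in> borel_measurable L \<and>
     (\<forall>\<omega>\<in>space L. \<forall>s. 0 \<le> Z \<omega> s) \<and>
     (\<forall>s. integrable L (\<lambda>\<omega>. Z \<omega> s) \<and> (\<integral>\<omega>. Z \<omega> s \<partial>L) = 1) \<and>
     integrable L (\<lambda>\<omega>. SUP s. Z \<omega> s) \<and>
     (\<forall>f\<in>E_minus. \<P>(\<omega> in N. \<forall>s. \<eta> \<omega> s \<le> f s) = exp (- D_norm L Z f))"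

definition copula_process :: "'a measure \<Rightarrow> ('a \<Rightarrow> ('s::metric_space \<Rightarrow>\<^sub>C real)) \<Rightarrow> bool" where
  "copula_process M U \<longleftrightarrow>
     U \<in> borel_measurable M \<and>
     (\<forall>s. distr M borel (\<lambda>\<omega>. U \<omega> s) = uniform_measure lborel {0<..<1})"

definition in_max_domain ::
    "'a measure \<Rightarrow> ('a \<Rightarrow> ('s::metric_space \<Rightarrow>\<^sub>C real)) \<Rightarrow> 'b measure \<Rightarrow> ('b \<Rightarrow> ('s \<Rightarrow>\<^sub>C real)) \<Rightarrow> bool" where
  "in_max_domain M U N \<eta> \<longleftrightarrow>
     weakly_converges
       (\<lambda>n. distr (max_law n (distr M borel U)) borel (\<lambda>g. real n *\<^sub>R (g - const_bcontfun 1)))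
       (distr N borel \<eta>)"

text \<open>The maximum over the empty family (\<open>n = 1\<close>) imposes no condition.\<close>

definition complete_record :: "(nat \<Rightarrow> 'a \<Rightarrow> ('s::metric_space \<Rightarrow>\<^sub>C real)) \<Rightarrow> nat \<Rightarrow> 'a \<Rightarrow> bool" where
  "complete_record U n \<omega> \<longleftrightarrow> (\<forall>i\<in>{1..<n}. \<forall>s. U i \<omega> s < U n \<omega> s)"

end

theory Submission
  imports Defs
begin

text \<open>
  Write \<open>h = n (U - 1)\<close> and \<open>\<Psi> g\<close> for the dual norm of \<open>g\<close>.  The core is \<open>n * P (h > g) \<longlonglongrightarrow> \<Psi> g\<close>.  For
  finitely many points it follows by inclusion-exclusion from
  \<open>P (h \<le> g)\<^sup>n = P (n (max U\<^sub>i - 1) \<le> g) \<longlonglongrightarrow> exp (- \<parallel>g\<parallel>)\<close>.  To pass to all of \<open>S\<close>, suppose that \<open>h\<close> exceeds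
  \<open>g + e\<close> at many points but not \<open>g\<close> everywhere; with probability bounded away from \<open>0\<close> the
  other observations are very small, and then the rescaled maximum oscillates in the same way, which
  is unlikely since its limit \<open>\<eta>\<close> has continuous paths.

  Conditioning on the first \<open>m\<close> observations, the probability that observation \<open>m + 1\<close> is a complete
  record above level \<open>f\<close> is asymptotically \<open>E (\<Psi> (max \<eta> f)) / m\<close>, by monotonicity of the survival
  function and tightness of the maxima.  To remove \<open>f\<close>, let the level decrease to \<open>-\<infinity>\<close>: by
  exchangeability \<open>n\<close> times the probability of a complete record below a level is at most the
  probability that the maximum is below this level.
\<close>

section \<open>Random elements of the space of continuous functions\<close>

text \<open>The factor \<open>n\<close> is the obstacle. The hypothesis is weak convergence of
  maxima, which sees only bounded continuous functionals, while a complete record has probability of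
  order \<open>1/n\<close>. Two devices bridge the gap: for finitely many points the
  \<open>n\<close>-th power of a distribution function is one of a maximum, and otherwise
  \<open>n\<close> disjoint events of equal probability turn \<open>n\<close> times a probability
  into a probability about the maximum alone.

  Weak convergence gives only inequalities with a slack in the level. The slack is harmless because
  the limit functional is Lipschitz in the level, with constant the \<open>D\<close>-norm of 1.

  Discontinuous functions enter twice: the finite-dimensional laws of \<eta> are read off from
  functions that vanish outside a finite set, and \<open>f\<close> itself may jump, so that events
  quantified over all of \<open>S\<close> are not determined by an arbitrary dense set.

  For a fixed \<open>f\<close> the limit functional is bounded, as \<open>f\<close> bounds the level
  from below. The conditioning event carries no such level, and there boundedness has to be replaced
  by an estimate uniform in \<open>n\<close>.\<close>

lemma compact_UNIV_nets:
  assumes "compact (UNIV :: 's::metric_space set)"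
  obtains K :: "nat \<Rightarrow> 's::metric_space set"
  where "\<And>n. finite (K n)" and "\<And>n s. \<exists>t\<in>K n. dist t s < 1 / real (Suc n)"
proof -
  have "\<exists>k::'s set. finite k \<and> (\<forall>s. \<exists>t\<in>k. dist t s < 1 / real (Suc n))" for n
  proof -
    have "0 < 1 / real (Suc n)" by simp
    then obtain k :: "'s set" where k: "finite k" "UNIV \<subseteq> (\<Union>x\<in>k. ball x (1 / real (Suc n)))"
      using assms unfolding compact_eq_totally_bounded by metis
    have "\<exists>t\<in>k. dist t s < 1 / real (Suc n)" for s
      using subsetD[OF k(2), of s] unfolding UN_iff mem_ball by blast
    with k(1) show ?thesis by blast
  qed
  then have "\<exists>K. \<forall>n. finite (K n) \<and> (\<forall>s. \<exists>t\<in>K n. dist t (s :: 's) < 1 / real (Suc n))"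
    by (intro choice allI)
  then show thesis using that by blast
qed

lemma compact_UNIV_countable_dense:
  assumes "compact (UNIV :: 's::metric_space set)"
  obtains Q :: "'s::metric_space set" where "countable Q" and "\<And>s e. e > 0 \<Longrightarrow> \<exists>q\<in>Q. dist q s < e"
proof -
  obtain K :: "nat \<Rightarrow> 's set"
    where K: "\<And>n. finite (K n)" "\<And>n s. \<exists>t\<in>K n. dist t s < 1 / real (Suc n)"
    using compact_UNIV_nets[OF assms] by blast
  show thesis
  proof
    show "countable (\<Union>n. K n)"
      using K(1) by (simp add: countable_finite)
    fix s :: 's and e :: real assume "e > 0"
    then obtain n where n: "1 / real (Suc n) < e"
      using nat_approx_posE by blast
    obtain q where q: "q \<in> K n" "dist q s < 1 / real (Suc n)"
      using K(2) by blast
    show "\<exists>q\<in>(\<Union>n. K n). dist q s < e"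
    proof
      show "q \<in> (\<Union>n. K n)" using q(1) by blast
    qed (use q n in linarith)
  qed
qed

text \<open>Uniform continuity lets a function be described up to \<open>3 * e\<close> by countable
  data: the fineness of a net adapted to it, and its rounded values on this net. One representative
  for each description is enough.\<close>

lemma compact_UNIV_bcontfun_separable:
  assumes cpt: "compact (UNIV :: 's::metric_space set)"
  obtains F :: "('s::metric_space \<Rightarrow>\<^sub>C real) set" where "countable F" and "\<And>x e. e > 0 \<Longrightarrow> \<exists>y\<in>F. dist y x < e"
proof -
  have "\<exists>F :: ('s \<Rightarrow>\<^sub>C real) set. countable F \<and> (\<forall>x. \<exists>y\<in>F. dist y x \<le> 3 * e)" if e: "e > 0" for e :: real
  proof -
    obtain K :: "nat \<Rightarrow> 's set"
      where K: "\<And>n. finite (K n)" "\<And>n s. \<exists>t\<in>K n. dist t s < 1 / real (Suc n)"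
      using compact_UNIV_nets[OF assms] by blast
    have "\<exists>n. \<forall>s t. dist s t < 1 / real (Suc n) \<longrightarrow> \<bar>x s - x t\<bar> < e" for x :: "'s \<Rightarrow>\<^sub>C real"
    proof -
      have "uniformly_continuous_on UNIV (apply_bcontfun x)"
        using cpt compact_uniformly_continuous continuous_on_apply_bcontfun by blast
      with e obtain d where d: "d > 0" "\<And>s t. dist s t < d \<Longrightarrow> dist (x s) (x t) < e"
        unfolding uniformly_continuous_on_def by (metis UNIV_I)
      obtain n where "1 / real (Suc n) < d" using nat_approx_posE[OF d(1)] .
      then show ?thesis using d(2) unfolding dist_real_def
        by (meson order_less_trans)
    qed
    then obtain m :: "('s \<Rightarrow>\<^sub>C real) \<Rightarrow> nat"
      where m: "\<And>x s t. dist s t < 1 / real (Suc (m x)) \<Longrightarrow> \<bar>x s - x t\<bar> < e"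
      by metis
    \<comment> \<open>Equal codes mean the same net and values at its points differing by less than
      \<open>e\<close>; moving from \<open>s\<close> to a net point costs another \<open>e\<close>
      for each of the two functions, hence \<open>3 * e\<close>.\<close>
    define code where
      "code x = (m x, restrict (\<lambda>t. \<lfloor>apply_bcontfun x t / e\<rfloor>) (K (m x)))" for x
    have "range code \<subseteq> (SIGMA n:UNIV. K n \<rightarrow>\<^sub>E UNIV)"
      by (auto simp: code_def)
    moreover have "countable (SIGMA n:UNIV. K n \<rightarrow>\<^sub>E (UNIV :: int set))"
      using K(1) by (intro countable_SIGMA countable_PiE) auto
    ultimately have "countable (range code)"
      using countable_subset by blast
    moreover have "dist (inv code (code x)) x \<le> 3 * e" for x
    proof -
      define y where "y = inv code (code x)"
      have "code y = code x"
        unfolding y_def by (simp add: f_inv_into_f)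
      then have my: "m y = m x"
        and "restrict (\<lambda>t. \<lfloor>y t / e\<rfloor>) (K (m x)) = restrict (\<lambda>t. \<lfloor>x t / e\<rfloor>) (K (m x))"
        by (auto simp: code_def)
      then have eq: "\<lfloor>y t / e\<rfloor> = \<lfloor>x t / e\<rfloor>" if "t \<in> K (m x)" for t
        using that by (metis (no_types, lifting) restrict_apply')
      have "dist y x \<le> 3 * e"
      proof (rule dist_bound)
        fix s
        obtain t where t: "t \<in> K (m x)" "dist s t < 1 / real (Suc (m x))"
          using K(2)[where n = "m x" and s = s] unfolding dist_commute[of _ s] by blast
        have "\<bar>x s - x t\<bar> < e" "\<bar>y s - y t\<bar> < e"
          using m[of s t x] m[of s t y] t(2) my by auto
        moreover have "\<bar>y t / e - x t / e\<bar> < 1"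
          using eq[OF t(1)] by linarith
        then have "\<bar>y t - x t\<bar> < e"
          using e by (simp add: diff_divide_distrib[symmetric] abs_divide field_simps)
        ultimately show "dist (y s) (x s) \<le> 3 * e"
          unfolding dist_real_def by linarith
      qed
      then show ?thesis by (simp add: y_def)
    qed
    ultimately show ?thesis
      by (intro exI[of _ "inv code ` range code"]) auto
  qed
  from this[of "1 / real (Suc n)" for n] have "\<exists>F :: ('s \<Rightarrow>\<^sub>C real) set. countable F \<and> (\<forall>x. \<exists>y\<in>F. dist y x \<le> 3 * (1 / real (Suc n)))" for n
    by simp
  then obtain F :: "nat \<Rightarrow> ('s \<Rightarrow>\<^sub>C real) set"
    where F: "\<And>n. countable (F n)" "\<And>n x. \<exists>y\<in>F n. dist y x \<le> 3 * (1 / real (Suc n))"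
    by metis
  show thesis
  proof
    show "countable (\<Union>n. F n)" using F(1) by simp
    fix x :: "'s \<Rightarrow>\<^sub>C real" and e :: real assume "e > 0"
    then obtain n where n: "1 / real (Suc n) < e / 3"
      using nat_approx_posE[of "e / 3"] by auto
    obtain y where "y \<in> F n" "dist y x \<le> 3 * (1 / real (Suc n))"
      using F(2) by blast
    with n show "\<exists>y\<in>(\<Union>n. F n). dist y x < e"
      by (intro bexI[of _ y]) auto
  qed
qed

text \<open>A closed ball is cut out by countably many coordinates, those in a dense set, and by
  separability every open set is a countable union of closed balls.\<close>

lemma borel_measurable_bcontfunI:
  fixes X :: "'a \<Rightarrow> ('s::metric_space \<Rightarrow>\<^sub>C real)"
  assumes cpt: "compact (UNIV :: 's set)" and X: "\<And>s. (\<lambda>\<omega>. X \<omega> s) \<in> borel_measurable M"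
  shows "X \<in> borel_measurable M"
proof -
  obtain Q :: "'s set" where Q: "countable Q" "\<And>s e. e > 0 \<Longrightarrow> \<exists>q\<in>Q. dist q s < e"
    using compact_UNIV_countable_dense[OF cpt] by blast
  obtain F :: "('s \<Rightarrow>\<^sub>C real) set" where F: "countable F" "\<And>x e. e > 0 \<Longrightarrow> \<exists>y\<in>F. dist y x < e"
    using compact_UNIV_bcontfun_separable[OF cpt] by blast
  have Qne: "\<exists>q. q \<in> Q" using Q(2)[of 1] by force
  have dense: "dist x y \<le> r" if "\<forall>q\<in>Q. \<bar>x q - y q\<bar> \<le> r" for x y :: "'s \<Rightarrow>\<^sub>C real" and r
  proof (rule dist_bound)
    fix s
    have "closed {s. \<bar>x s - y s\<bar> \<le> r}"
      by (intro closed_Collect_le continuous_intros) simp_all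
    moreover have "s \<in> closure Q"
      using Q(2) by (simp add: closure_approachable)
    ultimately show "dist (x s) (y s) \<le> r"
      using that closure_minimal[of Q "{s. \<bar>x s - y s\<bar> \<le> r}"] unfolding dist_real_def by blast
  qed
  have ball: "X -` cball y r \<inter> space M \<in> sets M" for y r
  proof -
    have "dist y x \<le> r \<longleftrightarrow> (\<forall>q\<in>Q. \<bar>y q - x q\<bar> \<le> r)" for x
    proof
      assume "dist y x \<le> r"
      then show "\<forall>q\<in>Q. \<bar>y q - x q\<bar> \<le> r"
        using dist_bounded[of y _ x] order_trans unfolding dist_real_def by blast
    qed (rule dense)
    then have "X -` cball y r \<inter> space M = {\<omega> \<in> space M. \<forall>q\<in>Q. \<bar>y q - X \<omega> q\<bar> \<le> r}"
      by (simp add: set_eq_iff conj_commute)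
    also have "\<dots> \<in> sets M"
      using Q(1) X by measurable
    finally show ?thesis .
  qed
  show ?thesis
  proof (rule borel_measurableI)
    fix V :: "('s \<Rightarrow>\<^sub>C real) set" assume "open V"
    define I where "I = {(y, q). y \<in> F \<and> q \<in> \<rat> \<and> cball y q \<subseteq> V}"
    have "I \<subseteq> F \<times> \<rat>" by (auto simp: I_def)
    then have I: "countable I"
      using F(1) countable_rat countable_SIGMA countable_subset by (metis (no_types))
    have "V = (\<Union>(y, q)\<in>I. cball y q)"
    proof
      show "V \<subseteq> (\<Union>(y, q)\<in>I. cball y q)"
      proof
        fix x assume "x \<in> V"
        with \<open>open V\<close> obtain e where e: "e > 0" "ball x e \<subseteq> V" by (meson openE)
        obtain q :: real where q: "q \<in> \<rat>" "0 < q" "q < e / 2"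
          using Rats_dense_in_real[of 0 "e/2"] e by auto
        obtain y where y: "y \<in> F" "dist y x < q" using F(2)[of q x] q by blast
        have "cball y q \<subseteq> ball x e"
        proof
          fix z assume "z \<in> cball y q"
          then show "z \<in> ball x e"
            using y q dist_triangle[of x z y] by (auto simp: dist_commute)
        qed
        then have "cball y q \<subseteq> V" using e(2) by (rule order_trans)
        then have "(y, q) \<in> I" "x \<in> cball y q"
          using q y by (simp_all add: I_def)
        then show "x \<in> (\<Union>(y, q)\<in>I. cball y q)"
          by (intro UN_I[of "(y, q)"]) auto
      qed
    qed (auto simp: I_def)
    then have "X -` V \<inter> space M = (\<Union>(y, q)\<in>I. X -` cball y q \<inter> space M)"
      by auto
    also have "\<dots> \<in> sets M"
      using I ball by (intro sets.countable_UN'') auto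
    finally show "X -` V \<inter> space M \<in> sets M" .
  qed
qed

lemma borel_measurable_apply_bcontfun [measurable]:
  "(\<lambda>x. apply_bcontfun x s) \<in> borel_measurable (borel :: ('s::metric_space \<Rightarrow>\<^sub>C real) measure)"
proof (rule borel_measurable_continuous_onI)
  show "continuous_on UNIV (\<lambda>x::'s \<Rightarrow>\<^sub>C real. x s)"
    unfolding continuous_on_iff
    by (meson dist_fun_lt_imp_dist_val_lt)
qed

lemma apply_bcontfun_Max:
  assumes "finite I" "I \<noteq> {}"
  shows "apply_bcontfun (bcontfun_Max I x) = (\<lambda>s. MAX i\<in>I. apply_bcontfun (x i) s)"
proof -
  have "(\<lambda>s. MAX i\<in>I. apply_bcontfun (x i) s) \<in> bcontfun"
    using assms
  proof (induction rule: finite_ne_induct)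
    case (singleton i)
    then show ?case by (simp add: bcontfun_def)
  next
    case (insert i J)
    let ?g = "\<lambda>s. MAX i\<in>J. apply_bcontfun (x i) s"
    have eq: "(\<lambda>s. MAX i\<in>insert i J. apply_bcontfun (x i) s) = (\<lambda>s. max (x i s) (?g s))"
      using insert by (auto simp: fun_eq_iff)
    obtain b where b: "\<And>s. norm (?g s) \<le> b"
      using insert.IH unfolding bcontfun_def bounded_iff by auto
    obtain c where c: "\<And>s. norm (x i s) \<le> c"
      using bounded_apply_bcontfun[of "x i"] unfolding bounded_iff by auto
    have "norm (max (x i s) (?g s)) \<le> max c b" for s
      using b[of s] c[of s] unfolding real_norm_def by linarith
    then show ?case
      unfolding eq using insert.IH
      by (intro bcontfun_normI[where b = "max c b"]) (auto simp: bcontfun_def intro!: continuous_intros)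
  qed
  then show ?thesis
    unfolding bcontfun_Max_def by (simp add: Bcontfun_inverse)
qed

section \<open>Functions with finitely many discontinuities\<close>

lemma tendsto_Min_INF:
  fixes a :: "nat \<Rightarrow> real"
  assumes "bdd_below (range a)"
  shows "(\<lambda>n. MIN i\<in>{..n}. a i) \<longlonglongrightarrow> (INF i. a i)"
proof -
  have "eventually (\<lambda>n. (MIN i\<in>{..n}. a i) < b) sequentially" if b: "(INF i. a i) < b" for b
  proof -
    obtain j where "a j < b" using b assms by (auto simp: cInf_less_iff)
    then have "(MIN i\<in>{..n}. a i) < b" if "n \<ge> j" for n
      using that by (subst Min_less_iff) auto
    then show ?thesis by (auto simp: eventually_sequentially)
  qed
  moreover have "b < (MIN i\<in>{..n}. a i)" if b: "b < (INF i. a i)" for b n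
    using b assms by (subst Min_gr_iff) (auto intro: less_le_trans cINF_lower)
  ultimately show ?thesis
    by (intro order_tendstoI) auto
qed

lemma E_space_range_bounded:
  assumes "f \<in> E_space"
  obtains c where "c > 0" "\<And>s. \<bar>f s\<bar> \<le> c"
proof -
  obtain c where c: "\<And>s. \<bar>f s\<bar> \<le> c"
    using assms unfolding E_space_def bounded_iff by auto
  have "\<bar>f s\<bar> \<le> \<bar>c\<bar> + 1" for s
    using c[of s] by linarith
  then show thesis using that[of "\<bar>c\<bar> + 1"] by auto
qed

lemma E_spaceI:
  assumes "f \<in> E_space" "\<And>s. isCont f s \<Longrightarrow> isCont k s" "\<And>s. \<bar>k s\<bar> \<le> c"
  shows "k \<in> E_space"
proof -
  have "{s. \<not> isCont k s} \<subseteq> {s. \<not> isCont f s}" using assms(2) by auto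
  then show ?thesis
    using assms(1,3) unfolding E_space_def bounded_iff
    by (auto intro: finite_subset)
qed

lemma isCont_bcontfun [continuous_intros, simp]: "isCont (apply_bcontfun x) s"
  using continuous_on_apply_bcontfun[of UNIV x] continuous_on_eq_continuous_at by blast

lemma bcontfun_bounded:
  fixes x :: "'s::metric_space \<Rightarrow>\<^sub>C real"
  obtains c where "c > 0" "\<And>s. \<bar>x s\<bar> \<le> c"
proof -
  obtain c where c: "\<And>s. \<bar>x s\<bar> \<le> c"
    using bounded_apply_bcontfun[of x] unfolding bounded_iff by auto
  have "\<bar>x s\<bar> \<le> \<bar>c\<bar> + 1" for s
    using c[of s] by linarith
  then show thesis using that[of "\<bar>c\<bar> + 1"] by auto
qed

lemma E_space_bcontfun: "apply_bcontfun x \<in> E_space"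
  unfolding E_space_def by auto

lemma E_space_add_const:
  assumes "f \<in> E_space" shows "(\<lambda>s. f s + c) \<in> E_space"
proof -
  obtain b where b: "\<And>s. \<bar>f s\<bar> \<le> b" using E_space_range_bounded[OF assms] by metis
  show ?thesis
  proof (rule E_spaceI[OF assms, where c = "b + \<bar>c\<bar>"])
    show "\<bar>f s + c\<bar> \<le> b + \<bar>c\<bar>" for s using b[of s] by linarith
  qed (auto intro!: continuous_intros)
qed

lemma E_space_max_bcontfun: "f \<in> E_space \<Longrightarrow> (\<lambda>s. max (apply_bcontfun y s) (f s)) \<in> E_space"
proof -
  assume f: "f \<in> E_space"
  obtain c where c: "\<And>s. \<bar>f s\<bar> \<le> c" using E_space_range_bounded[OF f] by metis
  obtain b where b: "\<And>s. \<bar>y s\<bar> \<le> b" using bcontfun_bounded[of y] by metis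
  show ?thesis
  proof (rule E_spaceI[OF f, where c="max b c"])
    show "\<bar>max (y s) (f s)\<bar> \<le> max b c" for s using b[of s] c[of s] by linarith
  qed (auto intro!: continuous_intros)
qed

text \<open>These functions give access to finite-dimensional distributions: outside
  \<open>A\<close> the level is 0, which constrains a nonpositive process in no way.\<close>

lemma E_minus_indicator:
  assumes "finite A" "\<And>s. s \<in> A \<Longrightarrow> f s \<le> 0"
  shows "(\<lambda>s. if s \<in> A then f s else 0 :: real) \<in> E_minus"
proof -
  have "isCont (\<lambda>s. if s \<in> A then f s else 0) s" if "s \<notin> A" for s
  proof -
    have "open (- A)" using assms(1) by (simp add: finite_imp_closed open_Compl)
    then have "eventually (\<lambda>s. s \<in> - A) (nhds s)"
      using that by (intro eventually_nhds_in_open) auto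
    then have "eventually (\<lambda>s. (if s \<in> A then f s else 0) = 0) (nhds s)"
      by eventually_elim auto
    then show ?thesis
      by (subst isCont_cong[where g="\<lambda>_. 0"]) auto
  qed
  then have "{s. \<not> isCont (\<lambda>s. if s \<in> A then f s else 0) s} \<subseteq> A" by blast
  moreover have "range (\<lambda>s. if s \<in> A then f s else 0) \<subseteq> insert 0 (f ` A)" by auto
  then have "bounded (range (\<lambda>s. if s \<in> A then f s else 0))"
    using assms(1) by (meson bounded_subset finite_imageI finite_imp_bounded finite_insert)
  ultimately show ?thesis
    using assms unfolding E_minus_def E_space_def by (auto intro: finite_subset)
qed

text \<open>One sequence serves for all functions with at most the discontinuities of \<open>f\<close>: a dense
  sequence that also visits these discontinuities.\<close>

lemma E_space_sequence:
  fixes f :: "'s::metric_space \<Rightarrow> real"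
  assumes cpt: "compact (UNIV :: 's set)" and f: "f \<in> E_space"
  obtains q :: "nat \<Rightarrow> 's"
  where "\<And>k. bdd_below (range k) \<Longrightarrow> (\<And>s. isCont f s \<Longrightarrow> isCont k s) \<Longrightarrow>
           (\<lambda>n. MIN i\<in>{..n}. k (q i) :: real) \<longlonglongrightarrow> (INF s. k s)"
proof -
  obtain Q :: "'s set" where Q: "countable Q" "\<And>s e. e > 0 \<Longrightarrow> \<exists>q\<in>Q. dist q s < e"
    using compact_UNIV_countable_dense[OF cpt] by blast
  have "countable (Q \<union> {s. \<not> isCont f s})"
    using Q(1) f by (auto simp: E_space_def countable_finite)
  moreover have "Q \<noteq> {}" using Q(2)[of 1] by force
  ultimately obtain q :: "nat \<Rightarrow> 's" where q: "range q = Q \<union> {s. \<not> isCont f s}"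
    by (metis Un_empty range_from_nat_into)
  show thesis
  proof
    fix k :: "'s \<Rightarrow> real"
    assume bdd: "bdd_below (range k)" and cont: "\<And>s. isCont f s \<Longrightarrow> isCont k s"
    have bddq: "bdd_below (range (\<lambda>i. k (q i)))"
      using bdd by (rule bdd_below_mono) auto
    have "(INF i. k (q i)) \<le> k s" for s
    proof (cases "isCont f s")
      case False
      then obtain i where "s = q i" using q by blast
      then show ?thesis using bddq by (auto intro: cINF_lower)
    next
      case True
      show ?thesis
      proof (rule field_le_epsilon)
        fix e :: real assume "e > 0"
        with cont[OF True] obtain d where d: "d > 0" "\<And>t. dist t s < d \<Longrightarrow> dist (k t) (k s) < e"
          by (metis continuous_at_eps_delta)
        obtain t where "t \<in> Q" "dist t s < d" using Q(2)[OF d(1)] by blast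
        moreover then obtain i where "t = q i" using q by blast
        ultimately have "k (q i) < k s + e" using d(2)[of t] by (auto simp: dist_real_def)
        moreover have "(INF i. k (q i)) \<le> k (q i)" using bddq by (auto intro: cINF_lower)
        ultimately show "(INF i. k (q i)) \<le> k s + e" by linarith
      qed
    qed
    then have "(INF i. k (q i)) = (INF s. k s)"
      using bdd by (intro antisym cINF_greatest) (auto intro: cINF_lower)
    then show "(\<lambda>n. MIN i\<in>{..n}. k (q i)) \<longlonglongrightarrow> (INF s. k s)"
      using tendsto_Min_INF[OF bddq] by simp
  qed
qed

text \<open>The sequence depends on \<open>f\<close> alone, so the same countably many coordinates
  serve for every \<omega>.\<close>

lemma borel_measurable_INF_E_space:
  fixes k :: "'a \<Rightarrow> 's::metric_space \<Rightarrow> real"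
  assumes "compact (UNIV :: 's set)" "f \<in> E_space"
    and "\<And>\<omega>. \<omega> \<in> space M \<Longrightarrow> bdd_below (range (k \<omega>))"
    and "\<And>\<omega> s. \<omega> \<in> space M \<Longrightarrow> isCont f s \<Longrightarrow> isCont (k \<omega>) s"
    and [measurable]: "\<And>s. (\<lambda>\<omega>. k \<omega> s) \<in> borel_measurable M"
  shows "(\<lambda>\<omega>. INF s. k \<omega> s) \<in> borel_measurable M"
proof -
  obtain q :: "nat \<Rightarrow> 's" where
    q: "\<And>k. bdd_below (range k) \<Longrightarrow> (\<And>s. isCont f s \<Longrightarrow> isCont k s) \<Longrightarrow>
           (\<lambda>n. MIN i\<in>{..n}. k (q i) :: real) \<longlonglongrightarrow> (INF s. k s)"
    using E_space_sequence[OF assms(1,2)] by blast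
  show ?thesis
  proof (rule borel_measurable_LIMSEQ_real)
    show "(\<lambda>n. MIN i\<in>{..n}. k \<omega> (q i)) \<longlonglongrightarrow> (INF s. k \<omega> s)" if "\<omega> \<in> space M" for \<omega>
      using that assms by (intro q) auto
    show "(\<lambda>\<omega>. MIN i\<in>{..n}. k \<omega> (q i)) \<in> borel_measurable M" for n
      by (intro borel_measurable_Min) auto
  qed
qed

text \<open>Strict positivity is not a condition on the infimum, as \<open>k \<omega>\<close> need not attain it; but
  away from its finitely many discontinuities it does on compact sets.\<close>

lemma measurable_all_pos_E_space:
  fixes k :: "'a \<Rightarrow> 's::metric_space \<Rightarrow> real"
  assumes cpt: "compact (UNIV :: 's set)" and f: "f \<in> E_space"
    and cont: "\<And>\<omega> s. \<omega> \<in> space M \<Longrightarrow> isCont f s \<Longrightarrow> isCont (k \<omega>) s"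
    and meas [measurable]: "\<And>s. (\<lambda>\<omega>. k \<omega> s) \<in> borel_measurable M"
  shows "Measurable.pred M (\<lambda>\<omega>. \<forall>s. 0 < k \<omega> s)"
proof -
  obtain Q :: "'s set" where Q: "countable Q" "\<And>s e. e > 0 \<Longrightarrow> \<exists>q\<in>Q. dist q s < e"
    using compact_UNIV_countable_dense[OF cpt] by blast
  \<comment> \<open>The added point keeps \<open>D\<close> nonempty; the distance to the empty set
    is 0 by convention, which would make every \<open>V m\<close> empty.\<close>
  define D where "D = insert undefined {s. \<not> isCont f s}"
  have D: "finite D" "D \<noteq> {}" "closed D"
    using f by (auto simp: D_def E_space_def intro!: finite_imp_closed)
  \<comment> \<open>The \<open>V m\<close> exhaust the complement of \<open>D\<close>. They are
    open, so that \<open>Q\<close> stays dense in each of them, and each lies in a compact set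
    avoiding \<open>D\<close>, where a positive \<open>k \<omega>\<close> has a positive
    minimum.\<close>
  define V where "V m = {s. infdist s D > 1 / real (Suc m)}" for m
  have "(\<forall>s. 0 < k \<omega> s) \<longleftrightarrow>
      (\<forall>s\<in>D. 0 < k \<omega> s) \<and> (\<forall>m. \<exists>j. \<forall>q\<in>Q \<inter> V m. 1 / real (Suc j) \<le> k \<omega> q)"
    (is "?l \<longleftrightarrow> ?r") if \<omega>: "\<omega> \<in> space M" for \<omega>
  proof
    assume l: ?l
    have "\<exists>j. \<forall>q\<in>Q \<inter> V m. 1 / real (Suc j) \<le> k \<omega> q" for m
    proof (cases "V m = {}")
      case False
      define K where "K = {s. infdist s D \<ge> 1 / real (Suc m)}"
      have "closed K" unfolding K_def by (intro closed_Collect_le continuous_intros)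
      then have "compact K" using cpt compact_Int_closed[of UNIV K] by simp
      moreover have "K \<noteq> {}"
      proof -
        obtain x where "1 / real (Suc m) < infdist x D" using False unfolding V_def by blast
        then have "x \<in> K" unfolding K_def by simp
        then show ?thesis by blast
      qed
      moreover have "continuous_on K (k \<omega>)"
      proof (rule continuous_at_imp_continuous_on, safe)
        fix s assume "s \<in> K"
        then have "s \<notin> D" using infdist_zero[of s D] unfolding K_def by auto
        then show "isCont (k \<omega>) s" using cont[OF \<omega>, of s] by (auto simp: D_def)
      qed
      ultimately obtain x where x: "x \<in> K" "\<And>y. y \<in> K \<Longrightarrow> k \<omega> x \<le> k \<omega> y"
        using continuous_attains_inf by metis
      obtain j where "1 / real (Suc j) < k \<omega> x" using l nat_approx_posE by blast
      moreover have "V m \<subseteq> K" by (auto simp: K_def V_def)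
      ultimately have "\<forall>q\<in>Q \<inter> V m. 1 / real (Suc j) \<le> k \<omega> q"
        using x(2) by (meson IntD2 less_imp_le order_trans subsetD)
      then show ?thesis by blast
    qed auto
    with l show ?r by blast
  next
    assume r: ?r
    show ?l
    proof
      fix s show "0 < k \<omega> s"
      proof (cases "s \<in> D")
        case False
        then have "infdist s D > 0"
          using D by (simp add: infdist_pos_not_in_closed)
        then obtain m where m: "1 / real (Suc m) < infdist s D" using nat_approx_posE by blast
        obtain j where j: "\<forall>q\<in>Q \<inter> V m. 1 / real (Suc j) \<le> k \<omega> q" using r by blast
        have "open (V m)" unfolding V_def by (intro open_Collect_less continuous_intros)
        then obtain d where d: "d > 0" "ball s d \<subseteq> V m"
          using m by (metis V_def mem_Collect_eq openE)
        have "isCont (k \<omega>) s" using False cont[OF \<omega>, of s] by (auto simp: D_def)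
        \<comment> \<open>The tolerance equals the lower bound valid on \<open>Q\<close>, so a
          nearby \<open>t\<close> in \<open>Q\<close> leaves \<open>k \<omega> s\<close> strictly
          positive.\<close>
        then obtain d' where d': "d' > 0"
            "\<And>t. dist t s < d' \<Longrightarrow> dist (k \<omega> t) (k \<omega> s) < 1 / real (Suc j)"
          by (metis continuous_at_eps_delta of_nat_0_less_iff zero_less_Suc zero_less_divide_1_iff)
        obtain t where "t \<in> Q" "dist t s < min d d'" using Q(2)[of "min d d'" s] d d' by auto
        then have "t \<in> Q \<inter> V m" "dist (k \<omega> t) (k \<omega> s) < 1 / real (Suc j)"
          using d d'(2)[of t] by (auto simp: dist_commute[of s])
        with j have "1 / real (Suc j) \<le> k \<omega> t" "\<bar>k \<omega> t - k \<omega> s\<bar> < 1 / real (Suc j)"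
          unfolding dist_real_def by blast+
        then show ?thesis by linarith
      qed (use r in auto)
    qed
  qed
  then have "{\<omega> \<in> space M. \<forall>s. 0 < k \<omega> s} = {\<omega> \<in> space M. (\<forall>s\<in>D. 0 < k \<omega> s) \<and>
      (\<forall>m. \<exists>j. \<forall>q\<in>Q \<inter> V m. 1 / real (Suc j) \<le> k \<omega> q)}"
    by blast
  also have "\<dots> \<in> sets M"
  proof -
    have "countable D" "\<And>m. countable (Q \<inter> V m)" using D Q by (auto simp: countable_finite)
    then show ?thesis by measurable
  qed
  finally show ?thesis by (simp add: pred_def)
qed

section \<open>The dual norm as a functional of the level\<close>

locale generator = L: prob_space L for L :: "'c measure" +
  fixes Z :: "'c \<Rightarrow> ('s::metric_space \<Rightarrow>\<^sub>C real)"
  assumes cpt: "compact (UNIV :: 's set)"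
    and Z [measurable]: "Z \<in> borel_measurable L"
    and Z_nonneg: "\<And>\<omega> s. \<omega> \<in> space L \<Longrightarrow> 0 \<le> Z \<omega> s"
    and integrable_SUP: "integrable L (\<lambda>\<omega>. SUP s. Z \<omega> s)"
begin

text \<open>The \<open>D\<close>-norm of the constant function 1; it is a Lipschitz constant of
  \<open>Psi\<close> for the sup-distance of levels.\<close>

definition C :: real where "C = (\<integral>\<omega>. (SUP s. Z \<omega> s) \<partial>L)"

definition wt :: "('s \<Rightarrow> real) \<Rightarrow> 'c \<Rightarrow> 's \<Rightarrow> real" where
  "wt g \<omega> s = max (- g s) 0 * Z \<omega> s"

text \<open>For \<open>g \<le> 0\<close> this is the dual norm of \<open>g\<close>, while it is \<open>0\<close> if \<open>g\<close> is positive somewhere, as befits the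
  limit of \<open>n * P (n (U - 1) > g)\<close>.\<close>

definition Psi :: "('s \<Rightarrow> real) \<Rightarrow> real" where
  "Psi g = (\<integral>\<omega>. (INF s. wt g \<omega> s) \<partial>L)"

lemma Psi_eq_dual_D_norm:
  assumes "\<And>s. g s \<le> 0" shows "Psi g = dual_D_norm L Z g"
proof -
  have "max (- g s) 0 = \<bar>g s\<bar>" for s using assms[of s] by simp
  then show ?thesis unfolding Psi_def dual_D_norm_def wt_def by simp
qed

lemma Z_le_SUP: "Z \<omega> s \<le> (SUP s. Z \<omega> s)"
  by (intro cSUP_upper bounded_imp_bdd_above) auto

lemma SUP_Z_nonneg: "\<omega> \<in> space L \<Longrightarrow> 0 \<le> (SUP s. Z \<omega> s)"
  using Z_nonneg[of \<omega> undefined] Z_le_SUP[of \<omega> undefined] by linarith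

lemma C_nonneg: "0 \<le> C"
  unfolding C_def by (intro integral_nonneg_AE AE_I2 SUP_Z_nonneg)

lemma measurable_wt [measurable]: "(\<lambda>\<omega>. wt g \<omega> s) \<in> borel_measurable L"
  unfolding wt_def by measurable

lemma wt_nonneg: "\<omega> \<in> space L \<Longrightarrow> 0 \<le> wt g \<omega> s"
  unfolding wt_def by (simp add: Z_nonneg)

lemma bdd_below_wt: "\<omega> \<in> space L \<Longrightarrow> bdd_below (range (wt g \<omega>))"
  using wt_nonneg by (intro bdd_belowI2[where m = 0])

lemma wt_le: "\<omega> \<in> space L \<Longrightarrow> - g s \<le> c \<Longrightarrow> 0 \<le> c \<Longrightarrow> wt g \<omega> s \<le> c * (SUP s. Z \<omega> s)"
  unfolding wt_def by (intro mult_mono Z_le_SUP Z_nonneg) auto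

lemma wt_le_add:
  assumes "\<omega> \<in> space L" "g s \<le> g' s + e" "0 \<le> e"
  shows "wt g' \<omega> s \<le> wt g \<omega> s + e * (SUP s. Z \<omega> s)"
proof -
  have "wt g' \<omega> s \<le> (max (- g s) 0 + e) * Z \<omega> s"
    unfolding wt_def using assms by (intro mult_right_mono Z_nonneg) auto
  also have "\<dots> \<le> wt g \<omega> s + e * (SUP s. Z \<omega> s)"
    unfolding wt_def distrib_right using assms by (intro add_left_mono mult_left_mono Z_le_SUP)
  finally show ?thesis .
qed

lemma isCont_wt: "isCont g s \<Longrightarrow> isCont (wt g \<omega>) s"
  unfolding wt_def by (intro continuous_intros) auto

lemma measurable_INF_wt: "g \<in> E_space \<Longrightarrow> (\<lambda>\<omega>. INF s. wt g \<omega> s) \<in> borel_measurable L"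
  by (rule borel_measurable_INF_E_space[OF cpt]) (auto simp: bdd_below_wt isCont_wt)

lemma INF_wt_nonneg: "\<omega> \<in> space L \<Longrightarrow> 0 \<le> (INF s. wt g \<omega> s)"
  by (intro cINF_greatest) (auto simp: wt_nonneg)

lemma INF_wt_le: "\<omega> \<in> space L \<Longrightarrow> (INF s. wt g \<omega> s) \<le> wt g \<omega> s"
  by (intro cINF_lower bdd_below_wt) auto

lemma integrable_INF_wt:
  assumes "g \<in> E_space" shows "integrable L (\<lambda>\<omega>. INF s. wt g \<omega> s)"
proof -
  obtain c where c: "c > 0" "\<And>s. \<bar>g s\<bar> \<le> c" using E_space_range_bounded[OF assms] by blast
  show ?thesis
  proof (rule Bochner_Integration.integrable_bound)
    show "integrable L (\<lambda>\<omega>. c * (SUP s. Z \<omega> s))" using integrable_SUP by simp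
    show "AE \<omega> in L. norm (INF s. wt g \<omega> s) \<le> norm (c * (SUP s. Z \<omega> s))"
    proof (rule AE_I2)
      fix \<omega> assume \<omega>: "\<omega> \<in> space L"
      have "(INF s. wt g \<omega> s) \<le> wt g \<omega> undefined" by (rule INF_wt_le[OF \<omega>])
      also have "\<dots> \<le> c * (SUP s. Z \<omega> s)"
        using c(1) c(2)[of undefined] by (intro wt_le \<omega>) linarith+
      finally show "norm (INF s. wt g \<omega> s) \<le> norm (c * (SUP s. Z \<omega> s))"
        using INF_wt_nonneg[OF \<omega>, of g] by simp
    qed
  qed (rule measurable_INF_wt[OF assms])
qed

lemma Psi_nonneg: "0 \<le> Psi g"
  unfolding Psi_def by (intro integral_nonneg_AE AE_I2 INF_wt_nonneg)

text \<open>A bound at one point suffices, since the infimum is at most the value there.\<close>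

lemma Psi_le:
  assumes g: "g \<in> E_space" and c: "- g s \<le> c" "0 \<le> c"
  shows "Psi g \<le> c * C"
proof -
  have "Psi g \<le> (\<integral>\<omega>. c * (SUP s. Z \<omega> s) \<partial>L)"
    unfolding Psi_def using integrable_INF_wt[OF g] integrable_SUP
  proof (intro integral_mono)
    fix \<omega> assume "\<omega> \<in> space L"
    then show "(INF s. wt g \<omega> s) \<le> c * (SUP s. Z \<omega> s)"
      using INF_wt_le[of \<omega> g s] wt_le[of \<omega> g s c] c by linarith
  qed auto
  then show ?thesis by (simp add: C_def)
qed

text \<open>Shifting the level by \<open>e\<close> changes every weight by at most \<open>e\<close>
  times the supremum of \<open>Z\<close>. The case \<open>e = 0\<close> is antitonicity; both uses
  occur below.\<close>

lemma Psi_mono_add: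
  assumes g: "g \<in> E_space" "g' \<in> E_space" and e: "\<And>s. g s \<le> g' s + e" "0 \<le> e"
  shows "Psi g' \<le> Psi g + e * C"
proof -
  have "Psi g' \<le> (\<integral>\<omega>. (INF s. wt g \<omega> s) + e * (SUP s. Z \<omega> s) \<partial>L)"
    unfolding Psi_def[of g']
  proof (intro integral_mono)
    fix \<omega> assume \<omega>: "\<omega> \<in> space L"
    have "(INF s. wt g' \<omega> s) - e * (SUP s. Z \<omega> s) \<le> wt g \<omega> s" for s
      using INF_wt_le[OF \<omega>, of g' s] wt_le_add[of \<omega> g s g' e, OF \<omega> e(1) e(2)] by linarith
    then have "(INF s. wt g' \<omega> s) - e * (SUP s. Z \<omega> s) \<le> (INF s. wt g \<omega> s)"
      by (intro cINF_greatest) auto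
    then show "(INF s. wt g' \<omega> s) \<le> (INF s. wt g \<omega> s) + e * (SUP s. Z \<omega> s)" by linarith
  qed (use integrable_INF_wt g integrable_SUP in auto)
  also have "\<dots> = Psi g + e * C"
    unfolding Psi_def C_def using integrable_INF_wt[OF g(1)] integrable_SUP by simp
  finally show ?thesis .
qed

lemma integrable_wt: "integrable L (\<lambda>\<omega>. wt g \<omega> s)"
proof (rule Bochner_Integration.integrable_bound)
  show "integrable L (\<lambda>\<omega>. \<bar>g s\<bar> * (SUP s. Z \<omega> s))" using integrable_SUP by simp
  show "AE \<omega> in L. norm (wt g \<omega> s) \<le> norm (\<bar>g s\<bar> * (SUP s. Z \<omega> s))"
    by (intro AE_I2) (auto simp: wt_nonneg SUP_Z_nonneg intro!: wt_le)
qed measurable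

lemma integrable_Min_wt:
  assumes "finite T" "T \<noteq> {}" shows "integrable L (\<lambda>\<omega>. MIN s\<in>T. wt g \<omega> s)"
  using assms by (induction rule: finite_ne_induct) (auto intro!: integrable_min simp: integrable_wt)

lemma integrable_Max_wt:
  assumes "finite T" "T \<noteq> {}" shows "integrable L (\<lambda>\<omega>. MAX s\<in>T. wt g \<omega> s)"
  using assms by (induction rule: finite_ne_induct) (auto intro!: integrable_max simp: integrable_wt)

text \<open>The sequence is a parameter so that a single \<open>q\<close> can serve for
  \<open>g\<close>, for its shifts, and for the differences of paths with \<open>g\<close>.\<close>

lemma tendsto_Psi:
  assumes g: "g \<in> E_space"
    and q: "\<And>k. bdd_below (range k) \<Longrightarrow> (\<And>s. isCont g s \<Longrightarrow> isCont k s) \<Longrightarrow>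
           (\<lambda>n. MIN i\<in>{..n}. k (q i) :: real) \<longlonglongrightarrow> (INF s. k s)"
  shows "(\<lambda>n. \<integral>\<omega>. (MIN i\<in>{..n::nat}. wt g \<omega> (q i)) \<partial>L) \<longlonglongrightarrow> Psi g"
proof -
  obtain c where c: "c > 0" "\<And>s. \<bar>g s\<bar> \<le> c" using E_space_range_bounded[OF g] by blast
  show ?thesis
    unfolding Psi_def
  proof (rule integral_dominated_convergence[where w = "\<lambda>\<omega>. c * (SUP s. Z \<omega> s)"])
    show "(\<lambda>\<omega>. INF s. wt g \<omega> s) \<in> borel_measurable L" by (rule measurable_INF_wt[OF g])
    show "(\<lambda>\<omega>. MIN i\<in>{..n}. wt g \<omega> (q i)) \<in> borel_measurable L" for n
      by (intro borel_measurable_Min) auto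
    show "integrable L (\<lambda>\<omega>. c * (SUP s. Z \<omega> s))" using integrable_SUP by simp
    show "AE \<omega> in L. (\<lambda>n. MIN i\<in>{..n}. wt g \<omega> (q i)) \<longlonglongrightarrow> (INF s. wt g \<omega> s)"
      by (intro AE_I2 q bdd_below_wt isCont_wt)
    show "AE \<omega> in L. norm (MIN i\<in>{..n}. wt g \<omega> (q i)) \<le> c * (SUP s. Z \<omega> s)" for n
    proof (rule AE_I2)
      fix \<omega> assume \<omega>: "\<omega> \<in> space L"
      have "0 \<le> (MIN i\<in>{..n}. wt g \<omega> (q i))"
        by (intro Min.boundedI) (auto simp: wt_nonneg[OF \<omega>])
      moreover have "(MIN i\<in>{..n}. wt g \<omega> (q i)) \<le> wt g \<omega> (q 0)" by (intro Min_le) auto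
      moreover have "wt g \<omega> (q 0) \<le> c * (SUP s. Z \<omega> s)"
        using c(1) c(2)[of "q 0"] by (intro wt_le \<omega>) auto
      ultimately show "norm (MIN i\<in>{..n}. wt g \<omega> (q i)) \<le> c * (SUP s. Z \<omega> s)"
        unfolding real_norm_def by linarith
    qed
  qed
qed

text \<open>The weight is \<open>\<bar>min (g s) 0\<bar> * Z \<omega> s\<close>; as weights are
  nonnegative and \<open>A\<close> is nonempty, the zeros outside \<open>A\<close> do not affect the
  supremum.\<close>

lemma D_norm_indicator:
  assumes A: "finite A" "A \<noteq> {}"
  shows "D_norm L Z (\<lambda>s. if s \<in> A then min (g s) 0 else 0) = (\<integral>\<omega>. (MAX s\<in>A. wt g \<omega> s) \<partial>L)"
  unfolding D_norm_def
proof (rule Bochner_Integration.integral_cong[OF refl])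
  fix \<omega> assume \<omega>: "\<omega> \<in> space L"
  have eq: "\<bar>if s \<in> A then min (g s) 0 else 0\<bar> * Z \<omega> s = (if s \<in> A then wt g \<omega> s else 0)" for s
    by (simp add: wt_def min_def max_def abs_if)
  obtain a where a: "a \<in> A" using A by blast
  have nn: "0 \<le> (MAX s\<in>A. wt g \<omega> s)"
    using A a wt_nonneg[OF \<omega>, of g a] by (subst Max_ge_iff) auto
  have le: "(if s \<in> A then wt g \<omega> s else 0) \<le> (MAX s\<in>A. wt g \<omega> s)" for s
    using A(1) nn Max_ge[of "wt g \<omega> ` A" "wt g \<omega> s"] by simp
  have "(SUP s. if s \<in> A then wt g \<omega> s else 0) = (MAX s\<in>A. wt g \<omega> s)"
  proof (rule antisym)
    show "(SUP s. if s \<in> A then wt g \<omega> s else 0) \<le> (MAX s\<in>A. wt g \<omega> s)"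
      by (rule cSUP_least) (use le in auto)
    have "wt g \<omega> s \<le> (SUP s. if s \<in> A then wt g \<omega> s else 0)" if "s \<in> A" for s
    proof -
      have "(if s \<in> A then wt g \<omega> s else 0) \<le> (SUP s. if s \<in> A then wt g \<omega> s else 0)"
        by (rule cSUP_upper[OF UNIV_I bdd_aboveI2[OF le]])
      then show ?thesis using that by simp
    qed
    then show "(MAX s\<in>A. wt g \<omega> s) \<le> (SUP s. if s \<in> A then wt g \<omega> s else 0)"
      using A by simp
  qed
  then show "(SUP s. \<bar>if s \<in> A then min (g s) 0 else 0\<bar> * Z \<omega> s) = (MAX s\<in>A. wt g \<omega> s)"
    unfolding eq .
qed

lemma integral_Max_wt_add:
  assumes A: "finite A" "A \<noteq> {}" and e: "\<And>s. g s \<le> g' s + e" "0 \<le> e"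
  shows "(\<integral>\<omega>. (MAX s\<in>A. wt g' \<omega> s) \<partial>L) \<le> (\<integral>\<omega>. (MAX s\<in>A. wt g \<omega> s) \<partial>L) + e * C"
proof -
  have "(\<integral>\<omega>. (MAX s\<in>A. wt g' \<omega> s) \<partial>L)
      \<le> (\<integral>\<omega>. (MAX s\<in>A. wt g \<omega> s) + e * (SUP s. Z \<omega> s) \<partial>L)"
  proof (intro integral_mono)
    fix \<omega> assume \<omega>: "\<omega> \<in> space L"
    have "wt g' \<omega> s \<le> (MAX s\<in>A. wt g \<omega> s) + e * (SUP s. Z \<omega> s)" if "s \<in> A" for s
    proof -
      have "wt g \<omega> s \<le> (MAX s\<in>A. wt g \<omega> s)" using A that by auto
      then show ?thesis using wt_le_add[of \<omega> g s g' e, OF \<omega> e(1) e(2)] by linarith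
    qed
    then show "(MAX s\<in>A. wt g' \<omega> s) \<le> (MAX s\<in>A. wt g \<omega> s) + e * (SUP s. Z \<omega> s)"
      using A by simp
  qed (use integrable_Max_wt[OF A] integrable_SUP in auto)
  also have "\<dots> = (\<integral>\<omega>. (MAX s\<in>A. wt g \<omega> s) \<partial>L) + e * C"
    unfolding C_def using integrable_Max_wt[OF A] integrable_SUP by simp
  finally show ?thesis .
qed

end

section \<open>Weak convergence of the maxima\<close>

lemma continuous_on_eval: "continuous_on UNIV (\<lambda>x::'s::metric_space \<Rightarrow>\<^sub>C real. apply_bcontfun x s)"
  unfolding continuous_on_iff by (meson dist_fun_lt_imp_dist_val_lt)

lemma continuous_on_Max:
  fixes a :: "'i \<Rightarrow> 'a::topological_space \<Rightarrow> real"
  assumes "finite A" "A \<noteq> {}" "\<And>i. i \<in> A \<Longrightarrow> continuous_on S (a i)"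
  shows "continuous_on S (\<lambda>x. MAX i\<in>A. a i x)"
  using assms
proof (induction rule: finite_ne_induct)
  case (insert i F)
  then have "(\<lambda>x. MAX i\<in>insert i F. a i x) = (\<lambda>x. max (a i x) (MAX i\<in>F. a i x))"
    by (auto simp: fun_eq_iff)
  then show ?case using insert by (auto intro!: continuous_intros)
qed simp

lemma continuous_on_Min:
  fixes a :: "'i \<Rightarrow> 'a::topological_space \<Rightarrow> real"
  assumes "finite A" "A \<noteq> {}" "\<And>i. i \<in> A \<Longrightarrow> continuous_on S (a i)"
  shows "continuous_on S (\<lambda>x. MIN i\<in>A. a i x)"
  using assms
proof (induction rule: finite_ne_induct)
  case (insert i F)
  then have "(\<lambda>x. MIN i\<in>insert i F. a i x) = (\<lambda>x. min (a i x) (MIN i\<in>F. a i x))"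
    by (auto simp: fun_eq_iff)
  then show ?case using insert by (auto intro!: continuous_intros)
qed simp

text \<open>With \<open>x = - ln (p n)\<close> this rests on \<open>x * exp (- x) \<le> 1 - exp (- x) \<le> x\<close>.\<close>

lemma tendsto_of_nat_mult_one_minus:
  fixes p :: "nat \<Rightarrow> real"
  assumes p: "\<And>n. 0 \<le> p n" "\<And>n. p n \<le> 1" and lim: "(\<lambda>n. p n ^ n) \<longlonglongrightarrow> exp (- m)"
  shows "(\<lambda>n. real n * (1 - p n)) \<longlonglongrightarrow> m"
proof -
  have ev: "eventually (\<lambda>n. p n > 0) sequentially"
    using order_tendstoD(1)[OF lim exp_gt_zero] eventually_gt_at_top[of 0]
  proof eventually_elim
    case (elim n)
    with p(1)[of n] show ?case by (cases "p n = 0") (auto simp: zero_power)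
  qed
  have "(\<lambda>n. ln (p n ^ n)) \<longlonglongrightarrow> ln (exp (- m))"
    using lim by (intro tendsto_ln) auto
  then have "(\<lambda>n. - ln (p n ^ n)) \<longlonglongrightarrow> m"
    using tendsto_minus by fastforce
  moreover have "eventually (\<lambda>n. - ln (p n ^ n) = real n * - ln (p n)) sequentially"
    using ev by eventually_elim (simp add: ln_realpow)
  ultimately have x: "(\<lambda>n. real n * - ln (p n)) \<longlonglongrightarrow> m"
    by (rule Lim_transform_eventually)
  have "(\<lambda>n. (real n * - ln (p n)) * (1 / real n)) \<longlonglongrightarrow> m * 0"
    by (intro tendsto_mult x lim_1_over_n)
  moreover have "eventually (\<lambda>n. (real n * - ln (p n)) * (1 / real n) = - ln (p n)) sequentially"
    using eventually_gt_at_top[of 0] by eventually_elim simp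
  ultimately have "(\<lambda>n. - ln (p n)) \<longlonglongrightarrow> 0"
    using Lim_transform_eventually by fastforce
  then have "(\<lambda>n. exp (- (- ln (p n)))) \<longlonglongrightarrow> exp (- 0)"
    by (intro tendsto_exp tendsto_minus)
  moreover have "eventually (\<lambda>n. exp (- (- ln (p n))) = p n) sequentially"
    using ev by eventually_elim simp
  ultimately have "p \<longlonglongrightarrow> 1"
    using Lim_transform_eventually by fastforce
  then have low: "(\<lambda>n. real n * - ln (p n) * p n) \<longlonglongrightarrow> m"
    using tendsto_mult[OF x, of p 1] by simp
  show ?thesis
  proof (rule tendsto_sandwich[OF _ _ low x])
    show "eventually (\<lambda>n. real n * - ln (p n) * p n \<le> real n * (1 - p n)) sequentially"
      using ev
    proof eventually_elim
      case (elim n)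
      have "- ln (p n) \<le> 1 / p n - 1"
        using ln_le_minus_one[of "1 / p n"] elim by (simp add: ln_div)
      then have "- ln (p n) * p n \<le> (1 / p n - 1) * p n"
        using elim by (intro mult_right_mono) auto
      also have "\<dots> = 1 - p n" using elim by (simp add: field_simps)
      finally show ?case unfolding mult.assoc by (intro mult_left_mono) auto
    qed
    show "eventually (\<lambda>n. real n * (1 - p n) \<le> real n * - ln (p n)) sequentially"
      using ev
    proof eventually_elim
      case (elim n)
      have "ln (p n) \<le> p n - 1" using elim by (rule ln_le_minus_one)
      then show ?case by (intro mult_left_mono) auto
    qed
  qed
qed

text \<open>The observations, \<eta> and \<open>Z\<close> live on separate spaces; \<eta> and
  \<open>Z\<close> are tied only through the distribution function of \<eta>, the observations and
  \<eta> only through weak convergence.\<close>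

locale record_setting = generator L Z + M: prob_space M + N: prob_space N
  for L :: "'c measure" and Z :: "'c \<Rightarrow> ('s::metric_space \<Rightarrow>\<^sub>C real)"
    and M :: "'a measure" and N :: "'b measure" +
  fixes U :: "nat \<Rightarrow> 'a \<Rightarrow> ('s \<Rightarrow>\<^sub>C real)" and \<eta> :: "'b \<Rightarrow> ('s \<Rightarrow>\<^sub>C real)"
  assumes U [measurable]: "\<And>i. U i \<in> borel_measurable M"
    and indep: "M.indep_vars (\<lambda>_. borel) U UNIV"
    and ident: "\<And>i. distr M borel (U i) = distr M borel (U 0)"
    and \<eta> [measurable]: "\<eta> \<in> borel_measurable N"
    and domain: "in_max_domain M (U 0) N \<eta>"
    and prob_\<eta>_le: "\<And>f. f \<in> E_minus \<Longrightarrow> N.prob {\<omega> \<in> space N. \<forall>s. \<eta> \<omega> s \<le> f s} = exp (- D_norm L Z f)"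
begin

text \<open>The index 0 stays outside all maxima, so \<open>U 0\<close> can serve as the generic
  single observation.\<close>

definition mx :: "nat \<Rightarrow> 'a \<Rightarrow> ('s \<Rightarrow>\<^sub>C real)" where
  "mx n \<omega> = bcontfun_Max {1..n} (\<lambda>i. U i \<omega>)"

definition W :: "nat \<Rightarrow> 'a \<Rightarrow> ('s \<Rightarrow>\<^sub>C real)" where
  "W n \<omega> = real n *\<^sub>R (mx n \<omega> - const_bcontfun 1)"

lemma mx_apply: "1 \<le> n \<Longrightarrow> mx n \<omega> s = (MAX i\<in>{1..n}. U i \<omega> s)"
  unfolding mx_def by (subst apply_bcontfun_Max) auto

lemma W_apply: "W n \<omega> s = real n * (mx n \<omega> s - 1)"
  unfolding W_def by simp

lemma mx_less_iff: "1 \<le> n \<Longrightarrow> mx n \<omega> s < c \<longleftrightarrow> (\<forall>i\<in>{1..n}. U i \<omega> s < c)"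
  by (subst mx_apply, assumption, subst Max_less_iff) auto

lemma W_le_iff:
  assumes "1 \<le> n" shows "W n \<omega> s \<le> c \<longleftrightarrow> (\<forall>i\<in>{1..n}. real n * (U i \<omega> s - 1) \<le> c)"
proof -
  have eq: "real n * (x - 1) \<le> c \<longleftrightarrow> x \<le> c / n + 1" for x
    using assms by (simp add: field_simps)
  have "mx n \<omega> s \<le> b \<longleftrightarrow> (\<forall>i\<in>{1..n}. U i \<omega> s \<le> b)" for b
    using assms by (subst mx_apply, assumption, subst Max_le_iff) auto
  then show ?thesis unfolding W_apply eq by blast
qed

lemma W_greater_iff: "1 \<le> n \<Longrightarrow> c < W n \<omega> s \<longleftrightarrow> (\<exists>i\<in>{1..n}. c < real n * (U i \<omega> s - 1))"
  using W_le_iff[of n \<omega> s c] by (meson not_le)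

lemma measurable_bcontfun_Max:
  assumes "finite I" "I \<noteq> {}"
  shows "bcontfun_Max I \<in> borel_measurable (Pi\<^sub>M I (\<lambda>_. borel :: ('s \<Rightarrow>\<^sub>C real) measure))"
proof (rule borel_measurable_bcontfunI[OF cpt])
  show "(\<lambda>x. apply_bcontfun (bcontfun_Max I x) s) \<in> borel_measurable (Pi\<^sub>M I (\<lambda>_. borel))" for s :: 's
    unfolding apply_bcontfun_Max[OF assms]
    by (intro borel_measurable_Max assms(1) measurable_compose[OF measurable_component_singleton] borel_measurable_apply_bcontfun)
qed

lemma mx_restrict: "mx n \<omega> = bcontfun_Max {1..n} (\<lambda>i\<in>{1..n}. U i \<omega>)"
  unfolding mx_def bcontfun_Max_def
  by (intro arg_cong[where f = Bcontfun] ext arg_cong[where f = Max] image_cong) auto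

lemma measurable_mx [measurable]: "1 \<le> n \<Longrightarrow> mx n \<in> borel_measurable M"
  unfolding mx_restrict
  by (rule measurable_compose[OF _ measurable_bcontfun_Max]) auto

lemma measurable_W [measurable]:
  assumes "1 \<le> n" shows "W n \<in> borel_measurable M"
proof (rule borel_measurable_bcontfunI[OF cpt])
  fix s
  have [measurable]: "mx n \<in> borel_measurable M" using assms by measurable
  show "(\<lambda>\<omega>. W n \<omega> s) \<in> borel_measurable M" unfolding W_apply by measurable
qed

text \<open>Exchangeability: the right-hand side does not involve \<open>p\<close>. The identity
  gives the law of the maximum, a transposition the symmetry between the observations in the record
  estimate.\<close>

lemma distr_U_reindex:
  assumes "finite I" "I \<noteq> {}" "inj_on p I"
  shows "distr M (Pi\<^sub>M I (\<lambda>_. borel)) (\<lambda>\<omega>. \<lambda>i\<in>I. U (p i) \<omega>) = Pi\<^sub>M I (\<lambda>_. distr M borel (U 0))"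
proof -
  let ?\<mu> = "distr M borel (U 0)"
  have "M.indep_vars (\<lambda>_. borel) U (p ` I)"
    using M.indep_vars_subset[OF indep] by blast
  then have "distr M (Pi\<^sub>M (p ` I) (\<lambda>_. borel)) (\<lambda>\<omega>. \<lambda>i\<in>p ` I. U i \<omega>) = Pi\<^sub>M (p ` I) (\<lambda>i. distr M borel (U i))"
    using M.indep_vars_iff_distr_eq_PiM[where I = "p ` I" and M' = "\<lambda>_. borel" and X = U] assms(2) U
    by blast
  moreover have "Pi\<^sub>M (p ` I) (\<lambda>i. distr M borel (U i)) = Pi\<^sub>M (p ` I) (\<lambda>_. ?\<mu>)"
    by (intro PiM_cong refl ident)
  ultimately have K: "Pi\<^sub>M (p ` I) (\<lambda>_. ?\<mu>) = distr M (Pi\<^sub>M (p ` I) (\<lambda>_. borel)) (\<lambda>\<omega>. \<lambda>i\<in>p ` I. U i \<omega>)"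
    by simp
  have "Pi\<^sub>M I (\<lambda>_. ?\<mu>) = distr (Pi\<^sub>M (p ` I) (\<lambda>_. ?\<mu>)) (Pi\<^sub>M I (\<lambda>_. ?\<mu>)) (\<lambda>\<omega>. \<lambda>n\<in>I. \<omega> (p n))"
    using distr_PiM_reindex[where K = "p ` I" and M = "\<lambda>_. ?\<mu>" and f = p and I = I]
      assms(3) M.prob_space_distr[OF U] by simp
  also have "\<dots> = distr (Pi\<^sub>M (p ` I) (\<lambda>_. ?\<mu>)) (Pi\<^sub>M I (\<lambda>_. borel)) (\<lambda>\<omega>. \<lambda>n\<in>I. \<omega> (p n))"
    by (rule distr_cong[OF refl _ refl], rule sets_PiM_cong) simp_all
  also have "\<dots> = distr M (Pi\<^sub>M I (\<lambda>_. borel)) ((\<lambda>\<omega>. \<lambda>n\<in>I. \<omega> (p n)) \<circ> (\<lambda>\<omega>. \<lambda>i\<in>p ` I. U i \<omega>))"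
    unfolding K
  proof (rule distr_distr)
    show "(\<lambda>\<omega>. \<lambda>n\<in>I. \<omega> (p n)) \<in> Pi\<^sub>M (p ` I) (\<lambda>_. borel) \<rightarrow>\<^sub>M Pi\<^sub>M I (\<lambda>_. borel)"
      by (rule measurable_restrict, rule measurable_component_singleton) simp
    show "(\<lambda>\<omega>. \<lambda>i\<in>p ` I. U i \<omega>) \<in> M \<rightarrow>\<^sub>M Pi\<^sub>M (p ` I) (\<lambda>_. borel)"
      by (rule measurable_restrict) (rule U)
  qed
  also have "(\<lambda>\<omega>. \<lambda>n\<in>I. \<omega> (p n)) \<circ> (\<lambda>\<omega>. \<lambda>i\<in>p ` I. U i \<omega>) = (\<lambda>\<omega>. \<lambda>i\<in>I. U (p i) \<omega>)"
    by (auto simp: fun_eq_iff restrict_def)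
  finally show ?thesis by (rule sym)
qed

lemma max_law_eq:
  assumes "1 \<le> n" shows "max_law n (distr M borel (U 0)) = distr M borel (mx n)"
proof -
  have "max_law n (distr M borel (U 0)) =
      distr (distr M (Pi\<^sub>M {1..n} (\<lambda>_. borel)) (\<lambda>\<omega>. \<lambda>i\<in>{1..n}. U i \<omega>)) borel (bcontfun_Max {1..n})"
    unfolding max_law_def using assms distr_U_reindex[of "{1..n}" "\<lambda>i. i"] by simp
  also have "\<dots> = distr M borel (mx n)"
    unfolding mx_restrict[abs_def]
    by (subst distr_distr)
       (use assms in \<open>auto simp: comp_def intro!: measurable_bcontfun_Max measurable_restrict U\<close>)
  finally show ?thesis .
qed

lemma tendsto_integral_W:
  fixes \<phi> :: "('s \<Rightarrow>\<^sub>C real) \<Rightarrow> real"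
  assumes cont: "continuous_on UNIV \<phi>" and bdd: "bounded (range \<phi>)"
  shows "(\<lambda>n. \<integral>\<omega>. \<phi> (W n \<omega>) \<partial>M) \<longlonglongrightarrow> (\<integral>\<omega>. \<phi> (\<eta> \<omega>) \<partial>N)"
proof -
  let ?sc = "\<lambda>n (g :: 's \<Rightarrow>\<^sub>C real). real n *\<^sub>R (g - const_bcontfun 1)"
  have [measurable]: "\<phi> \<in> borel_measurable borel"
    using cont by (rule borel_measurable_continuous_onI)
  have [measurable]: "?sc n \<in> borel_measurable borel" for n
    by (rule borel_measurable_bcontfunI[OF cpt]) simp
  have "(\<lambda>n. \<integral>x. \<phi> x \<partial>(distr (max_law n (distr M borel (U 0))) borel (?sc n))) \<longlonglongrightarrow>
      (\<integral>x. \<phi> x \<partial>(distr N borel \<eta>))"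
    using domain cont bdd unfolding in_max_domain_def weakly_converges_def by blast
  then have "(\<lambda>n. \<integral>x. \<phi> x \<partial>(distr (max_law n (distr M borel (U 0))) borel (?sc n))) \<longlonglongrightarrow>
      (\<integral>\<omega>. \<phi> (\<eta> \<omega>) \<partial>N)"
    by (simp add: integral_distr)
  moreover have "eventually (\<lambda>n. (\<integral>x. \<phi> x \<partial>(distr (max_law n (distr M borel (U 0))) borel (?sc n)))
      = (\<integral>\<omega>. \<phi> (W n \<omega>) \<partial>M)) sequentially"
    using eventually_ge_at_top[of 1]
  proof eventually_elim
    case (elim n)
    then show ?case
      unfolding max_law_eq[OF elim]
      by (subst distr_distr) (auto simp: integral_distr comp_def W_def)
  qed
  ultimately show ?thesis
    by (rule Lim_transform_eventually)
qed

text \<open>Half of the portmanteau theorem for sublevel sets. The ramp \<phi> is 1 where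
  \<open>a\<close> is at most 0 and vanishes where \<open>a\<close> is at least \<open>e\<close>;
  the slack \<open>e\<close> avoids any question about mass on the boundary.\<close>

lemma eventually_prob_W_le:
  fixes a :: "('s \<Rightarrow>\<^sub>C real) \<Rightarrow> real"
  assumes cont: "continuous_on UNIV a" and e: "0 < e" and d: "0 < d"
  shows "eventually (\<lambda>n. M.prob {\<omega> \<in> space M. a (W n \<omega>) \<le> 0}
           \<le> N.prob {\<omega> \<in> space N. a (\<eta> \<omega>) \<le> e} + d) sequentially"
proof -
  define \<phi> where "\<phi> x = max 0 (min 1 (1 - a x / e))" for x
  have cphi: "continuous_on UNIV \<phi>" unfolding \<phi>_def by (intro continuous_intros cont) (use e in auto)
  have \<phi>01: "0 \<le> \<phi> x" "\<phi> x \<le> 1" for x by (auto simp: \<phi>_def)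
  have bphi: "bounded (range \<phi>)" using \<phi>01 by (intro boundedI[where B = 1]) auto
  have [measurable]: "\<phi> \<in> borel_measurable borel" "a \<in> borel_measurable borel"
    using cphi cont by (auto intro: borel_measurable_continuous_onI)
  have "(\<integral>\<omega>. \<phi> (\<eta> \<omega>) \<partial>N) \<le> (\<integral>\<omega>. indicator {\<omega> \<in> space N. a (\<eta> \<omega>) \<le> e} \<omega> \<partial>N)"
  proof (rule integral_mono)
    show "integrable N (\<lambda>\<omega>. \<phi> (\<eta> \<omega>))"
      using \<phi>01 by (intro N.integrable_const_bound[where B = 1]) auto
    show "\<phi> (\<eta> \<omega>) \<le> indicator {\<omega> \<in> space N. a (\<eta> \<omega>) \<le> e} \<omega>" if "\<omega> \<in> space N" for \<omega>
      using that e \<phi>01(2) by (auto simp: \<phi>_def indicator_def field_simps)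
  qed (auto simp: N.emeasure_eq_measure)
  also have "\<dots> = N.prob {\<omega> \<in> space N. a (\<eta> \<omega>) \<le> e}" by simp
  finally have "(\<integral>\<omega>. \<phi> (\<eta> \<omega>) \<partial>N) < N.prob {\<omega> \<in> space N. a (\<eta> \<omega>) \<le> e} + d"
    using d by linarith
  then have "eventually (\<lambda>n. (\<integral>\<omega>. \<phi> (W n \<omega>) \<partial>M) < N.prob {\<omega> \<in> space N. a (\<eta> \<omega>) \<le> e} + d) sequentially"
    by (rule order_tendstoD(2)[OF tendsto_integral_W[OF cphi bphi]])
  then show ?thesis
    using eventually_ge_at_top[of 1]
  proof eventually_elim
    case (elim n)
    note [measurable] = measurable_W[OF elim(2)]
    have "(\<integral>\<omega>. indicator {\<omega> \<in> space M. a (W n \<omega>) \<le> 0} \<omega> \<partial>M) \<le> (\<integral>\<omega>. \<phi> (W n \<omega>) \<partial>M)"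
    proof (rule integral_mono)
      show "integrable M (\<lambda>\<omega>. \<phi> (W n \<omega>))"
        using \<phi>01 by (intro M.integrable_const_bound[where B = 1]) auto
      show "indicator {\<omega> \<in> space M. a (W n \<omega>) \<le> 0} \<omega> \<le> \<phi> (W n \<omega>)" for \<omega>
        using e \<phi>01(1) divide_nonpos_pos[of "a (W n \<omega>)" e] by (auto simp: \<phi>_def indicator_def)
    qed (auto simp: M.emeasure_eq_measure)
    then show ?case using elim by simp
  qed
qed

text \<open>The opposite half: now the ramp is 1 where \<open>a\<close> is at most
  \<open>- e\<close> and vanishes where \<open>a\<close> is nonnegative.\<close>

lemma eventually_prob_W_ge:
  fixes a :: "('s \<Rightarrow>\<^sub>C real) \<Rightarrow> real"
  assumes cont: "continuous_on UNIV a" and e: "0 < e" and d: "0 < d"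
  shows "eventually (\<lambda>n. N.prob {\<omega> \<in> space N. a (\<eta> \<omega>) \<le> - e} - d
           \<le> M.prob {\<omega> \<in> space M. a (W n \<omega>) \<le> 0}) sequentially"
proof -
  define \<phi> where "\<phi> x = max 0 (min 1 (- a x / e))" for x
  have cphi: "continuous_on UNIV \<phi>" unfolding \<phi>_def by (intro continuous_intros cont) (use e in auto)
  have \<phi>01: "0 \<le> \<phi> x" "\<phi> x \<le> 1" for x by (auto simp: \<phi>_def)
  have bphi: "bounded (range \<phi>)" using \<phi>01 by (intro boundedI[where B = 1]) auto
  have [measurable]: "\<phi> \<in> borel_measurable borel" "a \<in> borel_measurable borel"
    using cphi cont by (auto intro: borel_measurable_continuous_onI)
  have "N.prob {\<omega> \<in> space N. a (\<eta> \<omega>) \<le> - e} = (\<integral>\<omega>. indicator {\<omega> \<in> space N. a (\<eta> \<omega>) \<le> - e} \<omega> \<partial>N)"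
    by simp
  also have "\<dots> \<le> (\<integral>\<omega>. \<phi> (\<eta> \<omega>) \<partial>N)"
  proof (rule integral_mono)
    show "integrable N (\<lambda>\<omega>. \<phi> (\<eta> \<omega>))"
      using \<phi>01 by (intro N.integrable_const_bound[where B = 1]) auto
    show "indicator {\<omega> \<in> space N. a (\<eta> \<omega>) \<le> - e} \<omega> \<le> \<phi> (\<eta> \<omega>)" if "\<omega> \<in> space N" for \<omega>
      using that e \<phi>01(1) by (auto simp: \<phi>_def indicator_def field_simps)
  qed (auto simp: N.emeasure_eq_measure)
  finally have "N.prob {\<omega> \<in> space N. a (\<eta> \<omega>) \<le> - e} - d < (\<integral>\<omega>. \<phi> (\<eta> \<omega>) \<partial>N)"
    using d by linarith
  then have "eventually (\<lambda>n. N.prob {\<omega> \<in> space N. a (\<eta> \<omega>) \<le> - e} - d < (\<integral>\<omega>. \<phi> (W n \<omega>) \<partial>M)) sequentially"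
    by (rule order_tendstoD(1)[OF tendsto_integral_W[OF cphi bphi]])
  then show ?thesis
    using eventually_ge_at_top[of 1]
  proof eventually_elim
    case (elim n)
    note [measurable] = measurable_W[OF elim(2)]
    have "(\<integral>\<omega>. \<phi> (W n \<omega>) \<partial>M) \<le> (\<integral>\<omega>. indicator {\<omega> \<in> space M. a (W n \<omega>) \<le> 0} \<omega> \<partial>M)"
    proof (rule integral_mono)
      show "integrable M (\<lambda>\<omega>. \<phi> (W n \<omega>))"
        using \<phi>01 by (intro M.integrable_const_bound[where B = 1]) auto
      show "\<phi> (W n \<omega>) \<le> indicator {\<omega> \<in> space M. a (W n \<omega>) \<le> 0} \<omega>" if "\<omega> \<in> space M" for \<omega>
      proof (cases "a (W n \<omega>) \<le> 0")
        case False
        then have "- a (W n \<omega>) / e \<le> 0" using e by simp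
        then show ?thesis by (simp add: \<phi>_def)
      qed (use that \<phi>01(2) in simp)
    qed (auto simp: M.emeasure_eq_measure)
    then show ?case using elim by simp
  qed
qed

lemma prob_U_eq:
  assumes "Measurable.pred borel Q"
  shows "M.prob {\<omega> \<in> space M. Q (U i \<omega>)} = M.prob {\<omega> \<in> space M. Q (U 0 \<omega>)}"
proof -
  have "{x. Q x} \<in> sets borel" using assms by (simp add: pred_def)
  then have "M.prob {\<omega> \<in> space M. Q (U i \<omega>)} = measure (distr M borel (U i)) {x. Q x}" for i
    by (subst measure_distr) (auto simp: vimage_def Int_def conj_commute intro!: arg_cong[where f = M.prob])
  then show ?thesis using ident[of i] by simp
qed

lemma prob_U_all:
  assumes Q: "\<And>i. i \<in> I \<Longrightarrow> Measurable.pred borel (Q i)" and I: "finite I" "I \<noteq> {}"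
  shows "M.prob {\<omega> \<in> space M. \<forall>i\<in>I. Q i (U i \<omega>)} = (\<Prod>i\<in>I. M.prob {\<omega> \<in> space M. Q i (U 0 \<omega>)})"
proof -
  have "{\<omega> \<in> space M. \<forall>i\<in>I. Q i (U i \<omega>)} = (\<Inter>i\<in>I. U i -` {x. Q i x} \<inter> space M)"
    using I by auto
  also have "M.prob \<dots> = (\<Prod>i\<in>I. M.prob (U i -` {x. Q i x} \<inter> space M))"
    using Q I by (intro M.indep_varsD[OF indep]) (auto simp: pred_def)
  also have "\<dots> = (\<Prod>i\<in>I. M.prob {\<omega> \<in> space M. Q i (U 0 \<omega>)})"
  proof (rule prod.cong[OF refl])
    fix i assume "i \<in> I"
    then show "M.prob (U i -` {x. Q i x} \<inter> space M) = M.prob {\<omega> \<in> space M. Q i (U 0 \<omega>)}"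
      using prob_U_eq[OF Q, of i i]
      by (auto simp: vimage_def Int_def conj_commute)
  qed
  finally show ?thesis .
qed

section \<open>Exceedance probabilities at finitely many points\<close>

lemma AE_\<eta>_nonpos: "AE \<omega> in N. \<forall>s. \<eta> \<omega> s \<le> 0"
proof -
  have "(\<lambda>_. 0) \<in> E_minus" by (simp add: E_minus_def E_space_def)
  from prob_\<eta>_le[OF this] have "N.prob {\<omega> \<in> space N. \<forall>s. \<eta> \<omega> s \<le> 0} = 1"
    by (simp add: D_norm_def)
  then show ?thesis
    using N.prob_Collect_eq_1[of "\<lambda>\<omega>. \<forall>s. \<eta> \<omega> s \<le> 0"]
    by (metis (mono_tags, lifting) N.AE_prob_1 AE_mp AE_I2 mem_Collect_eq)
qed

text \<open>Almost surely \<eta> is nonpositive, so replacing \<open>g\<close> by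
  \<open>min (g s) 0\<close> on \<open>A\<close> and by 0 elsewhere does not change the probability,
  and the result lies in \<open>E_minus\<close>.\<close>

lemma prob_\<eta>_le_finite:
  assumes A: "finite A" "A \<noteq> {}"
  shows "N.prob {\<omega> \<in> space N. \<forall>s\<in>A. \<eta> \<omega> s \<le> g s} = exp (- (\<integral>\<omega>. (MAX s\<in>A. wt g \<omega> s) \<partial>L))"
proof -
  let ?f = "\<lambda>s. if s \<in> A then min (g s) 0 else 0 :: real"
  have f: "?f \<in> E_minus" using A by (intro E_minus_indicator) auto
  have "N.prob {\<omega> \<in> space N. \<forall>s\<in>A. \<eta> \<omega> s \<le> g s} = N.prob {\<omega> \<in> space N. \<forall>s. \<eta> \<omega> s \<le> ?f s}"
  proof (rule N.finite_measure_eq_AE)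
    show "AE x in N. (x \<in> {\<omega> \<in> space N. \<forall>s\<in>A. \<eta> \<omega> s \<le> g s})
        = (x \<in> {\<omega> \<in> space N. \<forall>s. \<eta> \<omega> s \<le> ?f s})"
      using AE_\<eta>_nonpos by eventually_elim auto
    show "{\<omega> \<in> space N. \<forall>s\<in>A. \<eta> \<omega> s \<le> g s} \<in> sets N"
      using A by (auto intro!: sets.sets_Collect_finite_All)
    \<comment> \<open>Measurability comes from the value of the probability: a nonmeasurable set has
      measure 0, but here it is an exponential.\<close>
    have "{\<omega> \<in> space N. \<forall>s. \<eta> \<omega> s \<le> ?f s} \<in> sets N"
      using prob_\<eta>_le[OF f] measure_notin_sets[of "{\<omega> \<in> space N. \<forall>s. \<eta> \<omega> s \<le> ?f s}" N]
        exp_gt_zero[of "- D_norm L Z ?f"] by linarith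
    then show "{\<omega> \<in> space N. \<forall>s. \<eta> \<omega> s \<le> ?f s} \<in> sets N" .
  qed
  also have "\<dots> = exp (- D_norm L Z ?f)" by (rule prob_\<eta>_le[OF f])
  finally show ?thesis unfolding D_norm_indicator[OF A] .
qed

text \<open>Both portmanteau bounds are evaluated at the levels \<open>g - e\<close> and
  \<open>g + e\<close>; this moves the exponent by at most \<open>e * C\<close>, which vanishes with
  \<open>e\<close>.\<close>

lemma tendsto_prob_W_le_finite:
  assumes A: "finite A" "A \<noteq> {}"
  shows "(\<lambda>n. M.prob {\<omega> \<in> space M. \<forall>s\<in>A. W n \<omega> s \<le> g s})
    \<longlonglongrightarrow> exp (- (\<integral>\<omega>. (MAX s\<in>A. wt g \<omega> s) \<partial>L))"
proof -
  define a where "a x = (MAX s\<in>A. apply_bcontfun x s - g s)" for x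
  define m where "m = (\<integral>\<omega>. (MAX s\<in>A. wt g \<omega> s) \<partial>L)"
  have cont: "continuous_on UNIV a"
    unfolding a_def by (intro continuous_on_Max A continuous_intros continuous_on_eval)
  have a_le: "a x \<le> e \<longleftrightarrow> (\<forall>s\<in>A. x s \<le> g s + e)" for x e
    unfolding a_def using A by (auto simp: algebra_simps)
  have "eventually (\<lambda>n. b < M.prob {\<omega> \<in> space M. a (W n \<omega>) \<le> 0}) sequentially" if b: "b < exp (- m)" for b
  proof -
    \<comment> \<open>The same \<open>e\<close> serves as slack in the level, whence
      \<open>e * C\<close>, and as loss in probability, whence the subtracted
      \<open>e\<close>.\<close>
    have "((\<lambda>e. exp (- (m + e * C)) - e) \<longlongrightarrow> exp (- (m + 0 * C)) - 0) (at_right 0)"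
      by (intro tendsto_intros)
    then have "eventually (\<lambda>e. b < exp (- (m + e * C)) - e) (at_right 0)"
      by (rule order_tendstoD) (use b in simp)
    then have "eventually (\<lambda>e. b < exp (- (m + e * C)) - e \<and> 0 < e) (at_right 0)"
      using eventually_at_right_less by (rule eventually_conj)
    then obtain e where e: "0 < e" "b < exp (- (m + e * C)) - e"
      using eventually_happens'[OF trivial_limit_at_right_real] by blast
    have "(\<integral>\<omega>. (MAX s\<in>A. wt (\<lambda>s. g s + - e) \<omega> s) \<partial>L) \<le> m + e * C"
      unfolding m_def using e by (intro integral_Max_wt_add A) auto
    then have "exp (- (m + e * C)) \<le> N.prob {\<omega> \<in> space N. a (\<eta> \<omega>) \<le> - e}"
      unfolding a_le prob_\<eta>_le_finite[OF A] by simp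
    then have "b < N.prob {\<omega> \<in> space N. a (\<eta> \<omega>) \<le> - e} - e" using e by linarith
    then show ?thesis
      using eventually_prob_W_ge[OF cont e(1) e(1)] by (auto elim: eventually_mono)
  qed
  moreover have "eventually (\<lambda>n. M.prob {\<omega> \<in> space M. a (W n \<omega>) \<le> 0} < b) sequentially" if b: "exp (- m) < b" for b
  proof -
    have "((\<lambda>e. exp (- (m - e * C)) + e) \<longlongrightarrow> exp (- (m - 0 * C)) + 0) (at_right 0)"
      by (intro tendsto_intros)
    then have "eventually (\<lambda>e. exp (- (m - e * C)) + e < b) (at_right 0)"
      by (rule order_tendstoD) (use b in simp)
    then have "eventually (\<lambda>e. exp (- (m - e * C)) + e < b \<and> 0 < e) (at_right 0)"
      using eventually_at_right_less by (rule eventually_conj)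
    then obtain e where e: "0 < e" "exp (- (m - e * C)) + e < b"
      using eventually_happens'[OF trivial_limit_at_right_real] by blast
    have "m \<le> (\<integral>\<omega>. (MAX s\<in>A. wt (\<lambda>s. g s + e) \<omega> s) \<partial>L) + e * C"
      unfolding m_def using e by (intro integral_Max_wt_add A) auto
    then have "N.prob {\<omega> \<in> space N. a (\<eta> \<omega>) \<le> e} \<le> exp (- (m - e * C))"
      unfolding a_le prob_\<eta>_le_finite[OF A] by simp
    then have "N.prob {\<omega> \<in> space N. a (\<eta> \<omega>) \<le> e} + e < b" using e by linarith
    then show ?thesis
      using eventually_prob_W_le[OF cont e(1) e(1)] by (auto elim: eventually_mono)
  qed
  ultimately have "(\<lambda>n. M.prob {\<omega> \<in> space M. a (W n \<omega>) \<le> 0}) \<longlonglongrightarrow> exp (- m)"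
    by (intro order_tendstoI)
  then show ?thesis by (simp add: a_le m_def)
qed

lemma pred_exists_finite [measurable]:
  "finite A \<Longrightarrow> Measurable.pred borel (\<lambda>x :: 's \<Rightarrow>\<^sub>C real. \<exists>s\<in>A. g s < real n * (apply_bcontfun x s - 1))"
  by (intro pred_intros_finite) measurable

lemma tendsto_prob_exists_finite:
  assumes A: "finite A" "A \<noteq> {}"
  shows "(\<lambda>n. real n * M.prob {\<omega> \<in> space M. \<exists>s\<in>A. g s < real n * (U 0 \<omega> s - 1)})
    \<longlonglongrightarrow> (\<integral>\<omega>. (MAX s\<in>A. wt g \<omega> s) \<partial>L)"
proof -
  define p where "p n = M.prob {\<omega> \<in> space M. \<not> (\<exists>s\<in>A. g s < real n * (U 0 \<omega> s - 1))}" for n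
  have m: "Measurable.pred borel (\<lambda>x :: 's \<Rightarrow>\<^sub>C real. \<not> (\<exists>s\<in>A. g s < real n * (x s - 1)))" for n
    using A(1) by measurable
  have "eventually (\<lambda>n. M.prob {\<omega> \<in> space M. \<forall>s\<in>A. W n \<omega> s \<le> g s} = p n ^ n) sequentially"
    using eventually_ge_at_top[of 1]
  proof eventually_elim
    case (elim n)
    have "{\<omega> \<in> space M. \<forall>s\<in>A. W n \<omega> s \<le> g s}
        = {\<omega> \<in> space M. \<forall>i\<in>{1..n}. \<not> (\<exists>s\<in>A. g s < real n * (U i \<omega> s - 1))}"
      using W_le_iff[OF elim] by (auto simp: not_less)
    also have "M.prob \<dots> = (\<Prod>i\<in>{1..n}. p n)"
      unfolding p_def using elim by (intro prob_U_all m) auto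
    finally show ?case by simp
  qed
  then have "(\<lambda>n. p n ^ n) \<longlonglongrightarrow> exp (- (\<integral>\<omega>. (MAX s\<in>A. wt g \<omega> s) \<partial>L))"
    by (rule Lim_transform_eventually[OF tendsto_prob_W_le_finite[OF A]])
  then have "(\<lambda>n. real n * (1 - p n)) \<longlonglongrightarrow> (\<integral>\<omega>. (MAX s\<in>A. wt g \<omega> s) \<partial>L)"
    by (rule tendsto_of_nat_mult_one_minus[rotated 2]) (auto simp: p_def)
  moreover have "1 - p n = M.prob {\<omega> \<in> space M. \<exists>s\<in>A. g s < real n * (U 0 \<omega> s - 1)}" for n
  proof -
    have "{\<omega> \<in> space M. \<exists>s\<in>A. g s < real n * (U 0 \<omega> s - 1)} \<in> M.events"
      using A(1) by measurable
    then show ?thesis unfolding p_def by (subst M.prob_neg) auto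
  qed
  ultimately show ?thesis by simp
qed

text \<open>With \<open>b\<close> the minimum of \<open>B\<close> this is the modular law
  \<open>min x b + min a b = min (min x a) b + min (max x a) b\<close>, the counterpart for weights
  of inclusion-exclusion for events. Writing it with \<open>insert\<close> includes empty
  \<open>B\<close>.\<close>

lemma Min_insert_Max_identity:
  fixes x a :: real
  assumes "finite B"
  shows "Min (insert x (insert a B)) = Min (insert x B) + Min (insert a B) - Min (insert (max x a) B)"
proof (cases "B = {}")
  case False
  have "min x (min a b) = min x b + min a b - min (max x a) b" for b by linarith
  then show ?thesis using assms False by simp
qed (simp add: min_def max_def)

text \<open>Inclusion-exclusion, one point at a time: \<open>1\<^sub>t * 1\<^sub>A = 1\<^sub>t + 1\<^sub>A - 1\<^sub>A\<^sub>+\<^sub>t\<close> for the exceedances over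
  a point \<open>t\<close> and over some point of \<open>A\<close>.\<close>

lemma tendsto_prob_all_exists_finite:
  assumes "finite T" "finite A" "A \<noteq> {}"
  shows "(\<lambda>n. real n * M.prob {\<omega> \<in> space M. (\<forall>t\<in>T. g t < real n * (U 0 \<omega> t - 1)) \<and>
        (\<exists>s\<in>A. g s < real n * (U 0 \<omega> s - 1))})
    \<longlonglongrightarrow> (\<integral>\<omega>. Min (insert (MAX s\<in>A. wt g \<omega> s) (wt g \<omega> ` T)) \<partial>L)"
  using assms
proof (induction T arbitrary: A rule: finite_induct)
  case empty
  then show ?case using tendsto_prob_exists_finite[of A g] by simp
next
  case (insert t T)
  let ?h = "\<lambda>n \<omega> s. g s < real n * (U 0 \<omega> s - 1)"
  let ?E = "\<lambda>n A. {\<omega> \<in> space M. (\<forall>t\<in>T. ?h n \<omega> t) \<and> (\<exists>s\<in>A. ?h n \<omega> s)}"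
  let ?I = "\<lambda>A \<omega>. Min (Set.insert (MAX s\<in>A. wt g \<omega> s) (wt g \<omega> ` T))"
  have meas: "?E n B \<in> M.events" if "finite B" for n B
    using that insert.hyps(1) by measurable
  have int: "integrable L (?I B)" if B: "finite B" "B \<noteq> {}" for B
  proof (cases "T = {}")
    case False
    then have "?I B = (\<lambda>\<omega>. min (MAX s\<in>B. wt g \<omega> s) (MIN s\<in>T. wt g \<omega> s))"
      using insert.hyps(1) by auto
    then show ?thesis
      using integrable_Max_wt[OF B] integrable_Min_wt[OF insert.hyps(1) False] by auto
  qed (use integrable_Max_wt[OF B] in auto)
  have eq: "M.prob {\<omega> \<in> space M. (\<forall>t\<in>Set.insert t T. ?h n \<omega> t) \<and> (\<exists>s\<in>A. ?h n \<omega> s)}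
      = M.prob (?E n {t}) + M.prob (?E n A) - M.prob (?E n (Set.insert t A))" for n
  proof -
    have "{\<omega> \<in> space M. (\<forall>t\<in>Set.insert t T. ?h n \<omega> t) \<and> (\<exists>s\<in>A. ?h n \<omega> s)} = ?E n {t} \<inter> ?E n A"
      by auto
    moreover have "?E n (Set.insert t A) = ?E n {t} \<union> ?E n A" by auto
    ultimately show ?thesis
      using M.finite_measure_Union'[OF meas[of "{t}" n] meas[of A n]]
        M.finite_measure_Diff'[OF meas[of A n] meas[of "{t}" n]] insert.prems
      by (simp add: Int_commute)
  qed
  \<comment> \<open>The hypothesis is needed for \<open>{t}\<close>, \<open>A\<close> and their
    union, hence the induction with arbitrary \<open>A\<close>.\<close>
  have "(\<lambda>n. real n * M.prob (?E n {t}) + real n * M.prob (?E n A) - real n * M.prob (?E n (Set.insert t A)))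
     \<longlonglongrightarrow> (\<integral>\<omega>. ?I {t} \<omega> \<partial>L) + (\<integral>\<omega>. ?I A \<omega> \<partial>L) - (\<integral>\<omega>. ?I (Set.insert t A) \<omega> \<partial>L)"
    using insert.prems by (intro tendsto_intros insert.IH) auto
  also have "(\<integral>\<omega>. ?I {t} \<omega> \<partial>L) + (\<integral>\<omega>. ?I A \<omega> \<partial>L) - (\<integral>\<omega>. ?I (Set.insert t A) \<omega> \<partial>L)
      = (\<integral>\<omega>. ?I {t} \<omega> + ?I A \<omega> - ?I (Set.insert t A) \<omega> \<partial>L)"
    using int[of "{t}"] int[of A] int[of "Set.insert t A"] insert.prems by simp
  also have "\<dots> = (\<integral>\<omega>. Min (Set.insert (MAX s\<in>A. wt g \<omega> s) (wt g \<omega> ` Set.insert t T)) \<partial>L)"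
  proof (rule Bochner_Integration.integral_cong[OF refl])
    fix \<omega>
    have "(MAX s\<in>Set.insert t A. wt g \<omega> s) = max (MAX s\<in>A. wt g \<omega> s) (wt g \<omega> t)"
      using insert.prems by (simp add: max.commute)
    then show "?I {t} \<omega> + ?I A \<omega> - ?I (Set.insert t A) \<omega>
        = Min (Set.insert (MAX s\<in>A. wt g \<omega> s) (wt g \<omega> ` Set.insert t T))"
      using Min_insert_Max_identity[of "wt g \<omega> ` T" "MAX s\<in>A. wt g \<omega> s" "wt g \<omega> t"] insert.hyps(1)
      by simp
  qed
  finally show ?case unfolding eq by (simp add: algebra_simps)
qed

lemma tendsto_prob_all_finite:
  assumes T: "finite T" "T \<noteq> {}"
  shows "(\<lambda>n. real n * M.prob {\<omega> \<in> space M. \<forall>t\<in>T. g t < real n * (U 0 \<omega> t - 1)})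
    \<longlonglongrightarrow> (\<integral>\<omega>. (MIN s\<in>T. wt g \<omega> s) \<partial>L)"
proof -
  \<comment> \<open>With \<open>A = {t}\<close> and \<open>t\<close> in \<open>T\<close> the
    existence clause follows from the universal one and drops out.\<close>
  obtain t where t: "t \<in> T" using T by blast
  have "{\<omega> \<in> space M. (\<forall>t\<in>T. g t < real n * (U 0 \<omega> t - 1)) \<and> (\<exists>s\<in>{t}. g s < real n * (U 0 \<omega> s - 1))}
      = {\<omega> \<in> space M. \<forall>t\<in>T. g t < real n * (U 0 \<omega> t - 1)}" for n
    using t by auto
  moreover have "Set.insert (MAX s\<in>{t}. wt g \<omega> s) (wt g \<omega> ` T) = wt g \<omega> ` T" for \<omega>
    using t by auto
  ultimately show ?thesis
    using tendsto_prob_all_exists_finite[OF T(1), of "{t}" g] by simp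
qed

end

section \<open>The survival function of a single observation\<close>

text \<open>The map is 1-Lipschitz whatever \<open>g\<close> is; boundedness of \<open>g\<close>
  ensures that the infimum is a genuine one.\<close>

lemma continuous_on_INF_diff:
  assumes g: "\<And>s. \<bar>g s\<bar> \<le> c"
  shows "continuous_on UNIV (\<lambda>x :: 's::metric_space \<Rightarrow>\<^sub>C real. INF s. apply_bcontfun x s - g s)"
proof -
  have bdd: "bdd_below (range (\<lambda>s. apply_bcontfun x s - g s))" for x :: "'s \<Rightarrow>\<^sub>C real"
  proof -
    obtain b where b: "\<And>s. \<bar>x s\<bar> \<le> b" using bcontfun_bounded[of x] by blast
    show ?thesis
    proof (rule bdd_belowI2)
      show "- b - c \<le> x s - g s" for s using b[of s] g[of s] by linarith
    qed
  qed
  have le: "(INF s. apply_bcontfun x s - g s) - dist x y \<le> (INF s. apply_bcontfun y s - g s)" for x y :: "'s \<Rightarrow>\<^sub>C real"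
  proof (rule cINF_greatest)
    fix s
    have "(INF s. apply_bcontfun x s - g s) \<le> x s - g s" by (intro cINF_lower bdd) simp
    moreover have "\<bar>x s - y s\<bar> \<le> dist x y" using dist_bounded[of x s y] by (simp add: dist_real_def)
    ultimately show "(INF s. apply_bcontfun x s - g s) - dist x y \<le> y s - g s" by linarith
  qed simp
  have "dist (INF s. apply_bcontfun x s - g s) (INF s. apply_bcontfun y s - g s) \<le> dist x y" for x y :: "'s \<Rightarrow>\<^sub>C real"
    using le[of x y] le[of y x] unfolding dist_real_def dist_commute[of y x] by linarith
  note lip = this
  show ?thesis
    unfolding continuous_on_iff
  proof (intro ballI allI impI)
    fix x :: "'s \<Rightarrow>\<^sub>C real" and e :: real assume "0 < e"
    then show "\<exists>d>0. \<forall>y\<in>UNIV. dist y x < d \<longrightarrow>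
        dist (INF s. apply_bcontfun y s - g s) (INF s. apply_bcontfun x s - g s) < e"
      using le_less_trans[OF lip] by (intro exI[of _ e]) simp
  qed
qed

lemma INF_diff_le:
  assumes g: "\<And>s. \<bar>g s\<bar> \<le> c"
  shows "(INF s. apply_bcontfun (x :: 's::metric_space \<Rightarrow>\<^sub>C real) s - g s) \<le> x s - g s"
proof (rule cINF_lower)
  obtain b where b: "\<And>s. \<bar>x s\<bar> \<le> b" using bcontfun_bounded[of x] by blast
  show "bdd_below (range (\<lambda>s. x s - g s))"
  proof (rule bdd_belowI2)
    show "- b - c \<le> x s - g s" for s using b[of s] g[of s] by linarith
  qed
qed simp

context record_setting
begin

lemma pred_all_greater:
  assumes g: "g \<in> E_space" and X: "X \<in> borel_measurable K"
  shows "Measurable.pred K (\<lambda>\<omega>. \<forall>s. g s < real n * (apply_bcontfun (X \<omega> :: 's \<Rightarrow>\<^sub>C real) s - 1))"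
proof -
  have "Measurable.pred K (\<lambda>\<omega>. \<forall>s. 0 < real n * (apply_bcontfun (X \<omega>) s - 1) - g s)"
    by (rule measurable_all_pos_E_space[OF cpt g]) (use X in \<open>auto intro!: continuous_intros\<close>)
  then show ?thesis by simp
qed

text \<open>The events that \<open>U i\<close> is the only exceptional one among \<open>U 1, \<dots>, U n\<close> are disjoint.\<close>

lemma one_big_jump:
  assumes A: "Measurable.pred borel A" and B: "Measurable.pred borel B"
    and disj: "\<And>x. A x \<Longrightarrow> \<not> B x" and R: "R \<in> M.events"
    and sub: "\<And>\<omega> i. \<omega> \<in> space M \<Longrightarrow> i \<in> {1..n} \<Longrightarrow> A (U i \<omega>) \<Longrightarrow>
      (\<And>j. j \<in> {1..n} \<Longrightarrow> j \<noteq> i \<Longrightarrow> B (U j \<omega>)) \<Longrightarrow> \<omega> \<in> R"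
  shows "real n * M.prob {\<omega> \<in> space M. A (U 0 \<omega>)} * M.prob {\<omega> \<in> space M. B (U 0 \<omega>)} ^ n \<le> M.prob R"
proof (cases "n = 0")
  case False
  let ?a = "M.prob {\<omega> \<in> space M. A (U 0 \<omega>)}" and ?b = "M.prob {\<omega> \<in> space M. B (U 0 \<omega>)}"
  define Q where "Q i j = (if j = i then A else B)" for i j :: nat
  define E where "E i = {\<omega> \<in> space M. \<forall>j\<in>{1..n}. Q i j (U j \<omega>)}" for i
  have Q [measurable]: "Measurable.pred borel (Q i j)" for i j using A B by (simp add: Q_def)
  have E: "E i \<in> M.events" for i unfolding E_def by measurable
  have prob_E: "M.prob (E i) = ?a * ?b ^ (n - 1)" if i: "i \<in> {1..n}" for i
  proof -
    have "M.prob (E i) = (\<Prod>j\<in>{1..n}. M.prob {\<omega> \<in> space M. Q i j (U 0 \<omega>)})"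
      unfolding E_def using False by (intro prob_U_all Q) auto
    also have "\<dots> = ?a * (\<Prod>j\<in>{1..n} - {i}. M.prob {\<omega> \<in> space M. Q i j (U 0 \<omega>)})"
      using i by (subst prod.remove[of _ i]) (auto simp: Q_def)
    also have "(\<Prod>j\<in>{1..n} - {i}. M.prob {\<omega> \<in> space M. Q i j (U 0 \<omega>)}) = (\<Prod>j\<in>{1..n} - {i}. ?b)"
      by (intro prod.cong) (auto simp: Q_def)
    also have "\<dots> = ?b ^ (n - 1)" using i by simp
    finally show ?thesis .
  qed
  have "disjoint_family_on E {1..n}"
    unfolding disjoint_family_on_def
  proof (intro ballI impI)
    fix i j assume ij: "i \<in> {1..n}" "j \<in> {1..n}" "i \<noteq> j"
    show "E i \<inter> E j = {}"
    proof (rule equals0I)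
      fix \<omega> assume "\<omega> \<in> E i \<inter> E j"
      then have "Q i i (U i \<omega>)" "Q j i (U i \<omega>)" using ij(1) by (auto simp: E_def)
      then show False using disj ij(3) by (simp add: Q_def)
    qed
  qed
  then have "M.prob (\<Union>i\<in>{1..n}. E i) = (\<Sum>i\<in>{1..n}. M.prob (E i))"
    using E by (intro M.finite_measure_finite_Union) auto
  also have "\<dots> = real n * (?a * ?b ^ (n - 1))"
    using prob_E by simp
  finally have "real n * (?a * ?b ^ (n - 1)) = M.prob (\<Union>i\<in>{1..n}. E i)" by simp
  also have "\<dots> \<le> M.prob R"
  proof (rule M.finite_measure_mono[OF _ R])
    show "(\<Union>i\<in>{1..n}. E i) \<subseteq> R"
    proof safe
      fix \<omega> i assume i: "i \<in> {1..n}" and \<omega>: "\<omega> \<in> E i"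
      show "\<omega> \<in> R"
      proof (rule sub[OF _ i])
        show "\<omega> \<in> space M" using \<omega> by (simp add: E_def)
        have "Q i i (U i \<omega>)" using \<omega> i by (simp add: E_def)
        then show "A (U i \<omega>)" by (simp add: Q_def)
        show "B (U j \<omega>)" if "j \<in> {1..n}" "j \<noteq> i" for j
        proof -
          have "Q i j (U j \<omega>)" using \<omega> that(1) by (simp add: E_def)
          then show ?thesis using that(2) by (simp add: Q_def)
        qed
      qed
    qed
  qed
  finally have "real n * (?a * ?b ^ (n - 1)) \<le> M.prob R" .
  \<comment> \<open>Only \<open>n - 1\<close> observations are required to be small. The weaker
    \<open>n\<close>-th power is the probability that all of them are, which the limit law
    controls.\<close>
  moreover have "?b ^ n \<le> ?b ^ (n - 1)" by (intro power_decreasing) auto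
  then have "real n * (?a * ?b ^ n) \<le> real n * (?a * ?b ^ (n - 1))"
    by (intro mult_left_mono) auto
  ultimately show ?thesis by (simp add: mult.assoc)
qed simp

text \<open>By independence the power is the probability that \<open>W n\<close> stays below
  \<open>- c\<close> everywhere. It is bounded away from 0 because \<eta> lies below any constant
  with probability the exponential of a finite number.\<close>

lemma eventually_prob_U_le_power:
  obtains \<kappa> where "0 < \<kappa>"
    and "eventually (\<lambda>n. \<kappa> \<le> M.prob {\<omega> \<in> space M. \<forall>s. real n * (U 0 \<omega> s - 1) \<le> - c} ^ n) sequentially"
proof -
  \<comment> \<open>This is the supremum of \<open>x + c\<close>, written through an infimum so that
    its continuity is already known.\<close>
  define a where "a x = - (INF s. apply_bcontfun (- x) s - c)" for x :: "'s \<Rightarrow>\<^sub>C real"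
  have cont: "continuous_on UNIV a"
    unfolding a_def
    by (intro continuous_on_minus continuous_on_compose2[OF continuous_on_INF_diff[where c = "\<bar>c\<bar>"]] continuous_on_id)
       auto
  have a_le: "a x \<le> e \<longleftrightarrow> (\<forall>s. x s \<le> e - c)" for x e
  proof
    assume l: "a x \<le> e"
    show "\<forall>s. x s \<le> e - c"
    proof
      fix s
      have "(INF s. apply_bcontfun (- x) s - c) \<le> (- x) s - c" by (rule INF_diff_le) (rule order_refl)
      then show "x s \<le> e - c" using l unfolding a_def by simp
    qed
  next
    assume r: "\<forall>s. x s \<le> e - c"
    have "- e \<le> (INF s. apply_bcontfun (- x) s - c)"
      by (rule cINF_greatest) (use r in \<open>auto simp: algebra_simps\<close>)
    then show "a x \<le> e" by (simp add: a_def)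
  qed
  \<comment> \<open>The \<open>- 1\<close> is the slack of the portmanteau bound, whose loss in
    probability takes the other half. Below, the minimum with 0 keeps the level in
    \<open>E_minus\<close> for every real \<open>c\<close>.\<close>
  define \<kappa> where "\<kappa> = N.prob {\<omega> \<in> space N. a (\<eta> \<omega>) \<le> - 1} / 2"
  have AE: "AE \<omega> in N. (\<omega> \<in> {\<omega> \<in> space N. a (\<eta> \<omega>) \<le> - 1}) =
      (\<omega> \<in> {\<omega> \<in> space N. \<forall>s. \<eta> \<omega> s \<le> min (- 1 - c) 0})"
    using AE_\<eta>_nonpos by eventually_elim (auto simp: a_le)
  have E: "(\<lambda>_. min (- 1 - c) 0) \<in> E_minus" by (simp add: E_minus_def E_space_def)
  have meas: "{\<omega> \<in> space N. \<forall>s. \<eta> \<omega> s \<le> min (- 1 - c) 0} \<in> N.events"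
    using prob_\<eta>_le[OF E] measure_notin_sets[of "{\<omega> \<in> space N. \<forall>s. \<eta> \<omega> s \<le> min (- 1 - c) 0}" N]
      exp_gt_zero[of "- D_norm L Z (\<lambda>_. min (- 1 - c) 0)"] by linarith
  have [measurable]: "a \<in> borel_measurable borel" using cont by (rule borel_measurable_continuous_onI)
  have "N.prob {\<omega> \<in> space N. a (\<eta> \<omega>) \<le> - 1} = N.prob {\<omega> \<in> space N. \<forall>s. \<eta> \<omega> s \<le> min (- 1 - c) 0}"
    by (rule N.finite_measure_eq_AE[OF AE _ meas]) measurable
  then have \<kappa>: "0 < \<kappa>" unfolding \<kappa>_def using prob_\<eta>_le[OF E] by simp
  have "eventually (\<lambda>n. N.prob {\<omega> \<in> space N. a (\<eta> \<omega>) \<le> - 1} - \<kappa> \<le> M.prob {\<omega> \<in> space M. a (W n \<omega>) \<le> 0}) sequentially"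
    by (rule eventually_prob_W_ge[OF cont]) (use \<kappa> in auto)
  then have "eventually (\<lambda>n. \<kappa> \<le> M.prob {\<omega> \<in> space M. \<forall>s. real n * (U 0 \<omega> s - 1) \<le> - c} ^ n) sequentially"
    using eventually_ge_at_top[of 1]
  proof eventually_elim
    case (elim n)
    have "closed {x :: 's \<Rightarrow>\<^sub>C real. \<forall>s. real n * (x s - 1) \<le> - c}"
      by (intro closed_Collect_all closed_Collect_le continuous_intros continuous_on_eval)
    then have B: "Measurable.pred borel (\<lambda>x :: 's \<Rightarrow>\<^sub>C real. \<forall>s. real n * (x s - 1) \<le> - c)"
      by (simp add: pred_def borel_closed)
    have "{\<omega> \<in> space M. a (W n \<omega>) \<le> 0} = {\<omega> \<in> space M. \<forall>i\<in>{1..n}. \<forall>s. real n * (U i \<omega> s - 1) \<le> - c}"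
      unfolding a_le using W_le_iff[OF elim(2)] by auto
    also have "M.prob \<dots> = (\<Prod>i\<in>{1..n}. M.prob {\<omega> \<in> space M. \<forall>s. real n * (U 0 \<omega> s - 1) \<le> - c})"
      using elim by (intro prob_U_all B) auto
    finally show ?case using elim(1) by (simp add: \<kappa>_def)
  qed
  with \<kappa> that show thesis by blast
qed

definition tail :: "nat \<Rightarrow> ('s \<Rightarrow> real) \<Rightarrow> real" where
  "tail n g = real n * M.prob {\<omega> \<in> space M. \<forall>s. g s < real n * (U 0 \<omega> s - 1)}"

lemma tail_event: "g \<in> E_space \<Longrightarrow> {\<omega> \<in> space M. \<forall>s. g s < real n * (U 0 \<omega> s - 1)} \<in> M.events"
  using pred_all_greater[of g "U 0" M n] by (simp add: pred_def)

text \<open>Monotonicity holds for each fixed \<open>n\<close>, and so allows a random level to be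
  enclosed between finitely many deterministic ones.\<close>

lemma tail_antimono:
  assumes "g \<in> E_space" "\<And>s. g s \<le> g' s" shows "tail n g' \<le> tail n g"
  unfolding tail_def
proof (intro mult_left_mono M.finite_measure_mono tail_event assms(1))
  show "{\<omega> \<in> space M. \<forall>s. g' s < real n * (U 0 \<omega> s - 1)} \<subseteq> {\<omega> \<in> space M. \<forall>s. g s < real n * (U 0 \<omega> s - 1)}"
    using assms(2) by (auto intro: le_less_trans)
qed simp

lemma tail_nonneg: "0 \<le> tail n g"
  unfolding tail_def by simp

text \<open>If \<open>U i\<close> is the only large one among \<open>U 1, \<dots>, U n\<close>, and exceeds \<open>g + e\<close> at \<open>q 0, \<dots>, q k\<close>
  but not \<open>g\<close> everywhere, then so does the maximum, which for large \<open>k\<close> is unlikely since the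
  limit \<open>\<eta>\<close> is continuous.\<close>

lemma oscillation_bound:
  fixes q :: "nat \<Rightarrow> 's" and k :: nat
  assumes g: "g \<in> E_space" "\<And>s. \<bar>g s\<bar> \<le> c" and e: "0 < e" and n: "1 \<le> n"
  shows "real n * M.prob {\<omega> \<in> space M. (\<forall>i\<in>{..k}. g (q i) + e < real n * (U 0 \<omega> (q i) - 1)) \<and>
        \<not> (\<forall>s. g s < real n * (U 0 \<omega> s - 1))}
      * M.prob {\<omega> \<in> space M. \<forall>s. real n * (U 0 \<omega> s - 1) \<le> - c} ^ n
    \<le> (\<integral>\<omega>. min 1 (((MIN i\<in>{..k}. W n \<omega> (q i) - g (q i)) - (INF s. W n \<omega> s - g s)) / e) \<partial>M)"
proof -
  define d where "d x = (MIN i\<in>{..k}. apply_bcontfun x (q i) - g (q i)) - (INF s. apply_bcontfun x s - g s)"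
    for x
  have cont: "continuous_on UNIV d"
    unfolding d_def
    by (intro continuous_intros continuous_on_Min continuous_on_eval continuous_on_INF_diff[OF g(2)]) auto
  have d_nonneg: "0 \<le> d x" for x
  proof -
    have "(INF s. x s - g s) \<le> (MIN i\<in>{..k}. x (q i) - g (q i))"
      by (intro Min.boundedI) (auto intro: INF_diff_le[OF g(2)])
    then show ?thesis by (simp add: d_def)
  qed
  have [measurable]: "d \<in> borel_measurable borel" using cont by (rule borel_measurable_continuous_onI)
  note [measurable] = measurable_W[OF n]
  let ?R = "{\<omega> \<in> space M. e \<le> d (W n \<omega>)}"
  let ?A = "\<lambda>x :: 's \<Rightarrow>\<^sub>C real. (\<forall>i\<in>{..k}. g (q i) + e < real n * (x (q i) - 1)) \<and> \<not> (\<forall>s. g s < real n * (x s - 1))"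
  let ?B = "\<lambda>x :: 's \<Rightarrow>\<^sub>C real. \<forall>s. real n * (x s - 1) \<le> - c"
  have "real n * M.prob {\<omega> \<in> space M. ?A (U 0 \<omega>)} * M.prob {\<omega> \<in> space M. ?B (U 0 \<omega>)} ^ n \<le> M.prob ?R"
  proof (rule one_big_jump)
    have "Measurable.pred borel (\<lambda>x :: 's \<Rightarrow>\<^sub>C real. \<forall>s. g s < real n * (x s - 1))"
      by (rule pred_all_greater[OF g(1)]) simp
    moreover have "Measurable.pred borel (\<lambda>x :: 's \<Rightarrow>\<^sub>C real. \<forall>i\<in>{..k}. g (q i) + e < real n * (x (q i) - 1))"
      by measurable
    ultimately show "Measurable.pred borel ?A" by (intro pred_intros_logic)
    have "closed {x. ?B x}"
      by (intro closed_Collect_all closed_Collect_le continuous_intros continuous_on_eval)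
    then show "Measurable.pred borel ?B"
      by (simp add: pred_def borel_closed)
    show "\<not> ?B x" if "?A x" for x
    proof
      assume B: "?B x"
      have "g (q 0) + e < real n * (x (q 0) - 1)" using that by blast
      moreover have "real n * (x (q 0) - 1) \<le> - c" using B by blast
      ultimately show False using g(2)[of "q 0"] e by linarith
    qed
    show "?R \<in> M.events" by measurable
    fix \<omega> i assume \<omega>: "\<omega> \<in> space M" and i: "i \<in> {1..n}" and A: "?A (U i \<omega>)"
      and B: "\<And>j. j \<in> {1..n} \<Longrightarrow> j \<noteq> i \<Longrightarrow> ?B (U j \<omega>)"
    have gt: "g (q l) + e < W n \<omega> (q l)" if "l \<le> k" for l
      unfolding W_greater_iff[OF n] using A i that by blast
    have "e \<le> W n \<omega> (q l) - g (q l)" if "l \<le> k" for l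
      using gt[OF that] by linarith
    then have 1: "e \<le> (MIN l\<in>{..k}. W n \<omega> (q l) - g (q l))"
      by (intro Min.boundedI) auto
    obtain s where s: "\<not> g s < real n * (U i \<omega> s - 1)" using A by blast
    \<comment> \<open>Since \<open>- c\<close> lies below \<open>g\<close>, the remaining
      observations cannot lift the maximum above \<open>g\<close> at the point where
      \<open>U i\<close> fails to exceed it.\<close>
    have "W n \<omega> s \<le> g s"
      unfolding W_le_iff[OF n]
    proof
      fix j assume j: "j \<in> {1..n}"
      show "real n * (U j \<omega> s - 1) \<le> g s"
      proof (cases "j = i")
        case False
        then have "real n * (U j \<omega> s - 1) \<le> - c" using B[OF j] by blast
        then show ?thesis using g(2)[of s] by linarith
      qed (use s in simp)
    qed
    moreover have "(INF s. W n \<omega> s - g s) \<le> W n \<omega> s - g s" by (rule INF_diff_le[OF g(2)])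
    ultimately have "(INF s. W n \<omega> s - g s) \<le> 0" by linarith
    with 1 have "e \<le> d (W n \<omega>)" unfolding d_def by linarith
    then show "\<omega> \<in> ?R" using \<omega> by simp
  qed
  also have "M.prob ?R = (\<integral>\<omega>. indicator ?R \<omega> \<partial>M)" by simp
  \<comment> \<open>A truncated Markov inequality, which replaces the event by a bounded continuous
    functional of \<open>W n\<close>, ready for the passage to \<eta>.\<close>
  also have "\<dots> \<le> (\<integral>\<omega>. min 1 (d (W n \<omega>) / e) \<partial>M)"
  proof (rule integral_mono)
    show "integrable M (\<lambda>\<omega>. min 1 (d (W n \<omega>) / e))"
      using d_nonneg e by (intro M.integrable_const_bound[where B = 1]) auto
    show "indicator ?R \<omega> \<le> min 1 (d (W n \<omega>) / e)" for \<omega>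
      using d_nonneg[of "W n \<omega>"] e by (auto simp: indicator_def)
  qed (auto simp: M.emeasure_eq_measure)
  finally show ?thesis unfolding d_def .
qed

text \<open>The upper bound restricts the event to finitely many points. For the lower bound the
  order of choice matters: \<open>e\<close> first, then \<open>k\<close>, and \<open>n\<close> last.
  The error at \<open>k\<close> points is an oscillation divided by \<kappa>, and \<kappa> depends
  neither on \<open>k\<close> nor on \<open>n\<close>.\<close>

lemma tendsto_tail:
  assumes g: "g \<in> E_space"
  shows "(\<lambda>n. tail n g) \<longlonglongrightarrow> Psi g"
proof -
  obtain q :: "nat \<Rightarrow> 's" where
    q: "\<And>k. bdd_below (range k) \<Longrightarrow> (\<And>s. isCont g s \<Longrightarrow> isCont k s) \<Longrightarrow>
           (\<lambda>n. MIN i\<in>{..n}. k (q i) :: real) \<longlonglongrightarrow> (INF s. k s)"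
    using E_space_sequence[OF cpt g] by blast
  obtain c where c: "c > 0" "\<And>s. \<bar>g s\<bar> \<le> c" using E_space_range_bounded[OF g] by blast
  define F where "F n k e = real n * M.prob {\<omega> \<in> space M. \<forall>i\<in>{..k}. g (q i) + e < real n * (U 0 \<omega> (q i) - 1)}"
    for n k e
  have F: "(\<lambda>n. F n k e) \<longlonglongrightarrow> (\<integral>\<omega>. (MIN i\<in>{..k}. wt (\<lambda>s. g s + e) \<omega> (q i)) \<partial>L)" for k e
    using tendsto_prob_all_finite[of "q ` {..k}" "\<lambda>s. g s + e"] by (simp add: F_def image_image)
  have lim_q: "(\<lambda>k. \<integral>\<omega>. (MIN i\<in>{..k::nat}. wt (\<lambda>s. g s + e) \<omega> (q i)) \<partial>L) \<longlonglongrightarrow> Psi (\<lambda>s. g s + e)" for e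
  \<comment> \<open>Adding a constant does not move the discontinuities, so the sequence chosen for
    \<open>g\<close> remains valid.\<close>
  proof (rule tendsto_Psi[OF E_space_add_const[OF g]])
    fix k :: "'s \<Rightarrow> real"
    assume "bdd_below (range k)" and k: "\<And>s. isCont (\<lambda>s. g s + e) s \<Longrightarrow> isCont k s"
    then show "(\<lambda>n. MIN i\<in>{..n}. k (q i)) \<longlonglongrightarrow> (INF s. k s)"
      by (intro q) (auto intro!: k continuous_intros)
  qed
  have F_meas: "{\<omega> \<in> space M. \<forall>i\<in>{..k}. g (q i) + e < real n * (U 0 \<omega> (q i) - 1)} \<in> M.events" for n k e
    by measurable
  have "eventually (\<lambda>n. tail n g < b) sequentially" if b: "Psi g < b" for b
  proof -
    have "eventually (\<lambda>k. (\<integral>\<omega>. (MIN i\<in>{..k::nat}. wt g \<omega> (q i)) \<partial>L) < b) sequentially"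
      using order_tendstoD(2)[OF lim_q[of 0]] b by simp
    then obtain k where "(\<integral>\<omega>. (MIN i\<in>{..k::nat}. wt g \<omega> (q i)) \<partial>L) < b"
      unfolding eventually_sequentially by blast
    then have "eventually (\<lambda>n. F n k 0 < b) sequentially"
      using order_tendstoD(2)[OF F[of k 0]] by simp
    then show ?thesis
    proof eventually_elim
      case (elim n)
      have "tail n g \<le> F n k 0"
        unfolding tail_def F_def by (intro mult_left_mono M.finite_measure_mono F_meas) auto
      with elim show ?case by linarith
    qed
  qed
  moreover have "eventually (\<lambda>n. b < tail n g) sequentially" if b: "b < Psi g" for b
  proof -
    have "((\<lambda>e. Psi g - e * C) \<longlongrightarrow> Psi g - 0 * C) (at_right 0)" by (intro tendsto_intros)
    then have "eventually (\<lambda>e. b < Psi g - e * C) (at_right 0)"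
      by (rule order_tendstoD) (use b in simp)
    then have "eventually (\<lambda>e. b < Psi g - e * C \<and> 0 < e) (at_right 0)"
      using eventually_at_right_less by (rule eventually_conj)
    then obtain e where e: "0 < e" "b < Psi g - e * C"
      using eventually_happens'[OF trivial_limit_at_right_real] by blast
    have "Psi g \<le> Psi (\<lambda>s. g s + e) + e * C"
      using e(1) by (intro Psi_mono_add E_space_add_const g) auto
    with e have b': "b < Psi (\<lambda>s. g s + e)" by linarith
    obtain \<kappa> where \<kappa>: "0 < \<kappa>" and ev_\<kappa>:
      "eventually (\<lambda>n. \<kappa> \<le> M.prob {\<omega> \<in> space M. \<forall>s. real n * (U 0 \<omega> s - 1) \<le> - c} ^ n) sequentially"
      by (rule eventually_prob_U_le_power)
    define d where "d k x = (MIN i\<in>{..k}. apply_bcontfun x (q i) - g (q i)) - (INF s. apply_bcontfun x s - g s)"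
      for k :: nat and x
    define \<phi> where "\<phi> k x = min 1 (d k x / e)" for k x
    have cont_d: "continuous_on UNIV (d k)" for k
      unfolding d_def
      by (intro continuous_intros continuous_on_Min continuous_on_eval continuous_on_INF_diff[OF c(2)]) auto
    then have cont: "continuous_on UNIV (\<phi> k)" for k
      unfolding \<phi>_def using e by (intro continuous_intros) auto
    have d_nonneg: "0 \<le> d k x" for k x
    proof -
      have "(INF s. x s - g s) \<le> (MIN i\<in>{..k}. x (q i) - g (q i))"
        by (intro Min.boundedI) (auto intro: INF_diff_le[OF c(2)])
      then show ?thesis by (simp add: d_def)
    qed
    then have \<phi>01: "0 \<le> \<phi> k x" "\<phi> k x \<le> 1" for k x using e by (auto simp: \<phi>_def)
    have [measurable]: "\<phi> k \<in> borel_measurable borel" for k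
      using cont by (rule borel_measurable_continuous_onI)
    \<comment> \<open>Here continuity of the paths enters: \<open>\<eta> \<omega> - g\<close> is
      continuous wherever \<open>g\<close> is, so its minima along \<open>q\<close> tend to its
      infimum and the gap closes.\<close>
    have "(\<lambda>k. \<integral>\<omega>. \<phi> k (\<eta> \<omega>) \<partial>N) \<longlonglongrightarrow> (\<integral>\<omega>. 0 \<partial>N)"
    proof (rule integral_dominated_convergence[where w = "\<lambda>_. 1"])
      show "AE \<omega> in N. (\<lambda>k. \<phi> k (\<eta> \<omega>)) \<longlonglongrightarrow> 0"
      proof (rule AE_I2)
        fix \<omega>
        obtain b where b: "\<And>s. \<bar>\<eta> \<omega> s\<bar> \<le> b" using bcontfun_bounded[of "\<eta> \<omega>"] by blast
        have "(\<lambda>k. MIN i\<in>{..k}. \<eta> \<omega> (q i) - g (q i)) \<longlonglongrightarrow> (INF s. \<eta> \<omega> s - g s)"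
        proof (rule q)
          show "bdd_below (range (\<lambda>s. \<eta> \<omega> s - g s))"
          proof (rule bdd_belowI2)
            show "- b - c \<le> \<eta> \<omega> s - g s" for s using b[of s] c(2)[of s] by linarith
          qed
        qed (intro continuous_intros, auto)
        then have "(\<lambda>k. \<phi> k (\<eta> \<omega>)) \<longlonglongrightarrow> min 1 (((INF s. \<eta> \<omega> s - g s) - (INF s. \<eta> \<omega> s - g s)) / e)"
          unfolding \<phi>_def d_def using e(1) by (intro tendsto_intros) auto
        then show "(\<lambda>k. \<phi> k (\<eta> \<omega>)) \<longlonglongrightarrow> 0" by simp
      qed
    qed (use \<phi>01 in auto)
    then have "(\<lambda>k. (\<integral>\<omega>. (MIN i\<in>{..k::nat}. wt (\<lambda>s. g s + e) \<omega> (q i)) \<partial>L) - (\<integral>\<omega>. \<phi> k (\<eta> \<omega>) \<partial>N) / \<kappa>)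
        \<longlonglongrightarrow> Psi (\<lambda>s. g s + e) - 0 / \<kappa>"
      using \<kappa> by (intro tendsto_intros lim_q) auto
    then have "eventually (\<lambda>k. b < (\<integral>\<omega>. (MIN i\<in>{..k::nat}. wt (\<lambda>s. g s + e) \<omega> (q i)) \<partial>L) - (\<integral>\<omega>. \<phi> k (\<eta> \<omega>) \<partial>N) / \<kappa>) sequentially"
      by (rule order_tendstoD) (use b' in simp)
    \<comment> \<open>The choice of \<open>k\<close> involves only limit quantities. For this fixed
      \<open>k\<close> both terms converge as \<open>n\<close> grows, so the strict inequality
      persists.\<close>
    then obtain k where k: "b < (\<integral>\<omega>. (MIN i\<in>{..k::nat}. wt (\<lambda>s. g s + e) \<omega> (q i)) \<partial>L) - (\<integral>\<omega>. \<phi> k (\<eta> \<omega>) \<partial>N) / \<kappa>"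
      unfolding eventually_sequentially by blast
    have "(\<lambda>n. F n k e - (\<integral>\<omega>. \<phi> k (W n \<omega>) \<partial>M) / \<kappa>)
        \<longlonglongrightarrow> (\<integral>\<omega>. (MIN i\<in>{..k::nat}. wt (\<lambda>s. g s + e) \<omega> (q i)) \<partial>L) - (\<integral>\<omega>. \<phi> k (\<eta> \<omega>) \<partial>N) / \<kappa>"
    proof (intro tendsto_intros F tendsto_integral_W cont)
      show "bounded (range (\<phi> k))" using \<phi>01 by (intro boundedI[where B = 1]) auto
    qed (use \<kappa> in auto)
    then have "eventually (\<lambda>n. b < F n k e - (\<integral>\<omega>. \<phi> k (W n \<omega>) \<partial>M) / \<kappa>) sequentially"
      by (rule order_tendstoD) (rule k)
    then show ?thesis
      using ev_\<kappa> eventually_ge_at_top[of 1]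
    proof eventually_elim
      case (elim n)
      let ?P = "{\<omega> \<in> space M. \<forall>i\<in>{..k}. g (q i) + e < real n * (U 0 \<omega> (q i) - 1)}"
      let ?T = "{\<omega> \<in> space M. \<forall>s. g s < real n * (U 0 \<omega> s - 1)}"
      let ?X = "{\<omega> \<in> space M. (\<forall>i\<in>{..k}. g (q i) + e < real n * (U 0 \<omega> (q i) - 1)) \<and>
        \<not> (\<forall>s. g s < real n * (U 0 \<omega> s - 1))}"
      have X: "?X = ?P - ?T" by auto
      then have X_meas: "?X \<in> M.events" using F_meas tail_event[OF g] by auto
      have "M.prob ?P \<le> M.prob (?T \<union> ?X)"
        using X_meas tail_event[OF g, of n] by (intro M.finite_measure_mono) (auto simp: X)
      also have "\<dots> \<le> M.prob ?T + M.prob ?X"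
        by (intro measure_Un_le X_meas tail_event g)
      finally have "real n * M.prob ?P \<le> real n * (M.prob ?T + M.prob ?X)" by (rule mult_left_mono) simp
      then have 1: "F n k e \<le> tail n g + real n * M.prob ?X"
        by (simp add: F_def tail_def distrib_left)
      have "real n * M.prob ?X * \<kappa> \<le> real n * M.prob ?X
          * M.prob {\<omega> \<in> space M. \<forall>s. real n * (U 0 \<omega> s - 1) \<le> - c} ^ n"
        by (intro mult_left_mono elim(2)) simp
      also have "\<dots> \<le> (\<integral>\<omega>. \<phi> k (W n \<omega>) \<partial>M)"
        unfolding \<phi>_def d_def by (rule oscillation_bound[OF g c(2) e(1) elim(3)])
      finally have "real n * M.prob ?X * \<kappa> \<le> (\<integral>\<omega>. \<phi> k (W n \<omega>) \<partial>M)" .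
      then have "real n * M.prob ?X \<le> (\<integral>\<omega>. \<phi> k (W n \<omega>) \<partial>M) / \<kappa>"
        using \<kappa> by (simp add: pos_le_divide_eq)
      with 1 elim(1) show ?case by linarith
    qed
  qed
  ultimately show ?thesis by (intro order_tendstoI)
qed

end

section \<open>Records\<close>

text \<open>Fubini for the product law, with \<open>Y\<close> frozen at its value. Both integrations
  are expressed on the original space, so that a random path can be inserted as a level.\<close>

lemma (in prob_space) indep_var_prob:
  assumes XY: "indep_var S X T Y" and A: "A \<in> sets (S \<Otimes>\<^sub>M T)"
  shows "(\<lambda>\<omega>'. prob {\<omega> \<in> space M. (X \<omega>, Y \<omega>') \<in> A}) \<in> borel_measurable M"
    and "prob {\<omega> \<in> space M. (X \<omega>, Y \<omega>) \<in> A} = (\<integral>\<omega>'. prob {\<omega> \<in> space M. (X \<omega>, Y \<omega>') \<in> A} \<partial>M)"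
proof -
  have X [measurable]: "X \<in> measurable M S" and Y [measurable]: "Y \<in> measurable M T"
    using XY indep_var_rv1 indep_var_rv2 by blast+
  interpret P: prob_space "distr M S X" by (rule prob_space_distr[OF X])
  interpret R: prob_space "distr M T Y" by (rule prob_space_distr[OF Y])
  interpret PR: pair_sigma_finite "distr M S X" "distr M T Y" ..
  have A': "A \<in> sets (distr M S X \<Otimes>\<^sub>M distr M T Y)" using A by simp
  let ?h = "\<lambda>y. measure (distr M S X) ((\<lambda>x. (x, y)) -` A)"
  have h [measurable]: "?h \<in> borel_measurable T"
    unfolding measure_def using PR.measurable_emeasure_Pair2[OF A'] by simp
  have h_eq: "?h (Y \<omega>') = prob {\<omega> \<in> space M. (X \<omega>, Y \<omega>') \<in> A}" if "\<omega>' \<in> space M" for \<omega>'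
  proof -
    have "(\<lambda>x. (x, Y \<omega>')) -` A \<in> sets S"
      using sets_Pair2[OF A'] by simp
    then show ?thesis
      by (subst measure_distr) (auto simp: vimage_def Int_def conj_commute)
  qed
  have "(\<lambda>\<omega>'. ?h (Y \<omega>')) \<in> borel_measurable M" by measurable
  then show "(\<lambda>\<omega>'. prob {\<omega> \<in> space M. (X \<omega>, Y \<omega>') \<in> A}) \<in> borel_measurable M"
    by (subst measurable_cong[OF h_eq[symmetric]])
  have distr_XY: "distr M S X \<Otimes>\<^sub>M distr M T Y = distr M (S \<Otimes>\<^sub>M T) (\<lambda>\<omega>. (X \<omega>, Y \<omega>))"
    using XY unfolding indep_var_distribution_eq by blast
  have "{\<omega> \<in> space M. (X \<omega>, Y \<omega>) \<in> A} = (\<lambda>\<omega>. (X \<omega>, Y \<omega>)) -` A \<inter> space M" by auto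
  then have "ennreal (prob {\<omega> \<in> space M. (X \<omega>, Y \<omega>) \<in> A}) = emeasure (distr M S X \<Otimes>\<^sub>M distr M T Y) A"
    unfolding distr_XY using A by (simp add: emeasure_distr emeasure_eq_measure)
  also have "\<dots> = (\<integral>\<^sup>+y. emeasure (distr M S X) ((\<lambda>x. (x, y)) -` A) \<partial>distr M T Y)"
    by (rule PR.emeasure_pair_measure_alt2[OF A'])
  also have "\<dots> = (\<integral>\<^sup>+y. ennreal (?h y) \<partial>distr M T Y)"
    by (simp add: P.emeasure_eq_measure)
  also have "\<dots> = ennreal (\<integral>y. ?h y \<partial>distr M T Y)"
    by (intro nn_integral_eq_integral R.integrable_const_bound[where B = 1]) auto
  finally have "prob {\<omega> \<in> space M. (X \<omega>, Y \<omega>) \<in> A} = (\<integral>y. ?h y \<partial>distr M T Y)"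
    by (subst (asm) ennreal_inj) (simp_all add: integral_nonneg_AE)
  also have "\<dots> = (\<integral>\<omega>'. ?h (Y \<omega>') \<partial>M)" by (rule integral_distr) measurable
  also have "\<dots> = (\<integral>\<omega>'. prob {\<omega> \<in> space M. (X \<omega>, Y \<omega>') \<in> A} \<partial>M)"
    by (intro Bochner_Integration.integral_cong refl h_eq)
  finally show "prob {\<omega> \<in> space M. (X \<omega>, Y \<omega>) \<in> A} = (\<integral>\<omega>'. prob {\<omega> \<in> space M. (X \<omega>, Y \<omega>') \<in> A} \<partial>M)" .
qed

context record_setting
begin

lemma indep_var_U_W:
  assumes "1 \<le> m" shows "M.indep_var borel (U (Suc m)) borel (W m)"
proof -
  have "M.indep_var (Pi\<^sub>M {Suc m} (\<lambda>_. borel)) (\<lambda>\<omega>. restrict (\<lambda>i. U i \<omega>) {Suc m})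
      (Pi\<^sub>M {1..m} (\<lambda>_. borel)) (\<lambda>\<omega>. restrict (\<lambda>i. U i \<omega>) {1..m})"
    by (rule M.indep_var_restrict[OF indep]) auto
  moreover have "(\<lambda>x. x (Suc m)) \<in> borel_measurable (Pi\<^sub>M {Suc m} (\<lambda>_. borel :: ('s \<Rightarrow>\<^sub>C real) measure))"
    by (rule measurable_component_singleton) simp
  moreover have "(\<lambda>x. real m *\<^sub>R (bcontfun_Max {1..m} x - const_bcontfun 1)) \<in>
      borel_measurable (Pi\<^sub>M {1..m} (\<lambda>_. borel :: ('s \<Rightarrow>\<^sub>C real) measure))"
  proof (rule borel_measurable_bcontfunI[OF cpt])
    have [measurable]: "bcontfun_Max {1..m} \<in> borel_measurable (Pi\<^sub>M {1..m} (\<lambda>_. borel :: ('s \<Rightarrow>\<^sub>C real) measure))"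
      using assms by (intro measurable_bcontfun_Max) auto
    show "(\<lambda>x. apply_bcontfun (real m *\<^sub>R (bcontfun_Max {1..m} x - const_bcontfun 1)) s) \<in>
      borel_measurable (Pi\<^sub>M {1..m} (\<lambda>_. borel))" for s :: 's
      unfolding scaleR_bcontfun.rep_eq minus_bcontfun.rep_eq const_bcontfun.rep_eq by measurable
  qed
  ultimately have "M.indep_var borel ((\<lambda>x. x (Suc m)) \<circ> (\<lambda>\<omega>. restrict (\<lambda>i. U i \<omega>) {Suc m}))
      borel ((\<lambda>x. real m *\<^sub>R (bcontfun_Max {1..m} x - const_bcontfun 1)) \<circ> (\<lambda>\<omega>. restrict (\<lambda>i. U i \<omega>) {1..m}))"
    by (rule M.indep_var_compose)
  moreover have "(\<lambda>x. x (Suc m)) \<circ> (\<lambda>\<omega>. restrict (\<lambda>i. U i \<omega>) {Suc m}) = U (Suc m)"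
    by auto
  moreover have "(\<lambda>x. real m *\<^sub>R (bcontfun_Max {1..m} x - const_bcontfun 1)) \<circ> (\<lambda>\<omega>. restrict (\<lambda>i. U i \<omega>) {1..m}) = W m"
    unfolding comp_def W_def[abs_def] mx_restrict ..
  ultimately show ?thesis by simp
qed

lemma prob_U_greater_max:
  assumes m: "1 \<le> m" and f: "f \<in> E_space"
  shows "(\<lambda>\<omega>'. tail m (\<lambda>s. max (W m \<omega>' s) (f s))) \<in> borel_measurable M"
    and "real m * M.prob {\<omega> \<in> space M. \<forall>s. max (W m \<omega> s) (f s) < real m * (U (Suc m) \<omega> s - 1)}
      = (\<integral>\<omega>'. tail m (\<lambda>s. max (W m \<omega>' s) (f s)) \<partial>M)"
proof -
  let ?Q = "\<lambda>z :: ('s \<Rightarrow>\<^sub>C real) \<times> ('s \<Rightarrow>\<^sub>C real). \<forall>s. 0 < real m * (apply_bcontfun (fst z) s - 1) - max (apply_bcontfun (snd z) s) (f s)"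
  let ?A = "{z \<in> space (borel \<Otimes>\<^sub>M borel). ?Q z}"
  have "Measurable.pred (borel \<Otimes>\<^sub>M borel) ?Q"
    \<comment> \<open>For every pair of continuous paths, discontinuities of the difference can come
      from \<open>f\<close> only.\<close>
    by (rule measurable_all_pos_E_space[OF cpt f]) (auto intro!: continuous_intros)
  then have A: "?A \<in> sets (borel \<Otimes>\<^sub>M borel)" by (simp add: pred_def)
  have eq: "M.prob {\<omega> \<in> space M. (U (Suc m) \<omega>, y) \<in> ?A}
      = M.prob {\<omega> \<in> space M. \<forall>s. max (y s) (f s) < real m * (U 0 \<omega> s - 1)}" for y
  proof -
    have "Measurable.pred borel (\<lambda>x :: 's \<Rightarrow>\<^sub>C real. \<forall>s. max (y s) (f s) < real m * (x s - 1))"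
      by (rule pred_all_greater[OF E_space_max_bcontfun[OF f]]) simp
    from prob_U_eq[OF this, of "Suc m"] show ?thesis
      by (simp add: space_pair_measure)
  qed
  note fub = M.indep_var_prob[OF indep_var_U_W[OF m] A]
  show "(\<lambda>\<omega>'. tail m (\<lambda>s. max (W m \<omega>' s) (f s))) \<in> borel_measurable M"
    unfolding tail_def using fub(1) unfolding eq by measurable
  show "real m * M.prob {\<omega> \<in> space M. \<forall>s. max (W m \<omega> s) (f s) < real m * (U (Suc m) \<omega> s - 1)}
      = (\<integral>\<omega>'. tail m (\<lambda>s. max (W m \<omega>' s) (f s)) \<partial>M)"
    using fub(2) unfolding eq tail_def by (simp add: space_pair_measure)
qed

abbreviation Psi_max :: "('s \<Rightarrow> real) \<Rightarrow> ('s \<Rightarrow>\<^sub>C real) \<Rightarrow> real" where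
  "Psi_max f y \<equiv> Psi (\<lambda>s. max (apply_bcontfun y s) (f s))"

section \<open>Continuity of the limit functional and tightness of the maxima\<close>

lemma Psi_lipschitz:
  assumes g: "g \<in> E_space" "g' \<in> E_space" and d: "\<And>s. \<bar>g s - g' s\<bar> \<le> e"
  shows "\<bar>Psi g - Psi g'\<bar> \<le> e * C"
proof -
  have e: "0 \<le> e" using d[of undefined] by linarith
  have 1: "g s \<le> g' s + e" "g' s \<le> g s + e" for s using d[of s] by linarith+
  have "Psi g' \<le> Psi g + e * C" "Psi g \<le> Psi g' + e * C"
    by (intro Psi_mono_add g 1 e)+
  then show ?thesis by linarith
qed

text \<open>The map \<open>H\<close> allows one proof for the path itself, its maximum with
  \<open>f\<close>, and the negative absolute values of these.\<close>

lemma continuous_on_Psi: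
  fixes H :: "('s \<Rightarrow>\<^sub>C real) \<Rightarrow> 's \<Rightarrow> real"
  assumes "\<And>x. H x \<in> E_space" "\<And>x y s. \<bar>H x s - H y s\<bar> \<le> \<bar>x s - y s\<bar>"
  shows "continuous_on UNIV (\<lambda>x. Psi (H x))"
proof -
  have "\<bar>H x s - H y s\<bar> \<le> dist x y" for x y s
    using assms(2)[of x s y] dist_bounded[of x s y] by (simp add: dist_real_def)
  then have "\<bar>Psi (H x) - Psi (H y)\<bar> \<le> dist x y * C" for x y
    by (rule Psi_lipschitz[OF assms(1) assms(1)])
  then have "C-lipschitz_on UNIV (\<lambda>x. Psi (H x))"
    using C_nonneg by (intro lipschitz_onI) (simp_all add: dist_real_def mult.commute)
  then show ?thesis by (rule lipschitz_on_continuous_on)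
qed

lemma Psi_max_lipschitz:
  assumes f: "f \<in> E_space" and d: "dist x y \<le> e"
  shows "\<bar>Psi_max f x - Psi_max f y\<bar> \<le> e * C"
proof (intro Psi_lipschitz E_space_max_bcontfun f)
  show "\<bar>max (x s) (f s) - max (y s) (f s)\<bar> \<le> e" for s
    using dist_bounded[of x s y] d unfolding dist_real_def by linarith
qed

text \<open>The level \<open>f\<close> keeps \<open>- max (y s) (f s)\<close> below \<open>c\<close>
  for every path \<open>y\<close>; this is what makes \<open>Psi_max f\<close> an admissible test
  function for weak convergence.\<close>

lemma Psi_max_bound:
  assumes f: "f \<in> E_space" "\<And>s. \<bar>f s\<bar> \<le> c"
  shows "0 \<le> Psi_max f y" "Psi_max f y \<le> c * C"
proof -
  show "0 \<le> Psi_max f y" by (rule Psi_nonneg)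
  have c: "0 \<le> c" using f(2)[of undefined] by linarith
  show "Psi_max f y \<le> c * C"
  proof (rule Psi_le[OF E_space_max_bcontfun[OF f(1)] _ c])
    show "- max (y undefined) (f undefined) \<le> c" using f(2)[of undefined] by linarith
  qed
qed

lemma continuous_on_Psi_max: "f \<in> E_space \<Longrightarrow> continuous_on UNIV (Psi_max f)"
  by (intro continuous_on_Psi E_space_max_bcontfun) (auto simp: max_def)

text \<open>A finite net of paths replaces a compact set. By separability \<eta> is close to one of
  finitely many paths with high probability, and the portmanteau bound passes this on to
  \<open>W n\<close>.\<close>

lemma tight:
  assumes e: "0 < e"
  obtains Y :: "('s \<Rightarrow>\<^sub>C real) set" where "finite Y" "Y \<noteq> {}"
    and "eventually (\<lambda>n. M.prob {\<omega> \<in> space M. \<not> (\<exists>y\<in>Y. dist y (W n \<omega>) \<le> e)} \<le> e) sequentially"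
proof -
  obtain F :: "('s \<Rightarrow>\<^sub>C real) set" where F: "countable F" "\<And>x e. e > 0 \<Longrightarrow> \<exists>y\<in>F. dist y x < e"
    using compact_UNIV_bcontfun_separable[OF cpt] by blast
  have "F \<noteq> {}" using F(2)[of 1 undefined] by auto
  define y where "y = from_nat_into F"
  have range_y: "range y = F" unfolding y_def using F(1) \<open>F \<noteq> {}\<close> by (rule range_from_nat_into[rotated])
  \<comment> \<open>Nonpositive exactly on the closed \<open>e\<close>-neighbourhood of
    \<open>y 0, \<dots>, y J\<close>. For \<eta> the distance is at most \<open>e / 2\<close>,
    leaving slack; \<open>e / 2\<close> in probability is lost when choosing \<open>J\<close> and
    again in passing to \<open>W n\<close>.\<close>
  define a where "a J x = (MIN j\<in>{..J::nat}. dist (y j) x) - e" for J x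
  have cont: "continuous_on UNIV (a J)" for J
    unfolding a_def by (intro continuous_intros continuous_on_Min) auto
  have [measurable]: "a J \<in> borel_measurable borel" for J
    using cont by (rule borel_measurable_continuous_onI)
  have "(\<lambda>J. N.prob {\<omega> \<in> space N. a J (\<eta> \<omega>) \<le> - (e / 2)}) \<longlonglongrightarrow> 1"
  proof -
    have "(\<lambda>J. \<integral>\<omega>. indicator {\<omega> \<in> space N. a J (\<eta> \<omega>) \<le> - (e / 2)} \<omega> \<partial>N) \<longlonglongrightarrow> (\<integral>\<omega>. (1::real) \<partial>N)"
    proof (rule integral_dominated_convergence[where w = "\<lambda>_. 1"])
      show "AE \<omega> in N. (\<lambda>J. indicator {\<omega> \<in> space N. a J (\<eta> \<omega>) \<le> - (e / 2)} \<omega> :: real) \<longlonglongrightarrow> 1"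
      proof (rule AE_I2)
        fix \<omega> assume \<omega>: "\<omega> \<in> space N"
        obtain j where j: "dist (y j) (\<eta> \<omega>) < e / 2"
          using F(2)[of "e / 2" "\<eta> \<omega>"] e range_y by auto
        have "eventually (\<lambda>J. indicator {\<omega> \<in> space N. a J (\<eta> \<omega>) \<le> - (e / 2)} \<omega> = (1::real)) sequentially"
          using eventually_ge_at_top[of j]
        proof eventually_elim
          case (elim J)
          have "(MIN j\<in>{..J}. dist (y j) (\<eta> \<omega>)) \<le> dist (y j) (\<eta> \<omega>)"
            using elim by (intro Min_le) auto
          then show ?case using j \<omega> by (simp add: a_def)
        qed
        then show "(\<lambda>J. indicator {\<omega> \<in> space N. a J (\<eta> \<omega>) \<le> - (e / 2)} \<omega> :: real) \<longlonglongrightarrow> 1"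
          by (rule tendsto_eventually)
      qed
      show "(\<lambda>\<omega>. indicator {\<omega> \<in> space N. a J (\<eta> \<omega>) \<le> - (e / 2)} \<omega> :: real) \<in> borel_measurable N" for J
        by (rule borel_measurable_indicator) measurable
    qed (auto simp: indicator_def)
    then show ?thesis by (simp add: N.prob_space)
  qed
  then have "eventually (\<lambda>J. 1 - e / 2 < N.prob {\<omega> \<in> space N. a J (\<eta> \<omega>) \<le> - (e / 2)}) sequentially"
    by (rule order_tendstoD) (use e in simp)
  then obtain J where J: "1 - e / 2 < N.prob {\<omega> \<in> space N. a J (\<eta> \<omega>) \<le> - (e / 2)}"
    unfolding eventually_sequentially by blast
  show thesis
  proof (rule that)
    have "eventually (\<lambda>n. N.prob {\<omega> \<in> space N. a J (\<eta> \<omega>) \<le> - (e / 2)} - e / 2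
        \<le> M.prob {\<omega> \<in> space M. a J (W n \<omega>) \<le> 0}) sequentially"
      by (rule eventually_prob_W_ge[OF cont]) (use e in auto)
    then show "eventually (\<lambda>n. M.prob {\<omega> \<in> space M. \<not> (\<exists>z\<in>y ` {..J}. dist z (W n \<omega>) \<le> e)} \<le> e) sequentially"
      using eventually_ge_at_top[of 1]
    proof eventually_elim
      case (elim n)
      note [measurable] = measurable_W[OF elim(2)]
      have iff: "(\<exists>z\<in>y ` {..J}. dist z x \<le> e) \<longleftrightarrow> a J x \<le> 0" for x
        unfolding a_def by (auto simp: Min_le_iff)
      have "{\<omega> \<in> space M. a J (W n \<omega>) \<le> 0} \<in> M.events" by measurable
      then have "M.prob {\<omega> \<in> space M. \<not> a J (W n \<omega>) \<le> 0} = 1 - M.prob {\<omega> \<in> space M. a J (W n \<omega>) \<le> 0}"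
        by (rule M.prob_neg)
      then show ?case unfolding iff using J elim(1) by linarith
    qed
  qed auto
qed

text \<open>The factor \<open>m / (m + 1)\<close> rewrites the level \<open>f\<close> for the
  scaling \<open>m + 1\<close> in the scaling \<open>m\<close> of the maximum. Convergence of
  \<open>tail\<close> is known only level by level, so the random level is compared with the nearest
  member of a finite net.\<close>

lemma tendsto_prob_greater_max:
  assumes f: "f \<in> E_space"
  shows "(\<lambda>m. real m * M.prob {\<omega> \<in> space M. \<forall>s. max (W m \<omega> s) (real m / (real m + 1) * f s)
      < real m * (U (Suc m) \<omega> s - 1)}) \<longlonglongrightarrow> (\<integral>\<omega>. Psi_max f (\<eta> \<omega>) \<partial>N)"
proof -
  obtain c where c: "c > 0" "\<And>s. \<bar>f s\<bar> \<le> c" using E_space_range_bounded[OF f] by blast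
  define fm where "fm m s = real m / (real m + 1) * f s" for m s
  have fm_bound: "\<bar>fm m s\<bar> \<le> c" for m s
  proof -
    have "\<bar>fm m s\<bar> \<le> 1 * \<bar>f s\<bar>"
      unfolding fm_def abs_mult by (intro mult_right_mono) auto
    then show ?thesis using c(2)[of s] by linarith
  qed
  have fm: "fm m \<in> E_space" for m
    by (rule E_spaceI[OF f _ fm_bound]) (auto simp: fm_def intro!: continuous_intros)
  have fm_close: "\<bar>fm m s - f s\<bar> \<le> c / (real m + 1)" for m s
  proof -
    have "fm m s - f s = - f s / (real m + 1)" by (simp add: fm_def field_simps)
    then show ?thesis using c(2)[of s] by (simp add: abs_divide divide_right_mono)
  qed
  define J where "J m = real m * M.prob {\<omega> \<in> space M. \<forall>s. max (W m \<omega> s) (fm m s)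
      < real m * (U (Suc m) \<omega> s - 1)}" for m
  \<comment> \<open>\<open>c * C\<close> bounds \<open>Psi_max f\<close>; the 1 is room for a bound
    on \<open>tail\<close> that holds only for large \<open>m\<close>.\<close>
  define K where "K = c * C + 1"
  have K: "0 < K" using c C_nonneg unfolding K_def by (smt (verit) mult_nonneg_nonneg)
  have [measurable]: "Psi_max f \<in> borel_measurable borel"
    using continuous_on_Psi_max[OF f] by (rule borel_measurable_continuous_onI)
  \<comment> \<open>The pieces are \<open>2 * e * C\<close> for the shifted level,
    \<open>e * C\<close> for moving from the net to \<open>W m\<close>, \<open>e\<close> for the
    convergence at the net, and \<open>K * e\<close> for the event of being far from the net; the
    multiple of \<open>C\<close> is rounded up to 4.\<close>
  have key: "eventually (\<lambda>m. \<bar>J m - (\<integral>\<omega>. Psi_max f (W m \<omega>) \<partial>M)\<bar> \<le> e * (4 * C + 1 + K)) sequentially"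
    if e: "0 < e" for e
  proof -
    obtain Y :: "('s \<Rightarrow>\<^sub>C real) set" where Y: "finite Y" "Y \<noteq> {}"
      "eventually (\<lambda>n. M.prob {\<omega> \<in> space M. \<not> (\<exists>y\<in>Y. dist y (W n \<omega>) \<le> e)} \<le> e) sequentially"
      using tight[OF e] by blast
    define G where "G y r = (\<lambda>s. max (apply_bcontfun y s) (f s) + r)" for y r
    have G: "G y r \<in> E_space" for y r
      unfolding G_def by (intro E_space_add_const E_space_max_bcontfun f)
    have "eventually (\<lambda>m. tail m (G y (- 2 * e)) < Psi (G y (- 2 * e)) + e \<and> Psi (G y (2 * e)) - e < tail m (G y (2 * e))) sequentially" for y
      using e by (intro eventually_conj order_tendstoD[OF tendsto_tail[OF G]]) auto
    then have ev1: "eventually (\<lambda>m. \<forall>y\<in>Y. tail m (G y (- 2 * e)) < Psi (G y (- 2 * e)) + e \<and> Psi (G y (2 * e)) - e < tail m (G y (2 * e))) sequentially"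
      using Y(1) by (simp add: eventually_ball_finite_distrib)
    \<comment> \<open>The constant \<open>- c\<close> lies below all levels that occur, so its
      \<open>tail\<close> bounds all of them at once, even far from the net.\<close>
    have "(\<lambda>_. - c) \<in> E_space" by (simp add: E_space_def)
    then have "(\<lambda>m. tail m (\<lambda>_. - c)) \<longlonglongrightarrow> Psi (\<lambda>_. - c)" "Psi (\<lambda>_. - c) \<le> c * C"
      using c by (auto intro!: tendsto_tail Psi_le[where s = undefined])
    then have ev2: "eventually (\<lambda>m. tail m (\<lambda>_. - c) < K) sequentially"
      by (intro order_tendstoD) (auto simp: K_def)
    have "(\<lambda>m. c * inverse (real (Suc m))) \<longlonglongrightarrow> c * 0"
      by (intro tendsto_intros LIMSEQ_inverse_real_of_nat)
    then have "(\<lambda>m. c / (real m + 1)) \<longlonglongrightarrow> 0"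
      by (simp add: divide_inverse add.commute)
    then have ev3: "eventually (\<lambda>m. c / (real m + 1) < e) sequentially"
      by (rule order_tendstoD) (rule e)
    show ?thesis
      using ev1 ev2 ev3 Y(3) eventually_ge_at_top[of 1]
    proof eventually_elim
      case (elim m)
      note [measurable] = measurable_W[OF elim(5)]
      let ?t = "\<lambda>\<omega>. tail m (\<lambda>s. max (W m \<omega> s) (fm m s))"
      let ?B = "{\<omega> \<in> space M. \<not> (\<exists>y\<in>Y. dist y (W m \<omega>) \<le> e)}"
      have t_meas [measurable]: "?t \<in> borel_measurable M"
        by (rule prob_U_greater_max(1)[OF elim(5) fm])
      have J: "J m = (\<integral>\<omega>. ?t \<omega> \<partial>M)"
        unfolding J_def by (rule prob_U_greater_max(2)[OF elim(5) fm])
      have t_bound: "0 \<le> ?t \<omega>" "?t \<omega> \<le> K" for \<omega>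
      proof -
        show "0 \<le> ?t \<omega>" by (rule tail_nonneg)
        have "?t \<omega> \<le> tail m (\<lambda>_. - c)"
        proof (rule tail_antimono)
          show "- c \<le> max (W m \<omega> s) (fm m s)" for s using fm_bound[of m s] by linarith
        qed (simp add: E_space_def)
        then show "?t \<omega> \<le> K" using elim(2) by linarith
      qed
      have P_bound: "0 \<le> Psi_max f x" "Psi_max f x \<le> K" for x
        using Psi_max_bound[OF f c(2), of x] by (auto simp: K_def)
      have [measurable]: "dist y \<in> borel_measurable borel" for y :: "'s \<Rightarrow>\<^sub>C real"
        by (intro borel_measurable_continuous_onI continuous_intros)
      have B_meas: "?B \<in> M.events" using Y(1) by measurable
      have diff: "\<bar>?t \<omega> - Psi_max f (W m \<omega>)\<bar> \<le> e * (4 * C + 1) + K * indicator ?B \<omega>" if \<omega>: "\<omega> \<in> space M" for \<omega>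
      proof (cases "\<omega> \<in> ?B")
        case True
        have "0 \<le> e * (4 * C + 1)" using e C_nonneg by simp
        then show ?thesis using True t_bound[of \<omega>] P_bound[of "W m \<omega>"] by simp
      next
        case False
        then obtain y where y: "y \<in> Y" "dist y (W m \<omega>) \<le> e" using \<omega> by blast
        \<comment> \<open>One \<open>e\<close> is the distance from \<open>y\<close> to
          \<open>W m\<close>, the other covers the distance from \<open>fm m\<close> to
          \<open>f\<close>.\<close>
        have near: "max (W m \<omega> s) (fm m s) \<le> max (y s) (f s) + 2 * e"
          "max (y s) (f s) + - 2 * e \<le> max (W m \<omega> s) (fm m s)" for s
        proof -
          have "\<bar>y s - W m \<omega> s\<bar> \<le> e"
            using dist_bounded[of y s "W m \<omega>"] y(2) by (simp add: dist_real_def)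
          moreover have "\<bar>fm m s - f s\<bar> \<le> e" using fm_close[of m s] elim(3) by linarith
          ultimately show "max (W m \<omega> s) (fm m s) \<le> max (y s) (f s) + 2 * e"
            "max (y s) (f s) + - 2 * e \<le> max (W m \<omega> s) (fm m s)" using e by linarith+
        qed
        have "?t \<omega> \<le> tail m (G y (- 2 * e))"
          by (rule tail_antimono[OF G]) (use near(2) in \<open>simp add: G_def\<close>)
        moreover have "tail m (G y (2 * e)) \<le> ?t \<omega>"
          by (rule tail_antimono[OF E_space_max_bcontfun[OF fm]]) (use near(1) in \<open>simp add: G_def\<close>)
        moreover have "Psi (G y (- 2 * e)) \<le> Psi_max f y + (2 * e) * C"
          using e by (intro Psi_mono_add G E_space_max_bcontfun f) (auto simp: G_def)
        moreover have "Psi_max f y \<le> Psi (G y (2 * e)) + (2 * e) * C"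
          using e by (intro Psi_mono_add G E_space_max_bcontfun f) (auto simp: G_def)
        moreover have "\<bar>Psi_max f y - Psi_max f (W m \<omega>)\<bar> \<le> e * C"
          by (rule Psi_max_lipschitz[OF f y(2)])
        moreover have "0 \<le> e * C" using e C_nonneg by simp
        ultimately have "\<bar>?t \<omega> - Psi_max f (W m \<omega>)\<bar> \<le> e * (4 * C + 1)"
          using elim(1) y(1) unfolding distrib_left by fastforce
        then show ?thesis using False by simp
      qed
      have int: "integrable M ?t" "integrable M (\<lambda>\<omega>. Psi_max f (W m \<omega>))"
        using t_bound P_bound by (auto intro!: M.integrable_const_bound[where B = K])
      have "\<bar>J m - (\<integral>\<omega>. Psi_max f (W m \<omega>) \<partial>M)\<bar> = \<bar>\<integral>\<omega>. ?t \<omega> - Psi_max f (W m \<omega>) \<partial>M\<bar>"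
        unfolding J using int by simp
      also have "\<dots> \<le> (\<integral>\<omega>. \<bar>?t \<omega> - Psi_max f (W m \<omega>)\<bar> \<partial>M)" by (rule integral_abs_bound)
      also have "\<dots> \<le> (\<integral>\<omega>. e * (4 * C + 1) + K * indicator ?B \<omega> \<partial>M)"
        using int B_meas by (intro integral_mono diff) (auto simp: M.emeasure_eq_measure)
      also have "\<dots> = e * (4 * C + 1) + K * M.prob ?B"
        using B_meas by (simp add: M.prob_space M.emeasure_eq_measure)
      also have "\<dots> \<le> e * (4 * C + 1) + K * e"
        using elim(4) K by (intro add_left_mono mult_left_mono) auto
      also have "\<dots> = e * (4 * C + 1 + K)" by (simp add: algebra_simps)
      finally show ?case .
    qed
  qed
  have "(\<lambda>m. J m - (\<integral>\<omega>. Psi_max f (W m \<omega>) \<partial>M)) \<longlonglongrightarrow> 0"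
  proof (rule tendstoI)
    fix r :: real assume r: "0 < r"
    have pos: "0 < 4 * C + 1 + K" using K C_nonneg by linarith
    define e where "e = r / 2 / (4 * C + 1 + K)"
    have "0 < e" using pos r by (simp add: e_def)
    moreover have "r / 2 / x * x = r / 2" if "0 < x" for x using that by simp
    then have "e * (4 * C + 1 + K) = r / 2" unfolding e_def using pos by blast
    ultimately have e: "0 < e" "e * (4 * C + 1 + K) < r" using r by simp_all
    show "eventually (\<lambda>m. dist (J m - (\<integral>\<omega>. Psi_max f (W m \<omega>) \<partial>M)) 0 < r) sequentially"
      using key[OF e(1)] by eventually_elim (use e(2) in \<open>simp add: dist_real_def\<close>)
  qed
  moreover have "(\<lambda>m. \<integral>\<omega>. Psi_max f (W m \<omega>) \<partial>M) \<longlonglongrightarrow> (\<integral>\<omega>. Psi_max f (\<eta> \<omega>) \<partial>N)"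
  proof (rule tendsto_integral_W[OF continuous_on_Psi_max[OF f]])
    show "bounded (range (Psi_max f))"
      using Psi_max_bound[OF f c(2)] by (intro boundedI[where B = "c * C"]) auto
  qed
  ultimately have "(\<lambda>m. (J m - (\<integral>\<omega>. Psi_max f (W m \<omega>) \<partial>M)) + (\<integral>\<omega>. Psi_max f (W m \<omega>) \<partial>M))
      \<longlonglongrightarrow> 0 + (\<integral>\<omega>. Psi_max f (\<eta> \<omega>) \<partial>N)"
    by (rule tendsto_add)
  then show ?thesis by (simp add: J_def fm_def)
qed

section \<open>Exchangeability and the probability of a record above a level\<close>

lemma complete_record_iff:
  "complete_record U (Suc m) \<omega> \<longleftrightarrow> (\<forall>i\<in>{1..m}. \<forall>s. U i \<omega> s < U (Suc m) \<omega> s)"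
  unfolding complete_record_def by (simp add: atLeastLessThanSuc_atLeastAtMost)

lemma pred_all_less:
  assumes [measurable]: "X \<in> borel_measurable K" "Y \<in> borel_measurable K"
  shows "Measurable.pred K (\<lambda>\<omega>. \<forall>s. apply_bcontfun (X \<omega> :: 's \<Rightarrow>\<^sub>C real) s < apply_bcontfun (Y \<omega>) s)"
proof -
  have "(\<lambda>_. 0) \<in> E_space" by (simp add: E_space_def)
  then have "Measurable.pred K (\<lambda>\<omega>. \<forall>s. 0 < apply_bcontfun (Y \<omega>) s - apply_bcontfun (X \<omega>) s)"
    by (rule measurable_all_pos_E_space[OF cpt]) (auto intro!: continuous_intros)
  then show ?thesis by simp
qed

text \<open>By exchangeability each \<open>U i\<close> is equally likely to dominate all the others, these events are
  disjoint, and on each of them the dominating function is the maximum.\<close>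

lemma prob_record_le:
  assumes n: "1 \<le> n" and Q: "Measurable.pred borel Q"
  shows "real n * M.prob {\<omega> \<in> space M. complete_record U n \<omega> \<and> Q (U n \<omega>)}
    \<le> M.prob {\<omega> \<in> space M. Q (mx n \<omega>)}"
proof -
  let ?I = "{1..n}"
  let ?P = "Pi\<^sub>M ?I (\<lambda>_. borel :: ('s \<Rightarrow>\<^sub>C real) measure)"
  define D where "D i x \<longleftrightarrow> (\<forall>j\<in>?I - {i}. \<forall>s. apply_bcontfun (x j) s < apply_bcontfun (x i) s) \<and> Q (x i)"
    for i and x :: "nat \<Rightarrow> ('s \<Rightarrow>\<^sub>C real)"
  define E where "E i = {\<omega> \<in> space M. D i (\<lambda>j. U j \<omega>)}" for i
  \<comment> \<open>The space is arbitrary because measurability is needed on \<open>M\<close> and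
    on the coordinate space, where the two joint laws are compared.\<close>
  have D_pred: "Measurable.pred K (\<lambda>\<omega>. D i (\<lambda>j. V j \<omega>))"
    if V: "\<And>j. j \<in> ?I \<Longrightarrow> V j \<in> borel_measurable K" and i: "i \<in> ?I" for K :: "'d measure" and V i
  proof -
    have "Measurable.pred K (\<lambda>\<omega>. Q (V i \<omega>))"
      using V[OF i] Q by (rule measurable_compose)
    moreover have "Measurable.pred K (\<lambda>\<omega>. \<forall>j\<in>?I - {i}. \<forall>s. apply_bcontfun (V j \<omega>) s < apply_bcontfun (V i \<omega>) s)"
      by (intro pred_intros_finite pred_all_less V i) auto
    ultimately show ?thesis unfolding D_def by (intro pred_intros_logic)
  qed
  have E_meas: "E i \<in> M.events" if "i \<in> ?I" for i
    using D_pred[of U M i] that unfolding E_def pred_def by simp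
  have prob_E: "M.prob (E i) = M.prob (E n)" if i: "i \<in> ?I" for i
  proof -
    \<comment> \<open>The transposition of \<open>i\<close> and \<open>n\<close> carries domination
      by observation \<open>n\<close> into domination by observation \<open>i\<close>.\<close>
    define p where "p = (\<lambda>j. if j = n then i else if j = i then n else j)"
    have p: "inj_on p ?I" "\<And>j. j \<in> ?I \<Longrightarrow> p j \<in> ?I" "p n = i" "\<And>j. p (p j) = j"
      using i by (auto simp: p_def inj_on_def)
    let ?S = "{x \<in> space ?P. D n x}"
    have S: "?S \<in> sets ?P"
      using D_pred[of "\<lambda>j x. x j" ?P n] n unfolding pred_def by (simp add: measurable_component_singleton)
    have "measure (distr M ?P (\<lambda>\<omega>. \<lambda>j\<in>?I. U (r j) \<omega>)) ?S
        = M.prob {\<omega> \<in> space M. D n (\<lambda>j. U (r j) \<omega>)}" for r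
    proof -
      have "(\<lambda>\<omega>. \<lambda>j\<in>?I. U (r j) \<omega>) \<in> measurable M ?P"
        by (rule measurable_restrict) (rule U)
      moreover have "D n (\<lambda>j\<in>?I. U (r j) \<omega>) \<longleftrightarrow> D n (\<lambda>j. U (r j) \<omega>)" for \<omega>
        using n by (auto simp: D_def)
      ultimately show ?thesis
        using S by (subst measure_distr) (auto intro!: arg_cong[where f = M.prob] simp: space_PiM)
    qed
    from this[of p] this[of "\<lambda>j. j"]
    have "M.prob {\<omega> \<in> space M. D n (\<lambda>j. U (p j) \<omega>)} = M.prob {\<omega> \<in> space M. D n (\<lambda>j. U j \<omega>)}"
      using distr_U_reindex[of ?I p] distr_U_reindex[of ?I "\<lambda>j. j"] p(1) n by simp
    moreover have "D n (\<lambda>j. U (p j) \<omega>) \<longleftrightarrow> D i (\<lambda>j. U j \<omega>)" for \<omega>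
    proof -
      have "(\<forall>j\<in>?I - {n}. R (p j)) \<longleftrightarrow> (\<forall>j\<in>?I - {i}. R j)" for R :: "nat \<Rightarrow> bool"
      proof
        assume l: "\<forall>j\<in>?I - {n}. R (p j)"
        show "\<forall>j\<in>?I - {i}. R j"
        proof
          fix j assume j: "j \<in> ?I - {i}"
          then have "p j \<in> ?I - {n}" using p(2)[of j] p(3) p(4)[of j] by auto
          with l have "R (p (p j))" by blast
          then show "R j" by (simp add: p(4))
        qed
      next
        assume r: "\<forall>j\<in>?I - {i}. R j"
        show "\<forall>j\<in>?I - {n}. R (p j)"
        proof
          fix j assume j: "j \<in> ?I - {n}"
          have "p j \<noteq> i" using j p(3) p(4)[of j] p(4)[of n] by (metis DiffE singletonI)
          then show "R (p j)" using r p(2)[of j] j by blast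
        qed
      qed
      from this[of "\<lambda>j. \<forall>s. U j \<omega> s < U i \<omega> s"] show ?thesis
        unfolding D_def p(3) by (simp only:)
    qed
    ultimately show ?thesis by (simp add: E_def)
  qed
  have "disjoint_family_on E ?I"
    unfolding disjoint_family_on_def
  proof (intro ballI impI)
    fix i j assume ij: "i \<in> ?I" "j \<in> ?I" "i \<noteq> j"
    have False if "\<omega> \<in> E i" "\<omega> \<in> E j" for \<omega>
    proof -
      have "U j \<omega> undefined < U i \<omega> undefined" "U i \<omega> undefined < U j \<omega> undefined"
        using that ij by (auto simp: E_def D_def)
      then show False by simp
    qed
    then show "E i \<inter> E j = {}" by blast
  qed
  then have "M.prob (\<Union>i\<in>?I. E i) = (\<Sum>i\<in>?I. M.prob (E i))"
    using E_meas by (intro M.finite_measure_finite_Union) auto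
  also have "\<dots> = (\<Sum>i\<in>?I. M.prob (E n))" by (rule sum.cong[OF refl prob_E])
  finally have "real n * M.prob (E n) = M.prob (\<Union>i\<in>?I. E i)" by simp
  also have "\<dots> \<le> M.prob {\<omega> \<in> space M. Q (mx n \<omega>)}"
  proof (rule M.finite_measure_mono)
    show "(\<Union>i\<in>?I. E i) \<subseteq> {\<omega> \<in> space M. Q (mx n \<omega>)}"
    proof safe
      fix i \<omega> assume i: "i \<in> ?I" and \<omega>: "\<omega> \<in> E i"
      then show "\<omega> \<in> space M" by (simp add: E_def)
      have D: "D i (\<lambda>j. U j \<omega>)" using \<omega> by (simp add: E_def)
      have "mx n \<omega> = U i \<omega>"
      proof (rule bcontfun_eqI)
        fix s
        show "mx n \<omega> s = U i \<omega> s"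
          unfolding mx_apply[OF n]
        proof (rule Max_eqI)
          show "y \<le> U i \<omega> s" if "y \<in> (\<lambda>j. U j \<omega> s) ` ?I" for y
            using that D unfolding D_def by (force intro: less_imp_le)
        qed (use i in auto)
      qed
      then show "Q (mx n \<omega>)" using D by (simp add: D_def)
    qed
    have "Measurable.pred M (\<lambda>\<omega>. Q (mx n \<omega>))" using measurable_mx[OF n] Q by (rule measurable_compose)
    then show "{\<omega> \<in> space M. Q (mx n \<omega>)} \<in> M.events" by (simp add: pred_def)
  qed
  also have "E n = {\<omega> \<in> space M. complete_record U n \<omega> \<and> Q (U n \<omega>)}"
    unfolding E_def D_def complete_record_def by (auto simp: Ball_def)
  finally show ?thesis .
qed

text \<open>For \<open>n = m + 1\<close> the event is exactly that of
  \<open>tendsto_prob_greater_max\<close>: exceeding the rescaled maximum of the first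
  \<open>m\<close> is being a complete record. Only the normalisation changes, by the factor
  \<open>(m + 1) / m\<close>.\<close>

lemma tendsto_prob_record:
  assumes f: "f \<in> E_space"
  shows "(\<lambda>n. real n * M.prob {\<omega> \<in> space M. (\<forall>s. f s < real n * (U n \<omega> s - 1)) \<and> complete_record U n \<omega>})
    \<longlonglongrightarrow> (\<integral>\<omega>. Psi_max f (\<eta> \<omega>) \<partial>N)"
proof (rule LIMSEQ_imp_Suc)
  let ?J = "\<lambda>m. real m * M.prob {\<omega> \<in> space M. \<forall>s. max (W m \<omega> s) (real m / (real m + 1) * f s)
      < real m * (U (Suc m) \<omega> s - 1)}"
  have "(\<lambda>m. real (Suc m) / real m * ?J m) \<longlonglongrightarrow> 1 * (\<integral>\<omega>. Psi_max f (\<eta> \<omega>) \<partial>N)"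
    by (intro tendsto_mult tendsto_prob_greater_max[OF f] LIMSEQ_Suc_n_over_n)
  moreover have "eventually (\<lambda>m. real (Suc m) / real m * ?J m = real (Suc m) * M.prob {\<omega> \<in> space M.
      (\<forall>s. f s < real (Suc m) * (U (Suc m) \<omega> s - 1)) \<and> complete_record U (Suc m) \<omega>}) sequentially"
    using eventually_ge_at_top[of 1]
  proof eventually_elim
    case (elim m)
    have m: "0 < real m" using elim by simp
    have eq: "max (W m \<omega> s) (real m / (real m + 1) * f s) < real m * (U (Suc m) \<omega> s - 1) \<longleftrightarrow>
        f s < real (Suc m) * (U (Suc m) \<omega> s - 1) \<and> (\<forall>i\<in>{1..m}. U i \<omega> s < U (Suc m) \<omega> s)" for \<omega> s
    proof -
      have "W m \<omega> s < real m * (U (Suc m) \<omega> s - 1) \<longleftrightarrow> mx m \<omega> s < U (Suc m) \<omega> s"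
        unfolding W_apply using m by simp
      moreover have "real m / (real m + 1) * f s < real m * (U (Suc m) \<omega> s - 1) \<longleftrightarrow>
          real m * (f s / (real m + 1)) < real m * (U (Suc m) \<omega> s - 1)" by simp
      then have "real m / (real m + 1) * f s < real m * (U (Suc m) \<omega> s - 1) \<longleftrightarrow>
          f s < real (Suc m) * (U (Suc m) \<omega> s - 1)"
        using m by (simp only: mult_less_cancel_left_pos) (simp add: pos_divide_less_eq mult.commute add.commute)
      ultimately show ?thesis unfolding max_less_iff_conj mx_less_iff[OF elim] by blast
    qed
    have "{\<omega> \<in> space M. \<forall>s. max (W m \<omega> s) (real m / (real m + 1) * f s) < real m * (U (Suc m) \<omega> s - 1)}
      = {\<omega> \<in> space M. (\<forall>s. f s < real (Suc m) * (U (Suc m) \<omega> s - 1)) \<and> complete_record U (Suc m) \<omega>}"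
      unfolding eq complete_record_iff by auto
    then show ?case using m by simp
  qed
  ultimately show "(\<lambda>m. real (Suc m) * M.prob {\<omega> \<in> space M.
      (\<forall>s. f s < real (Suc m) * (U (Suc m) \<omega> s - 1)) \<and> complete_record U (Suc m) \<omega>})
      \<longlonglongrightarrow> (\<integral>\<omega>. Psi_max f (\<eta> \<omega>) \<partial>N)"
    using Lim_transform_eventually by fastforce
qed

end

lemma (in prob_space) expectation_pos:
  fixes X :: "'a \<Rightarrow> real"
  assumes X: "integrable M X" "\<And>\<omega>. \<omega> \<in> space M \<Longrightarrow> 0 \<le> X \<omega>"
    and A: "0 < prob A" "\<And>\<omega>. \<omega> \<in> A \<Longrightarrow> 0 < X \<omega>"
  shows "0 < expectation X"
proof (rule ccontr)
  assume "\<not> 0 < expectation X"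
  moreover have "0 \<le> expectation X" using X(2) by (intro integral_nonneg_AE AE_I2)
  ultimately have "expectation X = 0" by linarith
  then have "AE \<omega> in M. X \<omega> = 0"
    using integral_nonneg_eq_0_iff_AE[OF X(1)] X(2) by (simp add: AE_I2)
  then have "AE \<omega> in M. \<omega> \<notin> A" by eventually_elim (use A(2) in force)
  \<comment> \<open>Again positive measure is what shows measurability.\<close>
  moreover have "A \<in> events" using A(1) measure_notin_sets by fastforce
  ultimately have "prob A = 0" by (simp add: prob_eq_0)
  with A(1) show False by simp
qed

section \<open>The conditioning event and the quotient\<close>

context record_setting
begin

lemma borel_measurable_Psi [measurable]: "(\<lambda>y :: 's \<Rightarrow>\<^sub>C real. Psi (apply_bcontfun y)) \<in> borel_measurable borel"
  by (intro borel_measurable_continuous_onI continuous_on_Psi E_space_bcontfun) simp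

text \<open>\<open>Psi\<close> need not be bounded on \<open>C(S)\<close>, so weak convergence does
  not apply to it directly. Truncation at \<open>- K\<close> yields limits \<open>a K\<close>, and
  the limits in \<open>n\<close> and \<open>K\<close> may be exchanged because the error of
  truncation is controlled for all large \<open>n\<close> at once.\<close>

lemma tendsto_prob_complete_record:
  shows "integrable N (\<lambda>\<omega>. Psi (\<eta> \<omega>))"
    and "(\<lambda>n. real n * M.prob {\<omega> \<in> space M. complete_record U n \<omega>}) \<longlonglongrightarrow> (\<integral>\<omega>. Psi (\<eta> \<omega>) \<partial>N)"
proof -
  let ?k = "\<lambda>K s. - real K :: real"
  have E: "?k K \<in> E_space" for K by (simp add: E_space_def)
  define R where "R n = real n * M.prob {\<omega> \<in> space M. complete_record U n \<omega>}" for n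
  define A where "A K n = real n * M.prob {\<omega> \<in> space M. (\<forall>s. - real K < real n * (U n \<omega> s - 1)) \<and> complete_record U n \<omega>}" for K n
  define a where "a K = (\<integral>\<omega>. Psi_max (?k K) (\<eta> \<omega>) \<partial>N)" for K
  \<comment> \<open>The infimum of the path; the subtracted 0 matches the form in which continuity
    is known.\<close>
  define b where "b x = (INF s. apply_bcontfun x s - 0)" for x :: "'s \<Rightarrow>\<^sub>C real"
  have b: "continuous_on UNIV b" unfolding b_def by (rule continuous_on_INF_diff[where c = 0]) simp
  have [measurable]: "b \<in> borel_measurable borel" using b by (rule borel_measurable_continuous_onI)
  have [measurable]: "Psi_max (?k K) \<in> borel_measurable borel" for K
    by (intro borel_measurable_continuous_onI continuous_on_Psi_max E)
  have lim_A: "(\<lambda>n. A K n) \<longlonglongrightarrow> a K" for K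
    unfolding A_def a_def by (rule tendsto_prob_record[OF E])
  have pred: "Measurable.pred borel (\<lambda>x :: 's \<Rightarrow>\<^sub>C real. \<forall>s. - real K < real n * (x s - 1))" for K n
    by (rule pred_all_greater[OF E]) simp
  have rec_meas: "{\<omega> \<in> space M. complete_record U n \<omega>} \<in> M.events" for n
  proof -
    have "Measurable.pred M (\<lambda>\<omega>. \<forall>i\<in>{1..<n}. \<forall>s. U i \<omega> s < U n \<omega> s)"
      by (intro pred_intros_finite pred_all_less U) auto
    then show ?thesis unfolding complete_record_def pred_def .
  qed
  have big_meas: "{\<omega> \<in> space M. \<forall>s. - real K < real n * (U n \<omega> s - 1)} \<in> M.events" for K n
    using pred_all_greater[OF E U, of K n n] by (simp add: pred_def)
  have A_le_R: "A K n \<le> R n" for K n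
    unfolding A_def R_def by (intro mult_left_mono M.finite_measure_mono rec_meas) auto
  have R_le_1: "R n \<le> 1" if "1 \<le> n" for n
  proof -
    have "R n \<le> M.prob {\<omega> \<in> space M. True}"
      using prob_record_le[OF that, of "\<lambda>_. True"] by (simp add: R_def)
    also have "\<dots> \<le> 1" by (rule M.prob_le_1)
    finally show ?thesis .
  qed
  \<comment> \<open>The uniform estimate: the factor \<open>n\<close> is absorbed by
    exchangeability, and what remains is the event that the rescaled maximum reaches down to
    \<open>- K\<close>.\<close>
  have R_le: "R n - A K n \<le> M.prob {\<omega> \<in> space M. b (W n \<omega>) + real K \<le> 0}" if n: "1 \<le> n" for K n
  proof -
    let ?X = "{\<omega> \<in> space M. complete_record U n \<omega> \<and> \<not> (\<forall>s. - real K < real n * (U n \<omega> s - 1))}"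
    let ?Y = "{\<omega> \<in> space M. (\<forall>s. - real K < real n * (U n \<omega> s - 1)) \<and> complete_record U n \<omega>}"
    have X: "?X = {\<omega> \<in> space M. complete_record U n \<omega>} - {\<omega> \<in> space M. \<forall>s. - real K < real n * (U n \<omega> s - 1)}"
      and Y: "?Y = {\<omega> \<in> space M. complete_record U n \<omega>} \<inter> {\<omega> \<in> space M. \<forall>s. - real K < real n * (U n \<omega> s - 1)}"
      by auto
    have "M.prob ?X = M.prob {\<omega> \<in> space M. complete_record U n \<omega>} - M.prob ?Y"
      unfolding X Y by (rule M.finite_measure_Diff'[OF rec_meas big_meas])
    then have "R n - A K n = real n * M.prob ?X" by (simp add: R_def A_def right_diff_distrib)
    also have "\<dots> \<le> M.prob {\<omega> \<in> space M. \<not> (\<forall>s. - real K < real n * (mx n \<omega> s - 1))}"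
      by (intro prob_record_le n pred_intros_logic pred)
    also have "\<dots> \<le> M.prob {\<omega> \<in> space M. b (W n \<omega>) + real K \<le> 0}"
    proof (rule M.finite_measure_mono)
      note [measurable] = measurable_W[OF n]
      show "{\<omega> \<in> space M. b (W n \<omega>) + real K \<le> 0} \<in> M.events" by measurable
      have "b x \<le> x s" for x s unfolding b_def using INF_diff_le[of "\<lambda>_. 0" 0 x s] by simp
      note b_le = this
      show "{\<omega> \<in> space M. \<not> (\<forall>s. - real K < real n * (mx n \<omega> s - 1))}
          \<subseteq> {\<omega> \<in> space M. b (W n \<omega>) + real K \<le> 0}"
        unfolding W_apply[symmetric]
      proof safe
        fix \<omega> s assume "\<not> - real K < W n \<omega> s"
        with b_le[of "W n \<omega>" s] show "b (W n \<omega>) + real K \<le> 0" by linarith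
      qed
    qed
    finally show ?thesis .
  qed
  \<comment> \<open>The bound 1 in place of 0 is the slack for the later passage from
    \<open>W n\<close> to \<eta>. The limit is 0 since each path of \<eta> is bounded.\<close>
  have b_tail: "(\<lambda>K. N.prob {\<omega> \<in> space N. b (\<eta> \<omega>) + real K \<le> 1}) \<longlonglongrightarrow> 0"
  proof -
    have "(\<lambda>K. \<integral>\<omega>. indicator {\<omega> \<in> space N. b (\<eta> \<omega>) + real K \<le> 1} \<omega> \<partial>N) \<longlonglongrightarrow> (\<integral>\<omega>. (0::real) \<partial>N)"
    proof (rule integral_dominated_convergence[where w = "\<lambda>_. 1"])
      show "AE \<omega> in N. (\<lambda>K. indicator {\<omega> \<in> space N. b (\<eta> \<omega>) + real K \<le> 1} \<omega> :: real) \<longlonglongrightarrow> 0"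
      proof (rule AE_I2)
        fix \<omega>
        obtain k :: nat where k: "1 - b (\<eta> \<omega>) < real k" using reals_Archimedean2 by blast
        have "eventually (\<lambda>K. indicator {\<omega> \<in> space N. b (\<eta> \<omega>) + real K \<le> 1} \<omega> = (0::real)) sequentially"
          using eventually_ge_at_top[of k] by eventually_elim (use k in auto)
        then show "(\<lambda>K. indicator {\<omega> \<in> space N. b (\<eta> \<omega>) + real K \<le> 1} \<omega> :: real) \<longlonglongrightarrow> 0"
          by (rule tendsto_eventually)
      qed
      show "(\<lambda>\<omega>. indicator {\<omega> \<in> space N. b (\<eta> \<omega>) + real K \<le> 1} \<omega> :: real) \<in> borel_measurable N" for K
        by (rule borel_measurable_indicator) measurable
    qed (auto simp: indicator_def)
    then show ?thesis by simp
  qed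
  have Psi_max_mono: "Psi_max (?k K) y \<le> Psi_max (?k K') y" if "K \<le> K'" for K K' y
  proof -
    have "Psi_max (?k K) y \<le> Psi_max (?k K') y + 0 * C"
    proof (rule Psi_mono_add[OF E_space_max_bcontfun[OF E] E_space_max_bcontfun[OF E]])
      show "max (y s) (- real K') \<le> max (y s) (- real K) + 0" for s using that by linarith
    qed simp
    then show ?thesis by simp
  qed
  have int: "integrable N (\<lambda>\<omega>. Psi_max (?k K) (\<eta> \<omega>))" for K
    using Psi_max_bound[OF E, of K "real K"]
    by (intro N.integrable_const_bound[where B = "real K * C"]) auto
  \<comment> \<open>The \<open>n\<close> events that one observation dominates the others are
    disjoint, so \<open>n\<close> times the record probability is at most 1. With monotonicity in
    \<open>K\<close> this bound also yields the integrability of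
    \<open>Psi (\<eta> \<omega>)\<close>.\<close>
  have a_le: "a K \<le> 1" for K
  proof (rule LIMSEQ_le_const2[OF lim_A])
    show "\<exists>N. \<forall>n\<ge>N. A K n \<le> 1"
      using order_trans[OF A_le_R R_le_1] by blast
  qed
  have "incseq a" unfolding incseq_def a_def by (intro allI impI integral_mono int Psi_max_mono)
  then obtain l where l: "a \<longlonglongrightarrow> l" using a_le by (blast intro: incseq_convergent)
  have eta_lim: "(\<lambda>K. Psi_max (?k K) (\<eta> \<omega>)) \<longlonglongrightarrow> Psi (\<eta> \<omega>)" for \<omega>
  proof -
    obtain c where c: "\<And>s. \<bar>\<eta> \<omega> s\<bar> \<le> c" using bcontfun_bounded[of "\<eta> \<omega>"] by blast
    obtain k :: nat where k: "c < real k" using reals_Archimedean2 by blast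
    have "eventually (\<lambda>K. Psi_max (?k K) (\<eta> \<omega>) = Psi (\<eta> \<omega>)) sequentially"
      using eventually_ge_at_top[of k]
    proof eventually_elim
      case (elim K)
      have "max (\<eta> \<omega> s) (- real K) = \<eta> \<omega> s" for s using c[of s] k elim by linarith
      then show ?case by simp
    qed
    then show ?thesis by (rule tendsto_eventually)
  qed
  have mc_int: "integrable N (\<lambda>\<omega>. Psi (\<eta> \<omega>))" and mc_eq: "(\<integral>\<omega>. Psi (\<eta> \<omega>) \<partial>N) = l"
  proof -
    note mc = integral_monotone_convergence_nonneg[where f = "\<lambda>K \<omega>. Psi_max (?k K) (\<eta> \<omega>)" and M = N
        and u = "\<lambda>\<omega>. Psi (\<eta> \<omega>)" and x = l, OF int _ _ _ l[unfolded a_def]]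
    show "integrable N (\<lambda>\<omega>. Psi (\<eta> \<omega>))"
      by (rule mc(1)) (auto simp: Psi_nonneg eta_lim Psi_max_mono intro!: monoI)
    show "(\<integral>\<omega>. Psi (\<eta> \<omega>) \<partial>N) = l"
      by (rule mc(2)) (auto simp: Psi_nonneg eta_lim Psi_max_mono intro!: monoI)
  qed
  show "integrable N (\<lambda>\<omega>. Psi (\<eta> \<omega>))" by (rule mc_int)
  have "R \<longlonglongrightarrow> l"
  proof (rule tendstoI)
    fix e :: real assume e: "0 < e"
    \<comment> \<open>Four quarters: \<open>a K\<close> against \<open>l\<close>,
      \<open>A K n\<close> against \<open>a K\<close>, the probability for \<eta> that bounds the
      truncation error, and the loss in passing from \<open>W n\<close> to \<eta>.\<close>
    have "eventually (\<lambda>K. dist (a K) l < e / 4 \<and> N.prob {\<omega> \<in> space N. b (\<eta> \<omega>) + real K \<le> 1} < e / 4) sequentially"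
      using e by (intro eventually_conj tendstoD[OF l] order_tendstoD[OF b_tail]) auto
    then obtain K where K: "dist (a K) l < e / 4" "N.prob {\<omega> \<in> space N. b (\<eta> \<omega>) + real K \<le> 1} < e / 4"
      unfolding eventually_sequentially by blast
    have "eventually (\<lambda>n. M.prob {\<omega> \<in> space M. b (W n \<omega>) + real K \<le> 0}
        \<le> N.prob {\<omega> \<in> space N. b (\<eta> \<omega>) + real K \<le> 1} + e / 4) sequentially"
      using e by (intro eventually_prob_W_le continuous_intros b) auto
    moreover have "eventually (\<lambda>n. dist (A K n) (a K) < e / 4) sequentially"
      using e by (intro tendstoD[OF lim_A]) auto
    ultimately show "eventually (\<lambda>n. dist (R n) l < e) sequentially"
      using eventually_ge_at_top[of 1]
    proof eventually_elim
      case (elim n)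
      then show ?case
        using R_le[of n K] A_le_R[of K n] K e unfolding dist_real_def by linarith
    qed
  qed
  then show "(\<lambda>n. real n * M.prob {\<omega> \<in> space M. complete_record U n \<omega>}) \<longlonglongrightarrow> (\<integral>\<omega>. Psi (\<eta> \<omega>) \<partial>N)"
    unfolding R_def mc_eq .
qed

text \<open>An infimum of positive numbers may be 0; here it is attained, since the weight is
  continuous on a compact space.\<close>

lemma Psi_pos:
  assumes Z: "0 < L.prob {\<omega> \<in> space L. \<forall>s. 0 < Z \<omega> s}" and y: "\<And>s. apply_bcontfun y s < 0"
  shows "0 < Psi y"
  unfolding Psi_def
proof (rule L.expectation_pos[OF integrable_INF_wt[OF E_space_bcontfun] INF_wt_nonneg Z])
  fix \<omega> assume \<omega>: "\<omega> \<in> {\<omega> \<in> space L. \<forall>s. 0 < Z \<omega> s}"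
  have "continuous_on UNIV (wt y \<omega>)"
    by (intro continuous_at_imp_continuous_on ballI isCont_wt isCont_bcontfun)
  then obtain x where x: "\<And>s. wt y \<omega> x \<le> wt y \<omega> s"
    using continuous_attains_inf[OF cpt] by (metis UNIV_I UNIV_not_empty)
  have "0 < wt y \<omega> x" unfolding wt_def using \<omega> y[of x] by (intro mult_pos_pos) auto
  also have "wt y \<omega> x \<le> (INF s. wt y \<omega> s)" by (intro cINF_greatest x) simp
  finally show "0 < (INF s. wt y \<omega> s)" .
qed

text \<open>It suffices that \<eta> stays below \<open>- 1\<close> with positive probability, namely
  \<open>exp (- C)\<close>.\<close>

lemma expectation_Psi_\<eta>_pos:
  assumes Z: "0 < L.prob {\<omega> \<in> space L. \<forall>s. 0 < Z \<omega> s}"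
  shows "0 < (\<integral>\<omega>. Psi (\<eta> \<omega>) \<partial>N)"
proof (rule N.expectation_pos[OF tendsto_prob_complete_record(1) Psi_nonneg])
  have "(\<lambda>_. - 1) \<in> E_minus" by (simp add: E_minus_def E_space_def)
  from prob_\<eta>_le[OF this] show "0 < N.prob {\<omega> \<in> space N. \<forall>s. \<eta> \<omega> s \<le> - 1}" by simp
  show "0 < Psi (\<eta> \<omega>)" if "\<omega> \<in> {\<omega> \<in> space N. \<forall>s. \<eta> \<omega> s \<le> - 1}" for \<omega>
  proof (rule Psi_pos[OF Z])
    show "\<eta> \<omega> s < 0" for s
    proof -
      have "\<eta> \<omega> s \<le> - 1" using that by blast
      then show ?thesis by simp
    qed
  qed
qed

text \<open>The two integrands agree where \<eta> is nonpositive, hence almost surely. The dual norm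
  is \<open>Psi\<close> at the negative absolute value of its argument, which makes it measurable in
  the path as well.\<close>

lemma integral_Psi_eq_dual_D_norm:
  fixes H :: "('s \<Rightarrow>\<^sub>C real) \<Rightarrow> 's \<Rightarrow> real"
  assumes E: "\<And>x. H x \<in> E_space" "\<And>x. (\<lambda>s. - \<bar>H x s\<bar>) \<in> E_space"
    and lip: "\<And>x y s. \<bar>H x s - H y s\<bar> \<le> \<bar>apply_bcontfun x s - apply_bcontfun y s\<bar>"
    and nonpos: "\<And>x s. (\<And>s. apply_bcontfun x s \<le> 0) \<Longrightarrow> H x s \<le> 0"
  shows "(\<integral>\<omega>. Psi (H (\<eta> \<omega>)) \<partial>N) = (\<integral>\<omega>. dual_D_norm L Z (H (\<eta> \<omega>)) \<partial>N)"
proof -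
  have dual: "dual_D_norm L Z (H x) = Psi (\<lambda>s. - \<bar>H x s\<bar>)" for x
    by (subst Psi_eq_dual_D_norm) (auto simp: dual_D_norm_def)
  have "\<bar>- \<bar>H x s\<bar> - - \<bar>H y s\<bar>\<bar> \<le> \<bar>apply_bcontfun x s - apply_bcontfun y s\<bar>" for x y s
    using lip[of x s y] by linarith
  then have [measurable]: "(\<lambda>x. Psi (\<lambda>s. - \<bar>H x s\<bar>)) \<in> borel_measurable borel"
    by (intro borel_measurable_continuous_onI continuous_on_Psi E)
  have [measurable]: "(\<lambda>x. Psi (H x)) \<in> borel_measurable borel"
    by (intro borel_measurable_continuous_onI continuous_on_Psi E lip)
  show ?thesis
  proof (rule integral_cong_AE)
    show "AE \<omega> in N. Psi (H (\<eta> \<omega>)) = dual_D_norm L Z (H (\<eta> \<omega>))"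
      using AE_\<eta>_nonpos by eventually_elim (intro Psi_eq_dual_D_norm nonpos, blast)
  qed (simp_all add: dual)
qed

lemma E_space_neg_abs:
  assumes "f \<in> E_space" shows "(\<lambda>s. - \<bar>f s\<bar>) \<in> E_space"
proof -
  obtain b where "\<And>s. \<bar>f s\<bar> \<le> b" using E_space_range_bounded[OF assms] by metis
  then show ?thesis by (intro E_spaceI[OF assms, where c = b]) (auto intro!: continuous_intros)
qed

end

theorem proposition3p7:
  fixes M :: "'a measure" and N :: "'b measure" and L :: "'c measure"
    and U :: "nat \<Rightarrow> 'a \<Rightarrow> ('s::metric_space \<Rightarrow>\<^sub>C real)"
    and \<eta> :: "'b \<Rightarrow> ('s \<Rightarrow>\<^sub>C real)"
    and Z :: "'c \<Rightarrow> ('s \<Rightarrow>\<^sub>C real)"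
    and f :: "'s \<Rightarrow> real"
  assumes "compact (UNIV :: 's set)"
    and "prob_space M" and "prob_space N" and "prob_space L"
    and "\<And>i. copula_process M (U i)"
    and "prob_space.indep_vars M (\<lambda>_. borel) U UNIV"
    and "\<And>i. distr M borel (U i) = distr M borel (U 0)"
    and "standard_max_stable N \<eta>"
    and "in_max_domain M (U 0) N \<eta>"
    and "D_norm_generator L Z N \<eta>"
    and "\<P>(\<omega> in L. \<forall>s. Z \<omega> s > 0) > 0"
    and "f \<in> E_minus"
  shows "(\<lambda>n. \<P>(\<omega> in M. (\<forall>s. real n * (U n \<omega> s - 1) > f s) \<bar> complete_record U n \<omega>))
           \<longlonglongrightarrow> (\<integral>\<omega>. dual_D_norm L Z (\<lambda>s. max (\<eta> \<omega> s) (f s)) \<partial>N)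
               / (\<integral>\<omega>. dual_D_norm L Z (apply_bcontfun (\<eta> \<omega>)) \<partial>N)"
proof -
  interpret M: prob_space M by (rule assms(2))
  interpret N: prob_space N by (rule assms(3))
  interpret L: prob_space L by (rule assms(4))
  have gen: "Z \<in> borel_measurable L" "\<And>\<omega> s. \<omega> \<in> space L \<Longrightarrow> 0 \<le> Z \<omega> s"
    "integrable L (\<lambda>\<omega>. SUP s. Z \<omega> s)"
    "\<And>f. f \<in> E_minus \<Longrightarrow> N.prob {\<omega> \<in> space N. \<forall>s. \<eta> \<omega> s \<le> f s} = exp (- D_norm L Z f)"
    using assms(10) unfolding D_norm_generator_def by auto
  interpret record_setting L Z M N U \<eta>
  proof unfold_locales
    show "U i \<in> borel_measurable M" for i
      using assms(5)[of i] unfolding copula_process_def by blast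
    show "\<eta> \<in> borel_measurable N"
      using assms(8) unfolding standard_max_stable_def by blast
  qed (fact assms(1) assms(6) assms(7) assms(9) gen)+
  have f: "f \<in> E_space" "\<And>s. f s \<le> 0" using assms(12) by (auto simp: E_minus_def)
  have num: "(\<integral>\<omega>. Psi_max f (\<eta> \<omega>) \<partial>N) = (\<integral>\<omega>. dual_D_norm L Z (\<lambda>s. max (\<eta> \<omega> s) (f s)) \<partial>N)"
  proof (rule integral_Psi_eq_dual_D_norm)
    show E: "(\<lambda>s. max (apply_bcontfun x s) (f s)) \<in> E_space" for x
      by (rule E_space_max_bcontfun[OF f(1)])
    show "(\<lambda>s. - \<bar>max (apply_bcontfun x s) (f s)\<bar>) \<in> E_space" for x
      by (rule E_space_neg_abs[OF E])
    show "\<bar>max (apply_bcontfun x s) (f s) - max (apply_bcontfun y s) (f s)\<bar> \<le> \<bar>apply_bcontfun x s - apply_bcontfun y s\<bar>"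
      for x y s by linarith
  qed (simp add: f(2))
  have den: "(\<integral>\<omega>. Psi (\<eta> \<omega>) \<partial>N) = (\<integral>\<omega>. dual_D_norm L Z (apply_bcontfun (\<eta> \<omega>)) \<partial>N)"
    by (rule integral_Psi_eq_dual_D_norm) (auto intro!: E_space_neg_abs E_space_bcontfun)
  let ?A = "\<lambda>n. M.prob {\<omega> \<in> space M. (\<forall>s. f s < real n * (U n \<omega> s - 1)) \<and> complete_record U n \<omega>}"
  let ?R = "\<lambda>n. M.prob {\<omega> \<in> space M. complete_record U n \<omega>}"
  \<comment> \<open>Both probabilities tend to 0; multiplied by \<open>n\<close> they have finite
    limits, and the limit of the denominator is positive because \<open>Z\<close> is positive with
    positive probability.\<close>
  have "(\<lambda>n. (real n * ?A n) / (real n * ?R n)) \<longlonglongrightarrow> (\<integral>\<omega>. Psi_max f (\<eta> \<omega>) \<partial>N) / (\<integral>\<omega>. Psi (\<eta> \<omega>) \<partial>N)"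
    using expectation_Psi_\<eta>_pos[OF assms(11)]
    by (intro tendsto_divide tendsto_prob_record[OF f(1)] tendsto_prob_complete_record(2)) simp
  moreover have "eventually (\<lambda>n. (real n * ?A n) / (real n * ?R n)
      = \<P>(\<omega> in M. (\<forall>s. real n * (U n \<omega> s - 1) > f s) \<bar> complete_record U n \<omega>)) sequentially"
    using eventually_ge_at_top[of 1] by eventually_elim (simp add: cond_prob_def)
  ultimately show ?thesis
    unfolding num den by (rule Lim_transform_eventually)
qed

end
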